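(* Let $\Omega\subset\mathbb{R}^3$ be a bounded domain with smooth boundary, and let $a_1,a_2,a_3\in\mathcal{C}^1(\overline{\Omega},\mathbb{R})$, where each $a_\ell$ depends only on the variable $x_\ell$. Consider the vector operator $$T=e_1a_1(x_1)\partial_{x_1}+e_2a_2(x_2)\partial_{x_2}+e_3a_3(x_3)\partial_{x_3}$$ on $L^2(\Omega,\mathbb{H})$ with homogeneous Dirichlet boundary conditions. Assume $$\inf_{x\in\Omega}a_\ell(x_\ell)^2-\frac{\sqrt{C_\Omega}}{2}\big\|\partial_{x_\ell}(a_\ell(x_\ell)^2)\big\|_\infty>0,\qquad \ell=1,2,3,$$ and $$\frac12-\frac12\|\Phi\|_\infty^2\,C_\Omega^2\,C_a^2>0,$$ where $\Phi(x):=\sum_{\ell=1}^3 e_\ell\,\partial_{x_\ell}a_\ell(x_\ell)$ and $C_a:=\sup_{x\in\Omega,\ \ell=1,2,3}\frac{1}{|a_\ell(x_\ell)|}=\big(\inf_{x\in\Omega,\ \ell=1,2,3}|a_\ell(x_\ell)|\big)^{-1}$. Then every $s\in\mathbb{H}\setminus\{0\}$ with $\Re(s)=0$ belongs to the $S$-resolvent set $\rho_S(T)$. Moreover, there is a constant $\Theta>0$ independent of $s$ such that $$\|S_L^{-1}(s,T)\|_{\mathcal{B}(L^2)}\le\frac{\Theta}{|s|}\quad\text{and}\quad\|S_R^{-1}(s,T)\|_{\mathcal{B}(L^2)}\le\frac{\Theta}{|s|}\qquad\text{for all } s\in\mathbb{H}\setminus\{0\},\ \Re(s)=0.$$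
   Context: $\mathbb{H}$ denotes the quaternions with units $1,e_1,e_2,e_3$, $e_\ell^2=-1$, $e_\ell e_m=-e_me_\ell$ for $\ell\ne m$; for $p=\xi_0+\sum\xi_\ell e_\ell$, $\Re(p)=\xi_0$, $\overline{p}=\xi_0-\sum\xi_\ell e_\ell$. $L^2=L^2(\Omega,\mathbb{H})$ is the quaternionic Hilbert space of square-integrable $\mathbb{H}$-valued functions with inner product $\langle u,v\rangle=\int_\Omega\overline{u(x)}v(x)\,dx$; $H_0^1(\Omega,\mathbb{H})$ is the closure of $\mathcal{C}_c^\infty(\Omega,\mathbb{H})$ in the quaternionic Sobolev space $H^1(\Omega,\mathbb{H})$ (componentwise $H^1$). $C_\Omega$ is a Poincaré constant of $\Omega$ chosen so that $\|u\|_{L^2}\le C_\Omega\|\partial_{x_\ell}u\|_{L^2}$ for all $u\in H_0^1(\Omega,\mathbb{H})$ and each $\ell=1,2,3$ (and also $\|u\|_{L^2}^2\le C_\Omega^2\sum_{\ell}\|\partial_{x_\ell}u\|_{L^2}^2$). $\mathcal{B}(L^2)$ is the space of bounded right-linear operators on $L^2$ with operator norm. For a closed right-linear operator $T$ and $s\in\mathbb{H}$, $\mathcal{Q}_s(T):=T^2-2\Re(s)T+|s|^2\mathcal{I}$ (here understood with homogeneous Dirichlet conditions, i.e. weakly via its form on $H_0^1(\Omega,\mathbb{H})$). The $S$-resolvent set is $\rho_S(T)=\{s\in\mathbb{H}:\mathcal{Q}_s(T)^{-1}\in\mathcal{B}(L^2)\}$. For $s\in\rho_S(T)$ the left and right $S$-resolvent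 operators are $S_L^{-1}(s,T):=\mathcal{Q}_s(T)^{-1}\overline{s}-T\mathcal{Q}_s(T)^{-1}$ and $S_R^{-1}(s,T):=-(T-\mathcal{I}\overline{s})\mathcal{Q}_s(T)^{-1}$. *)

theory Defs
  imports "HOL-Analysis.Analysis"
begin

section \<open>Quaternions, modelled on real^4 (index 0 = real part, 1,2,3 = e1,e2,e3)\<close>

type_synonym quat = "real^4"

definition qmul :: "quat \<Rightarrow> quat \<Rightarrow> quat" where
  "qmul p q = (\<chi> i.
     if i = 0 then p$0*q$0 - p$1*q$1 - p$2*q$2 - p$3*q$3
     else if i = 1 then p$0*q$1 + p$1*q$0 + p$2*q$3 - p$3*q$2
     else if i = 2 then p$0*q$2 - p$1*q$3 + p$2*q$0 + p$3*q$1
     else p$0*q$3 + p$1*q$2 - p$2*q$1 + p$3*q$0)"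

definition qcnj :: "quat \<Rightarrow> quat" where
  "qcnj p = (\<chi> i. if i = 0 then p$i else - p$i)"

definition qRe :: "quat \<Rightarrow> real" where
  "qRe p = p$0"

text \<open>Imaginary units: qe 0 = e1, qe 1 = e2, qe 2 = e3 (the coordinate index l :: 3 of
  real^3 is 0-based, so coordinate l corresponds to x_{l+1} and unit e_{l+1}).\<close>
definition qe :: "3 \<Rightarrow> quat" where
  "qe l = (\<chi> i. if (i = 1 \<and> l = 0) \<or> (i = 2 \<and> l = 1) \<or> (i = 3 \<and> l = 2) then 1 else 0)"

fun ipd :: "3 list \<Rightarrow> (real^3 \<Rightarrow> real) \<Rightarrow> real^3 \<Rightarrow> real" where
  "ipd [] f = f"
| "ipd (l # ls) f = (\<lambda>x. deriv (\<lambda>t. ipd ls f (x + t *\<^sub>R axis l 1)) 0)"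

definition smooth_on :: "(real^3) set \<Rightarrow> (real^3 \<Rightarrow> real) \<Rightarrow> bool" where
  "smooth_on U f \<longleftrightarrow> (\<forall>ls. continuous_on U (ipd ls f) \<and>
      (\<forall>l. \<forall>x\<in>U. (\<lambda>t. ipd ls f (x + t *\<^sub>R axis l 1)) differentiable (at 0)))"

definition smooth_boundary :: "(real^3) set \<Rightarrow> bool" where
  "smooth_boundary \<Omega> \<longleftrightarrow> (\<forall>p\<in>frontier \<Omega>. \<exists>r>0. \<exists>\<psi>.
      smooth_on (ball p r) \<psi> \<and> (\<forall>x\<in>ball p r. \<exists>l. ipd [l] \<psi> x \<noteq> 0) \<and>
      \<Omega> \<inter> ball p r = {x\<in>ball p r. \<psi> x < 0})"

definition bounded_smooth_domain :: "(real^3) set \<Rightarrow> bool" where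
  "bounded_smooth_domain \<Omega> \<longleftrightarrow> open \<Omega> \<and> connected \<Omega> \<and> \<Omega> \<noteq> {} \<and> bounded \<Omega> \<and> smooth_boundary \<Omega>"

definition test_fun :: "(real^3) set \<Rightarrow> (real^3 \<Rightarrow> real) \<Rightarrow> bool" where
  "test_fun \<Omega> \<phi> \<longleftrightarrow> smooth_on UNIV \<phi> \<and> (\<exists>K. compact K \<and> K \<subseteq> \<Omega> \<and> (\<forall>x. x \<notin> K \<longrightarrow> \<phi> x = 0))"

definition qtest :: "(real^3) set \<Rightarrow> (real^3 \<Rightarrow> quat) \<Rightarrow> bool" where
  "qtest \<Omega> \<phi> \<longleftrightarrow> (\<forall>i. test_fun \<Omega> (\<lambda>x. \<phi> x $ i))"

definition qpd :: "3 \<Rightarrow> (real^3 \<Rightarrow> quat) \<Rightarrow> real^3 \<Rightarrow> quat" where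
  "qpd l \<phi> x = (\<chi> i. ipd [l] (\<lambda>y. \<phi> y $ i) x)"

definition L2 :: "(real^3) set \<Rightarrow> (real^3 \<Rightarrow> quat) \<Rightarrow> bool" where
  "L2 \<Omega> u \<longleftrightarrow> set_borel_measurable lebesgue \<Omega> u \<and>
     set_integrable lebesgue \<Omega> (\<lambda>x. (norm (u x))\<^sup>2)"

definition L2norm :: "(real^3) set \<Rightarrow> (real^3 \<Rightarrow> quat) \<Rightarrow> real" where
  "L2norm \<Omega> u = sqrt (LINT x:\<Omega>|lebesgue. (norm (u x))\<^sup>2)"

definition qinner :: "(real^3) set \<Rightarrow> (real^3 \<Rightarrow> quat) \<Rightarrow> (real^3 \<Rightarrow> quat) \<Rightarrow> quat" where
  "qinner \<Omega> u v = (LINT x:\<Omega>|lebesgue. qmul (qcnj (u x)) (v x))"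

definition weak_partial :: "(real^3) set \<Rightarrow> 3 \<Rightarrow> (real^3 \<Rightarrow> quat) \<Rightarrow> (real^3 \<Rightarrow> quat) \<Rightarrow> bool" where
  "weak_partial \<Omega> l u g \<longleftrightarrow> (\<forall>\<phi>. test_fun \<Omega> \<phi> \<longrightarrow>
     (LINT x:\<Omega>|lebesgue. ipd [l] \<phi> x *\<^sub>R u x) = - (LINT x:\<Omega>|lebesgue. \<phi> x *\<^sub>R g x))"

definition wpd :: "(real^3) set \<Rightarrow> 3 \<Rightarrow> (real^3 \<Rightarrow> quat) \<Rightarrow> real^3 \<Rightarrow> quat" where
  "wpd \<Omega> l u = (SOME g. L2 \<Omega> g \<and> weak_partial \<Omega> l u g)"

definition H1 :: "(real^3) set \<Rightarrow> (real^3 \<Rightarrow> quat) \<Rightarrow> bool" where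
  "H1 \<Omega> u \<longleftrightarrow> L2 \<Omega> u \<and> (\<forall>l. \<exists>g. L2 \<Omega> g \<and> weak_partial \<Omega> l u g)"

definition H01 :: "(real^3) set \<Rightarrow> (real^3 \<Rightarrow> quat) \<Rightarrow> bool" where
  "H01 \<Omega> u \<longleftrightarrow> H1 \<Omega> u \<and> (\<exists>\<phi>s. (\<forall>n. qtest \<Omega> (\<phi>s n)) \<and>
     (\<lambda>n. (L2norm \<Omega> (\<lambda>x. \<phi>s n x - u x))\<^sup>2 +
          (\<Sum>l\<in>UNIV. (L2norm \<Omega> (\<lambda>x. qpd l (\<phi>s n) x - wpd \<Omega> l u x))\<^sup>2)) \<longlonglongrightarrow> 0)"

definition Top :: "(real^3) set \<Rightarrow> (3 \<Rightarrow> real \<Rightarrow> real) \<Rightarrow> (real^3 \<Rightarrow> quat) \<Rightarrow> real^3 \<Rightarrow> quat" where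
  "Top \<Omega> a u x = (\<Sum>l\<in>UNIV. qmul (qe l) (a l (x$l) *\<^sub>R wpd \<Omega> l u x))"

text \<open>Formal adjoint applied to a test function: \<Sum> e_l \<partial>_l(a_l \<phi>), so that the
  distribution T v is defined by <T v, \<phi>> = <v, Tadj \<phi>>.\<close>
definition Tadj :: "(3 \<Rightarrow> real \<Rightarrow> real) \<Rightarrow> (real^3 \<Rightarrow> quat) \<Rightarrow> real^3 \<Rightarrow> quat" where
  "Tadj a \<phi> x = (\<Sum>l\<in>UNIV. qmul (qe l) (deriv (a l) (x$l) *\<^sub>R \<phi> x + a l (x$l) *\<^sub>R qpd l \<phi> x))"

text \<open>u \<in> H^1_0 solves Q_s(T) u = f weakly (homogeneous Dirichlet conditions).\<close>
definition weak_sol :: "(real^3) set \<Rightarrow> (3 \<Rightarrow> real \<Rightarrow> real) \<Rightarrow> quat \<Rightarrow> (real^3 \<Rightarrow> quat) \<Rightarrow> (real^3 \<Rightarrow> quat) \<Rightarrow> bool" where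
  "weak_sol \<Omega> a s f u \<longleftrightarrow> H01 \<Omega> u \<and> (\<forall>\<phi>. qtest \<Omega> \<phi> \<longrightarrow>
     qinner \<Omega> (Top \<Omega> a u) (Tadj a \<phi>) - (2 * qRe s) *\<^sub>R qinner \<Omega> (Top \<Omega> a u) \<phi>
       + (norm s)\<^sup>2 *\<^sub>R qinner \<Omega> u \<phi> = qinner \<Omega> f \<phi>)"

definition Qinv :: "(real^3) set \<Rightarrow> (3 \<Rightarrow> real \<Rightarrow> real) \<Rightarrow> quat \<Rightarrow> (real^3 \<Rightarrow> quat) \<Rightarrow> real^3 \<Rightarrow> quat" where
  "Qinv \<Omega> a s f = (SOME u. weak_sol \<Omega> a s f u)"

definition rho_S :: "(real^3) set \<Rightarrow> (3 \<Rightarrow> real \<Rightarrow> real) \<Rightarrow> quat set" where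
  "rho_S \<Omega> a = {s. (\<forall>f. L2 \<Omega> f \<longrightarrow> (\<exists>u. weak_sol \<Omega> a s f u)) \<and>
     (\<forall>f u v. L2 \<Omega> f \<longrightarrow> weak_sol \<Omega> a s f u \<longrightarrow> weak_sol \<Omega> a s f v \<longrightarrow>
        (AE x in lebesgue. x \<in> \<Omega> \<longrightarrow> u x = v x)) \<and>
     (\<exists>C. \<forall>f. L2 \<Omega> f \<longrightarrow> L2norm \<Omega> (Qinv \<Omega> a s f) \<le> C * L2norm \<Omega> f)}"

text \<open>Left and right S-resolvent operators (two-sided module convention:
  (A q)(v) = A(q v), (I q)(v) = q v).\<close>
definition SL :: "(real^3) set \<Rightarrow> (3 \<Rightarrow> real \<Rightarrow> real) \<Rightarrow> quat \<Rightarrow> (real^3 \<Rightarrow> quat) \<Rightarrow> real^3 \<Rightarrow> quat" where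
  "SL \<Omega> a s f x = Qinv \<Omega> a s (\<lambda>y. qmul (qcnj s) (f y)) x - Top \<Omega> a (Qinv \<Omega> a s f) x"

definition SR :: "(real^3) set \<Rightarrow> (3 \<Rightarrow> real \<Rightarrow> real) \<Rightarrow> quat \<Rightarrow> (real^3 \<Rightarrow> quat) \<Rightarrow> real^3 \<Rightarrow> quat" where
  "SR \<Omega> a s f x = - (Top \<Omega> a (Qinv \<Omega> a s f) x - qmul (qcnj s) (Qinv \<Omega> a s f x))"

definition poincare_const :: "(real^3) set \<Rightarrow> real \<Rightarrow> bool" where
  "poincare_const \<Omega> C \<longleftrightarrow> C > 0 \<and> (\<forall>u. H01 \<Omega> u \<longrightarrow>
     (\<forall>l. L2norm \<Omega> u \<le> C * L2norm \<Omega> (wpd \<Omega> l u)) \<and>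
     (L2norm \<Omega> u)\<^sup>2 \<le> C\<^sup>2 * (\<Sum>l\<in>UNIV. (L2norm \<Omega> (wpd \<Omega> l u))\<^sup>2))"

definition Phi :: "(3 \<Rightarrow> real \<Rightarrow> real) \<Rightarrow> real^3 \<Rightarrow> quat" where
  "Phi a x = (\<Sum>l\<in>UNIV. deriv (a l) (x$l) *\<^sub>R qe l)"

definition Ca :: "(real^3) set \<Rightarrow> (3 \<Rightarrow> real \<Rightarrow> real) \<Rightarrow> real" where
  "Ca \<Omega> a = 1 / (INF p\<in>\<Omega> \<times> UNIV. \<bar>a (snd p) (fst p $ snd p)\<bar>)"

end

theory Submission
  imports Defs
begin

text \<open>Since \<open>a\<^sub>l\<close> depends on \<open>x\<^sub>l\<close> only, the operators \<open>a\<^sub>l \<partial>\<^sub>l\<close> commute, whereas the units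
  anticommute; hence the mixed terms of \<open>T\<^sup>2\<close> cancel and, for a test function \<open>\<phi>\<close>, the real part of
  the form is \<open>\<Sum>\<^sub>l \<langle>a\<^sub>l \<partial>\<^sub>l \<phi>, a\<^sub>l \<partial>\<^sub>l \<phi> + a\<^sub>l' \<phi>\<rangle>\<close>. Young's inequality and the Poincare inequality bound
  it below by \<open>(m\<^sup>2 - \<parallel>\<Phi>\<parallel>\<^sup>2 C\<^sup>2) / 2\<close> times the squared norm of the gradient, where \<open>m = 1 / C\<^sub>a\<close>, so that
  the form is coercive on \<open>H\<^sup>1\<^sub>0\<close>.
  A Lax--Milgram argument produces the weak solution \<open>u\<close> of \<open>Q\<^sub>s(T) u = f\<close>. For \<open>\<Re> s = 0\<close>, testing with
  \<open>u\<close> itself gives \<open>c \<parallel>\<nabla>u\<parallel>\<^sup>2 + |s|\<^sup>2 \<parallel>u\<parallel>\<^sup>2 \<le> \<parallel>f\<parallel> \<parallel>u\<parallel>\<close>, so \<open>\<parallel>u\<parallel> \<le> \<parallel>f\<parallel> / |s|\<^sup>2\<close> and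
  \<open>\<parallel>\<nabla>u\<parallel> \<le> \<parallel>f\<parallel> / (\<surd>c |s|)\<close>, which are the resolvent estimates.\<close>

section \<open>The Lax--Milgram theorem without completeness\<close>

text \<open>Functions are not identified almost everywhere, \<open>H01\<close> is a predicate and
  \<open>wpd\<close> an arbitrary choice of weak derivative, so no Hilbert space is at hand. The
  form is therefore studied on test functions: there Lax--Milgram is proved up to every \<epsilon>,
  coercivity makes the approximate solutions a Cauchy sequence, and completeness enters once, as
  Riesz--Fischer for limits of 1-jets. Test functions also have the second derivatives on which the
  cancellation of the mixed terms rests; the resulting inequality is of first order and passes to
  limits of jets. To return from such a limit to \<open>H01\<close>, its gradient part must agree
  a.e. with \<open>wpd\<close>; this calls for the fundamental lemma of the calculus of variations,
  hence for explicit smooth bumps. The quaternionic equation amounts to four real ones, obtained by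
  multiplying test functions on the right by conjugate units. The formal adjoint of T commutes with
  right multiplication by constants, so a single real bilinear form suffices.\<close>

lemma quadratic_nonneg_discriminant:
  fixes A B C :: real
  assumes "\<And>t. 0 \<le> A + 2 * t * B + t\<^sup>2 * C" and "0 \<le> C"
  shows "B\<^sup>2 \<le> A * C"
proof (cases "C = 0")
  case True
  have "B = 0"
  proof (rule ccontr)
    assume "B \<noteq> 0"
    \<comment> \<open>For \<open>C = 0\<close> the quadratic is affine, and at this \<open>t\<close>
      its value is -1.\<close>
    with assms(1)[of "- (A + 1) / (2 * B)"] True show False
      by (simp add: field_simps)
  qed
  with True show ?thesis by simp
next
  case False
  with assms(2) have C: "0 < C" by simp
  have "0 \<le> (A + 2 * (- B / C) * B + (- B / C)\<^sup>2 * C) * C"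
    using assms(1)[of "- B / C"] C by (intro mult_nonneg_nonneg) auto
  also have "\<dots> = A * C - B\<^sup>2"
    using C by (simp add: field_simps power2_eq_square)
  finally show ?thesis by simp
qed

text \<open>The single operation \<open>comb u t v\<close> stands for \<open>u + t v\<close>, so that spaces of functions
  need no vector space type.\<close>

locale prehilbert =
  fixes V :: "'v set" and comb :: "'v \<Rightarrow> real \<Rightarrow> 'v \<Rightarrow> 'v" and ip :: "'v \<Rightarrow> 'v \<Rightarrow> real"
  assumes nonempty: "V \<noteq> {}"
    and comb_in: "u \<in> V \<Longrightarrow> v \<in> V \<Longrightarrow> comb u t v \<in> V"
    and ip_comb: "u \<in> V \<Longrightarrow> v \<in> V \<Longrightarrow> w \<in> V \<Longrightarrow> ip (comb u t v) w = ip u w + t * ip v w"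
    and ip_sym: "u \<in> V \<Longrightarrow> v \<in> V \<Longrightarrow> ip u v = ip v u"
    and ip_nonneg: "u \<in> V \<Longrightarrow> 0 \<le> ip u u"
begin

definition nrm :: "'v \<Rightarrow> real" where "nrm u = sqrt (ip u u)"

definition lin :: "('v \<Rightarrow> real) \<Rightarrow> bool" where
  "lin G \<longleftrightarrow> (\<forall>u\<in>V. \<forall>v\<in>V. \<forall>t. G (comb u t v) = G u + t * G v)"

lemma nrm_nonneg: "u \<in> V \<Longrightarrow> 0 \<le> nrm u"
  by (simp add: nrm_def ip_nonneg)

lemma nrm_sq: "u \<in> V \<Longrightarrow> (nrm u)\<^sup>2 = ip u u"
  by (simp add: nrm_def ip_nonneg)

lemma ip_comb_right:
  "u \<in> V \<Longrightarrow> v \<in> V \<Longrightarrow> w \<in> V \<Longrightarrow> ip w (comb u t v) = ip w u + t * ip w v"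
  using ip_comb[of u v w t] ip_sym[of w u] ip_sym[of w v] ip_sym[OF _ comb_in, of w u v t] by simp

lemma ip_comb_self:
  assumes "u \<in> V" "v \<in> V"
  shows "ip (comb u t v) (comb u t v) = ip u u + 2 * t * ip u v + t\<^sup>2 * ip v v"
  using assms by (simp add: ip_comb ip_comb_right comb_in ip_sym[of v u] algebra_simps power2_eq_square)

lemma ip_bound:
  assumes "u \<in> V" "v \<in> V"
  shows "\<bar>ip u v\<bar> \<le> nrm u * nrm v"
proof -
  have "(ip u v)\<^sup>2 \<le> ip u u * ip v v"
  proof (rule quadratic_nonneg_discriminant)
    show "0 \<le> ip u u + 2 * t * ip u v + t\<^sup>2 * ip v v" for t
      using ip_nonneg[OF comb_in[OF assms, of t]] ip_comb_self[OF assms, of t] by simp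
  qed (use assms ip_nonneg in simp)
  then have "\<bar>ip u v\<bar>\<^sup>2 \<le> (nrm u * nrm v)\<^sup>2"
    using assms by (simp add: power_mult_distrib nrm_sq)
  then show ?thesis
    by (rule power2_le_imp_le) (use assms in \<open>simp add: nrm_nonneg\<close>)
qed

text \<open>Riesz representation up to \<open>\<epsilon>\<close>: take a near-minimiser of \<open>g \<mapsto> \<parallel>g\<parallel>\<^sup>2 / 2 - G g\<close>.\<close>

lemma approximate_riesz:
  assumes G: "lin G" and bd: "\<And>v. v \<in> V \<Longrightarrow> \<bar>G v\<bar> \<le> K * nrm v" and e: "0 < \<epsilon>"
  obtains g where "g \<in> V" "\<And>v. v \<in> V \<Longrightarrow> \<bar>G v - ip g v\<bar> \<le> \<epsilon> * nrm v"
proof -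
  define J where "J g = ip g g / 2 - G g" for g
  have low: "- K\<^sup>2 / 2 \<le> J v" if "v \<in> V" for v
  proof -
    have "J v \<ge> (nrm v)\<^sup>2 / 2 - K * nrm v"
      using bd[OF that] that by (auto simp: J_def nrm_sq)
    moreover have "0 \<le> (nrm v - K)\<^sup>2" by simp
    ultimately show ?thesis by (simp add: power2_diff algebra_simps)
  qed
  have bdd: "bdd_below (J ` V)" using low by (intro bdd_belowI2)
  have "\<exists>y\<in>J ` V. y < Inf (J ` V) + \<epsilon>\<^sup>2 / 2"
    using nonempty bdd e by (subst cInf_less_iff[symmetric]) auto
  then obtain g where g: "g \<in> V" "J g < Inf (J ` V) + \<epsilon>\<^sup>2 / 2" by auto
  have "\<bar>G v - ip g v\<bar> \<le> \<epsilon> * nrm v" if v: "v \<in> V" for v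
  proof -
    \<comment> \<open>Moving from \<open>g\<close> in direction \<open>v\<close> cannot lower
      \<open>J\<close> by more than \<epsilon>^2/2. Doubled, this says that a quadratic in
      \<open>t\<close> has no negative value, and its discriminant is the claim; hence the tolerance
      chosen for \<open>g\<close>.\<close>
    have "(ip g v - G v)\<^sup>2 \<le> \<epsilon>\<^sup>2 * ip v v"
    proof (rule quadratic_nonneg_discriminant)
      fix t
      have "Inf (J ` V) \<le> J (comb g t v)"
        using bdd g v comb_in by (intro cInf_lower) auto
      also have "J (comb g t v) = J g + t * (ip g v - G v) + t\<^sup>2 * ip v v / 2"
        using g v G by (simp add: J_def ip_comb_self lin_def field_simps)
      finally show "0 \<le> \<epsilon>\<^sup>2 + 2 * t * (ip g v - G v) + t\<^sup>2 * ip v v"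
        using g by simp
    qed (use v ip_nonneg in auto)
    then have "\<bar>G v - ip g v\<bar>\<^sup>2 \<le> (\<epsilon> * nrm v)\<^sup>2"
      using v by (simp only: power2_abs power2_commute[of "G v" "ip g v"] power_mult_distrib nrm_sq)
    then show ?thesis by (rule power2_le_imp_le) (use e v in \<open>simp add: nrm_nonneg\<close>)
  qed
  with g that show ?thesis by blast
qed

text \<open>The residual \<open>F - \<beta> u\<close> shrinks by a fixed factor when \<open>u\<close> is moved along the approximate
  Riesz representative of the residual.\<close>

lemma residual_step:
  assumes lin1: "\<And>w. w \<in> V \<Longrightarrow> lin (\<lambda>u. \<beta> u w)" and lin2: "\<And>u. u \<in> V \<Longrightarrow> lin (\<beta> u)"
    and F: "lin F"
    and bd: "\<And>u v. u \<in> V \<Longrightarrow> v \<in> V \<Longrightarrow> \<bar>\<beta> u v\<bar> \<le> M * nrm u * nrm v"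
    and coer: "\<And>u. u \<in> V \<Longrightarrow> c * (nrm u)\<^sup>2 \<le> \<beta> u u"
    and M: "0 < M" and c: "0 < c" and e: "0 < \<epsilon>" and r: "0 \<le> r"
    and u: "u \<in> V" and res: "\<And>v. v \<in> V \<Longrightarrow> \<bar>F v - \<beta> u v\<bar> \<le> r * nrm v"
    and \<rho>: "\<rho> = c / M\<^sup>2"
  shows "\<exists>u'\<in>V. \<forall>v\<in>V. \<bar>F v - \<beta> u' v\<bar> \<le>
     (\<epsilon> + \<rho> * \<epsilon> + sqrt (max 0 (1 - c\<^sup>2 / M\<^sup>2) * (r + \<epsilon>)\<^sup>2
        + 2 * \<rho> * \<epsilon> * (r + \<epsilon>) + \<rho>\<^sup>2 * (2 * M * (r + \<epsilon>) * \<epsilon> + \<epsilon>\<^sup>2))) * nrm v"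
proof -
  have \<rho>0: "0 < \<rho>" using \<rho> M c by simp
  have "lin (\<lambda>v. F v - \<beta> u v)"
    using F lin2[OF u] by (simp add: lin_def algebra_simps)
  then obtain g where g: "g \<in> V" "\<And>v. v \<in> V \<Longrightarrow> \<bar>(F v - \<beta> u v) - ip g v\<bar> \<le> \<epsilon> * nrm v"
    using approximate_riesz[of "\<lambda>v. F v - \<beta> u v" r \<epsilon>] res e by blast
  have bdg: "\<bar>\<beta> g v\<bar> \<le> (M * nrm g) * nrm v" if "v \<in> V" for v using bd g that by blast
  obtain h where h: "h \<in> V" "\<And>v. v \<in> V \<Longrightarrow> \<bar>\<beta> g v - ip h v\<bar> \<le> \<epsilon> * nrm v"
    using approximate_riesz[of "\<beta> g", OF lin2[OF g(1)] bdg e] by blast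
  have ng: "0 \<le> nrm g" and nh: "0 \<le> nrm h" using g h nrm_nonneg by auto
  have "nrm g * nrm g \<le> (r + \<epsilon>) * nrm g"
    using g(2)[OF g(1)] res[OF g(1)] nrm_sq[OF g(1)] by (simp add: power2_eq_square algebra_simps)
  then have gle: "nrm g \<le> r + \<epsilon>"
    by (cases "nrm g = 0") (use ng r e in \<open>auto simp: mult_le_cancel_right\<close>)
  have "nrm h * nrm h \<le> (M * nrm g + \<epsilon>) * nrm h"
    using h(2)[OF h(1)] bd[OF g(1) h(1)] nrm_sq[OF h(1)] by (simp add: power2_eq_square algebra_simps)
  then have hle: "nrm h \<le> M * nrm g + \<epsilon>"
    by (cases "nrm h = 0") (use nh ng M e in \<open>auto simp: mult_le_cancel_right\<close>)
  have gh: "ip g h \<ge> c * (nrm g)\<^sup>2 - \<epsilon> * nrm g"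
    using h(2)[OF g(1)] coer[OF g(1)] ip_sym[OF g(1) h(1)] by linarith
  \<comment> \<open>Up to the errors of \<open>g\<close> and \<open>h\<close>, this represents the
    new residual \<open>F - \<beta> (comb u \<rho> g)\<close>. The choice \<rho> = c/M^2 minimises
    the factor 1 - 2 \<rho> c + \<rho>^2 M^2 that appears in its squared norm.\<close>
  define w where "w = comb g (- \<rho>) h"
  have w: "w \<in> V" using g h comb_in by (simp add: w_def)
  have "(nrm w)\<^sup>2 = (nrm g)\<^sup>2 - 2 * \<rho> * ip g h + \<rho>\<^sup>2 * (nrm h)\<^sup>2"
    using g h w by (simp add: nrm_sq w_def ip_comb_self)
  also have "\<dots> \<le> (nrm g)\<^sup>2 - 2 * \<rho> * (c * (nrm g)\<^sup>2 - \<epsilon> * nrm g) + \<rho>\<^sup>2 * (M * nrm g + \<epsilon>)\<^sup>2"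
    using gh \<rho>0 hle nh ng by (intro add_mono diff_mono mult_left_mono power_mono) auto
  also have "\<dots> = (1 - 2 * \<rho> * c + \<rho>\<^sup>2 * M\<^sup>2) * (nrm g)\<^sup>2 + 2 * \<rho> * \<epsilon> * nrm g
      + \<rho>\<^sup>2 * (2 * M * nrm g * \<epsilon> + \<epsilon>\<^sup>2)"
    by (simp add: algebra_simps power2_eq_square)
  also have "1 - 2 * \<rho> * c + \<rho>\<^sup>2 * M\<^sup>2 = 1 - c\<^sup>2 / M\<^sup>2"
    using M by (simp add: \<rho> field_simps power2_eq_square)
  \<comment> \<open>If all norms vanish, \<open>c\<close> may exceed \<open>M\<close> and the factor
    may be negative; \<open>max 0\<close> keeps the bound increasing in
    \<open>nrm g\<close>.\<close>
  also have "(1 - c\<^sup>2 / M\<^sup>2) * (nrm g)\<^sup>2 + 2 * \<rho> * \<epsilon> * nrm g + \<rho>\<^sup>2 * (2 * M * nrm g * \<epsilon> + \<epsilon>\<^sup>2)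
    \<le> max 0 (1 - c\<^sup>2 / M\<^sup>2) * (r + \<epsilon>)\<^sup>2 + 2 * \<rho> * \<epsilon> * (r + \<epsilon>)
        + \<rho>\<^sup>2 * (2 * M * (r + \<epsilon>) * \<epsilon> + \<epsilon>\<^sup>2)"
    using gle ng \<rho>0 M e by (intro add_mono mult_mono mult_left_mono mult_right_mono power_mono) auto
  finally have nw: "nrm w \<le> sqrt (max 0 (1 - c\<^sup>2 / M\<^sup>2) * (r + \<epsilon>)\<^sup>2
      + 2 * \<rho> * \<epsilon> * (r + \<epsilon>) + \<rho>\<^sup>2 * (2 * M * (r + \<epsilon>) * \<epsilon> + \<epsilon>\<^sup>2))" (is "_ \<le> ?W")
    by (rule real_le_rsqrt)
  show ?thesis
  proof (intro bexI[of _ "comb u \<rho> g"] ballI)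
    fix v assume v: "v \<in> V"
    have "F v - \<beta> (comb u \<rho> g) v =
        ((F v - \<beta> u v) - ip g v) - \<rho> * (\<beta> g v - ip h v) + ip w v"
      using lin1[OF v] u g h v by (simp add: lin_def w_def ip_comb algebra_simps)
    also have "\<bar>\<dots>\<bar> \<le> \<bar>(F v - \<beta> u v) - ip g v\<bar> + \<rho> * \<bar>\<beta> g v - ip h v\<bar> + \<bar>ip w v\<bar>"
      using \<rho>0 abs_mult[of \<rho> "\<beta> g v - ip h v"] by simp
    also have "\<dots> \<le> \<epsilon> * nrm v + \<rho> * (\<epsilon> * nrm v) + ?W * nrm v"
    proof (intro add_mono mult_left_mono)
      show "\<bar>ip w v\<bar> \<le> ?W * nrm v"
        using ip_bound[OF w v] mult_right_mono[OF nw nrm_nonneg[OF v]] by linarith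
    qed (use g(2)[OF v] h(2)[OF v] \<rho>0 in auto)
    finally show "\<bar>F v - \<beta> (comb u \<rho> g) v\<bar> \<le> (\<epsilon> + \<rho> * \<epsilon> + ?W) * nrm v"
      by (simp add: algebra_simps)
  qed (use u g comb_in in auto)
qed

text \<open>An infimum replaces the iteration, so that no errors accumulate: if \<open>d\<close> is
  the infimum of all residual bounds, one step with vanishing error gives d \<le> \<theta> r for
  every attainable r, hence d \<le> \<theta> d with \<theta> < 1 and d = 0.\<close>

lemma approximate_lax_milgram:
  assumes lin1: "\<And>w. w \<in> V \<Longrightarrow> lin (\<lambda>u. \<beta> u w)" and lin2: "\<And>u. u \<in> V \<Longrightarrow> lin (\<beta> u)"
    and F: "lin F" and Fbd: "\<And>v. v \<in> V \<Longrightarrow> \<bar>F v\<bar> \<le> K * nrm v"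
    and bd: "\<And>u v. u \<in> V \<Longrightarrow> v \<in> V \<Longrightarrow> \<bar>\<beta> u v\<bar> \<le> M * nrm u * nrm v"
    and coer: "\<And>u. u \<in> V \<Longrightarrow> c * (nrm u)\<^sup>2 \<le> \<beta> u u"
    and M: "0 < M" and c: "0 < c" and e: "0 < \<epsilon>"
  shows "\<exists>u\<in>V. \<forall>v\<in>V. \<bar>F v - \<beta> u v\<bar> \<le> \<epsilon> * nrm v"
proof -
  define S where "S = {r. 0 \<le> r \<and> (\<exists>u\<in>V. \<forall>v\<in>V. \<bar>F v - \<beta> u v\<bar> \<le> r * nrm v)}"
  obtain u0 where u0: "u0 \<in> V" using nonempty by blast
  have "\<bar>F v - \<beta> u0 v\<bar> \<le> (\<bar>K\<bar> + M * nrm u0) * nrm v" if v: "v \<in> V" for v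
  proof -
    have "K * nrm v \<le> \<bar>K\<bar> * nrm v" using nrm_nonneg[OF v] by (intro mult_right_mono) auto
    then show ?thesis using Fbd[OF v] bd[OF u0 v] by (simp add: algebra_simps)
  qed
  then have "\<bar>K\<bar> + M * nrm u0 \<in> S"
    using u0 M nrm_nonneg[OF u0] by (auto simp: S_def)
  then have ne: "S \<noteq> {}" by blast
  have bdd: "bdd_below S" by (rule bdd_belowI[of _ 0]) (simp add: S_def)
  define d where "d = Inf S"
  have d0: "0 \<le> d" unfolding d_def using ne by (intro cInf_greatest) (auto simp: S_def)
  define \<theta> where "\<theta> = sqrt (max 0 (1 - c\<^sup>2 / M\<^sup>2))"
  have \<theta>: "0 \<le> \<theta>" "\<theta> < 1" using c M by (auto simp: \<theta>_def)
  have step: "d \<le> \<theta> * r" if r: "r \<in> S" for r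
  proof -
    from r obtain u where u: "0 \<le> r" "u \<in> V" "\<And>v. v \<in> V \<Longrightarrow> \<bar>F v - \<beta> u v\<bar> \<le> r * nrm v"
      by (auto simp: S_def)
    define \<rho> where "\<rho> = c / M\<^sup>2"
    \<comment> \<open>The bound that \<open>residual_step\<close> yields for tolerance \<delta>. It
      is continuous at 0 with value \<theta> r, so \<delta> can tend to 0 while \<open>r\<close>
      stays fixed.\<close>
    define B where "B \<delta> = \<delta> + \<rho> * \<delta> + sqrt (max 0 (1 - c\<^sup>2 / M\<^sup>2) * (r + \<delta>)\<^sup>2
        + 2 * \<rho> * \<delta> * (r + \<delta>) + \<rho>\<^sup>2 * (2 * M * (r + \<delta>) * \<delta> + \<delta>\<^sup>2))" for \<delta>
    have "B \<delta> \<in> S" if "0 < \<delta>" for \<delta>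
    proof -
      have "\<rho> \<ge> 0" using c by (simp add: \<rho>_def)
      then have "0 \<le> B \<delta>" using that u(1) M unfolding B_def
        by (intro add_nonneg_nonneg mult_nonneg_nonneg real_sqrt_ge_zero) auto
      then show ?thesis
        using residual_step[OF lin1 lin2 F bd coer M c that u(1) u(2) u(3) \<rho>_def]
        by (auto simp: S_def B_def)
    qed
    then have "d \<le> B \<delta>" if "0 < \<delta>" for \<delta>
      unfolding d_def using that bdd by (intro cInf_lower) auto
    moreover have "(B \<longlongrightarrow> B 0) (at_right 0)"
      unfolding B_def by (intro tendsto_intros)
    ultimately have "d \<le> B 0"
      by (intro tendsto_lowerbound[of B "B 0" "at_right 0" d])
        (auto simp: eventually_at_filter)
    also have "B 0 = \<theta> * r" using u(1) by (simp add: B_def \<theta>_def real_sqrt_mult)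
    finally show ?thesis .
  qed
  have "d < \<epsilon>"
  proof (cases "\<theta> = 0")
    case True
    then show ?thesis using step ne e d0 by fastforce
  next
    case False
    have "d / \<theta> \<le> d"
      unfolding d_def[symmetric] using ne step False \<theta>
      by (subst (2) d_def, intro cInf_greatest) (auto simp: field_simps)
    then have "d \<le> d * \<theta>" using False \<theta> by (simp add: field_simps)
    then have "d * (1 - \<theta>) \<le> 0" by (simp add: algebra_simps)
    then have "d \<le> 0" using \<theta> by (simp add: mult_le_0_iff)
    then show ?thesis using e by simp
  qed
  then obtain r where r: "r \<in> S" "r < \<epsilon>"
    using cInf_less_iff[OF ne bdd] unfolding d_def by blast
  then obtain u where u: "u \<in> V" "\<And>v. v \<in> V \<Longrightarrow> \<bar>F v - \<beta> u v\<bar> \<le> r * nrm v"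
    by (auto simp: S_def)
  have "\<bar>F v - \<beta> u v\<bar> \<le> \<epsilon> * nrm v" if v: "v \<in> V" for v
    using u(2)[OF v] mult_right_mono[OF less_imp_le[OF r(2)] nrm_nonneg[OF v]] by linarith
  with u(1) show ?thesis by blast
qed

end

section \<open>Square-integrable functions\<close>

text \<open>Any measure and any Euclidean target are allowed, so that quaternion-valued functions,
  their gradients and their 1-jets in \<open>quat \<times> (quat^3)\<close> share one theory. On
  \<Omega> it coincides with \<open>L2\<close>, see \<open>L2_iff_sqint\<close>.\<close>

definition sqint :: "'a measure \<Rightarrow> ('a \<Rightarrow> 'b::euclidean_space) \<Rightarrow> bool" where
  "sqint M u \<longleftrightarrow> u \<in> borel_measurable M \<and> integrable M (\<lambda>x. (norm (u x))\<^sup>2)"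

definition l2n :: "'a measure \<Rightarrow> ('a \<Rightarrow> 'b::euclidean_space) \<Rightarrow> real" where
  "l2n M u = sqrt (\<integral>x. (norm (u x))\<^sup>2 \<partial>M)"

lemma l2n_nonneg: "0 \<le> l2n M u"
  by (simp add: l2n_def)

lemma l2n_sq: "(l2n M u)\<^sup>2 = (\<integral>x. (norm (u x))\<^sup>2 \<partial>M)"
  by (simp add: l2n_def)

lemma sqint_measurable[measurable_dest]: "sqint M u \<Longrightarrow> u \<in> borel_measurable M"
  by (simp add: sqint_def)

lemma sqint_bound:
  assumes "sqint M u" "w \<in> borel_measurable M"
    and le: "\<And>x. x \<in> space M \<Longrightarrow> norm (w x) \<le> C * norm (u x)"
  shows "sqint M w"
proof -
  have "integrable M (\<lambda>x. C\<^sup>2 * (norm (u x))\<^sup>2)"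
    using assms by (simp add: sqint_def)
  then have "integrable M (\<lambda>x. (norm (w x))\<^sup>2)"
  proof (rule Bochner_Integration.integrable_bound)
    show "AE x in M. norm ((norm (w x))\<^sup>2) \<le> norm (C\<^sup>2 * (norm (u x))\<^sup>2)"
      using le by (intro AE_I2) (simp add: power_mult_distrib[symmetric] power_mono)
  qed (use assms in measurable)
  with assms show ?thesis by (simp add: sqint_def)
qed

lemma l2n_bound:
  assumes "sqint M u" "w \<in> borel_measurable M"
    and le: "\<And>x. x \<in> space M \<Longrightarrow> norm (w x) \<le> C * norm (u x)" and C: "0 \<le> C"
  shows "l2n M w \<le> C * l2n M u"
proof -
  have "(\<integral>x. (norm (w x))\<^sup>2 \<partial>M) \<le> (\<integral>x. C\<^sup>2 * (norm (u x))\<^sup>2 \<partial>M)"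
  proof (intro integral_mono)
    show "(norm (w x))\<^sup>2 \<le> C\<^sup>2 * (norm (u x))\<^sup>2" if "x \<in> space M" for x
      using le[OF that] by (simp add: power_mult_distrib[symmetric] power_mono)
  qed (use sqint_bound[OF assms(1-3)] assms(1) in \<open>auto simp: sqint_def\<close>)
  then have "(l2n M w)\<^sup>2 \<le> (C * l2n M u)\<^sup>2"
    by (simp add: l2n_sq power_mult_distrib)
  then show ?thesis
    by (rule power2_le_imp_le) (simp add: C l2n_nonneg)
qed

lemma sqint_prod_integrable:
  assumes "sqint M u" "sqint M v"
  shows "integrable M (\<lambda>x. norm (u x) * norm (v x))"
proof (rule Bochner_Integration.integrable_bound)
  show "integrable M (\<lambda>x. (norm (u x))\<^sup>2 + (norm (v x))\<^sup>2)"
    using assms by (simp add: sqint_def)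
  show "AE x in M. norm (norm (u x) * norm (v x)) \<le> norm ((norm (u x))\<^sup>2 + (norm (v x))\<^sup>2)"
  proof (intro AE_I2)
    fix x
    have "2 * norm (u x) * norm (v x) \<le> (norm (u x))\<^sup>2 + (norm (v x))\<^sup>2"
      using zero_le_power2[of "norm (u x) - norm (v x)"] by (simp add: power2_diff)
    then show "norm (norm (u x) * norm (v x)) \<le> norm ((norm (u x))\<^sup>2 + (norm (v x))\<^sup>2)"
      unfolding real_norm_def
      using mult_nonneg_nonneg[OF norm_ge_zero[of "u x"] norm_ge_zero[of "v x"]] by linarith
  qed
qed (use assms in measurable)

lemma sqint_add:
  assumes "sqint M u" "sqint M v"
  shows "sqint M (\<lambda>x. u x + v x)"
proof -
  have "integrable M (\<lambda>x. (norm (u x + v x))\<^sup>2)"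
  proof (rule Bochner_Integration.integrable_bound)
    show "integrable M (\<lambda>x. (norm (u x))\<^sup>2 + (norm (v x))\<^sup>2 + 2 * (norm (u x) * norm (v x)))"
      using assms sqint_prod_integrable[OF assms] by (simp add: sqint_def)
    show "AE x in M. norm ((norm (u x + v x))\<^sup>2)
        \<le> norm ((norm (u x))\<^sup>2 + (norm (v x))\<^sup>2 + 2 * (norm (u x) * norm (v x)))"
    proof (intro AE_I2)
      fix x
      have "(norm (u x + v x))\<^sup>2 \<le> (norm (u x) + norm (v x))\<^sup>2"
        by (intro power_mono norm_triangle_ineq) auto
      then show "norm ((norm (u x + v x))\<^sup>2)
        \<le> norm ((norm (u x))\<^sup>2 + (norm (v x))\<^sup>2 + 2 * (norm (u x) * norm (v x)))"
        by (simp add: power2_sum algebra_simps)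
    qed
  qed (use assms in measurable)
  with assms show ?thesis by (auto simp: sqint_def)
qed

lemma sqint_scaleR: "sqint M u \<Longrightarrow> sqint M (\<lambda>x. c *\<^sub>R u x)"
  by (auto simp: sqint_def power_mult_distrib)

lemma sqint_diff: "sqint M u \<Longrightarrow> sqint M v \<Longrightarrow> sqint M (\<lambda>x. u x - v x)"
  using sqint_add[of M u "\<lambda>x. (-1) *\<^sub>R v x"] sqint_scaleR[of M v "-1"] by simp

lemma l2n_cauchy_schwarz:
  assumes "sqint M u" "sqint M v"
  shows "(\<integral>x. norm (u x) * norm (v x) \<partial>M) \<le> l2n M u * l2n M v"
proof -
  have "(\<integral>x. norm (u x) * norm (v x) \<partial>M)\<^sup>2 \<le> (l2n M u)\<^sup>2 * (l2n M v)\<^sup>2"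
  proof (rule quadratic_nonneg_discriminant)
    fix t :: real
    have i: "integrable M (\<lambda>x. (norm (u x))\<^sup>2)" "integrable M (\<lambda>x. (norm (v x))\<^sup>2)"
      "integrable M (\<lambda>x. norm (u x) * norm (v x))"
      using assms sqint_prod_integrable by (auto simp: sqint_def)
    have "0 \<le> (\<integral>x. (norm (u x) + t * norm (v x))\<^sup>2 \<partial>M)" by simp
    also have "\<dots> = (\<integral>x. (norm (u x))\<^sup>2 + 2 * t * (norm (u x) * norm (v x))
        + t\<^sup>2 * (norm (v x))\<^sup>2 \<partial>M)"
      by (intro Bochner_Integration.integral_cong) (auto simp: power2_eq_square algebra_simps)
    also have "\<dots> = (l2n M u)\<^sup>2 + 2 * t * (\<integral>x. norm (u x) * norm (v x) \<partial>M) + t\<^sup>2 * (l2n M v)\<^sup>2"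
      using i by (simp add: l2n_sq)
    finally show "0 \<le> (l2n M u)\<^sup>2 + 2 * t * (\<integral>x. norm (u x) * norm (v x) \<partial>M) + t\<^sup>2 * (l2n M v)\<^sup>2" .
  qed simp
  then have "(\<integral>x. norm (u x) * norm (v x) \<partial>M)\<^sup>2 \<le> (l2n M u * l2n M v)\<^sup>2"
    by (simp add: power_mult_distrib)
  then show ?thesis by (rule power2_le_imp_le) (simp add: l2n_nonneg)
qed

lemma l2n_add:
  assumes "sqint M u" "sqint M v"
  shows "l2n M (\<lambda>x. u x + v x) \<le> l2n M u + l2n M v"
proof -
  have "(l2n M (\<lambda>x. u x + v x))\<^sup>2
      \<le> (\<integral>x. (norm (u x))\<^sup>2 + (norm (v x))\<^sup>2 + 2 * (norm (u x) * norm (v x)) \<partial>M)"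
    unfolding l2n_sq
  proof (intro integral_mono)
    fix x
    have "(norm (u x + v x))\<^sup>2 \<le> (norm (u x) + norm (v x))\<^sup>2"
      by (intro power_mono norm_triangle_ineq) auto
    then show "(norm (u x + v x))\<^sup>2 \<le> (norm (u x))\<^sup>2 + (norm (v x))\<^sup>2 + 2 * (norm (u x) * norm (v x))"
      by (simp add: power2_sum algebra_simps)
  qed (use assms sqint_add[OF assms] sqint_prod_integrable[OF assms] in \<open>auto simp: sqint_def\<close>)
  also have "\<dots> = (l2n M u)\<^sup>2 + (l2n M v)\<^sup>2 + 2 * (\<integral>x. norm (u x) * norm (v x) \<partial>M)"
    using assms sqint_prod_integrable[OF assms] by (simp add: sqint_def l2n_sq)
  also have "\<dots> \<le> (l2n M u + l2n M v)\<^sup>2"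
    using l2n_cauchy_schwarz[OF assms] by (simp add: power2_sum)
  finally show ?thesis by (rule power2_le_imp_le) (simp add: l2n_nonneg)
qed

lemma l2n_uminus: "l2n M (\<lambda>x. - u x) = l2n M u"
  by (simp add: l2n_def)

lemma l2n_diff:
  assumes "sqint M u" "sqint M v"
  shows "l2n M (\<lambda>x. u x - v x) \<le> l2n M u + l2n M v"
  using l2n_add[OF assms(1) sqint_scaleR[OF assms(2), of "-1"]] by (simp add: l2n_uminus)

lemma l2n_zero_AE:
  assumes "sqint M u" "l2n M u = 0"
  shows "AE x in M. u x = 0"
proof -
  have "(\<integral>x. (norm (u x))\<^sup>2 \<partial>M) = 0" using assms(2) by (simp add: l2n_def)
  then have "AE x in M. (norm (u x))\<^sup>2 = 0"
    using assms(1) by (subst (asm) integral_nonneg_eq_0_iff_AE) (auto simp: sqint_def)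
  then show ?thesis by simp
qed

lemma l2n_cong_AE:
  assumes "AE x in M. u x = v x" "u \<in> borel_measurable M" "v \<in> borel_measurable M"
  shows "l2n M u = l2n M v"
  unfolding l2n_def using assms by (intro arg_cong[of _ _ sqrt] integral_cong_AE) auto

lemma sqint_bounded:
  assumes "finite_measure M" "u \<in> borel_measurable M" "\<And>x. x \<in> space M \<Longrightarrow> norm (u x) \<le> B"
  shows "sqint M u"
proof -
  interpret finite_measure M by fact
  have "integrable M (\<lambda>x. (norm (u x))\<^sup>2)"
    by (rule integrable_const_bound[of _ "B\<^sup>2"])
      (use assms in \<open>auto intro!: AE_I2 power_mono\<close>)
  with assms show ?thesis by (simp add: sqint_def)
qed

text \<open>On a finite measure space a fast \<open>L\<^sup>2\<close>-Cauchy subsequence has summable increments in \<open>L\<^sup>1\<close>,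
  hence converges almost everywhere; Fatou's lemma upgrades this to \<open>L\<^sup>2\<close>-convergence.\<close>

lemma sqint_complete:
  fixes u :: "nat \<Rightarrow> 'a \<Rightarrow> 'b::euclidean_space"
  assumes fin: "finite_measure M" and u: "\<And>n. sqint M (u n)"
    and cau: "\<And>e. 0 < e \<Longrightarrow> \<exists>N. \<forall>m\<ge>N. \<forall>n\<ge>N. l2n M (\<lambda>x. u m x - u n x) < e"
  obtains w where "sqint M w" "(\<lambda>n. l2n M (\<lambda>x. u n x - w x)) \<longlonglongrightarrow> 0"
proof -
  interpret finite_measure M by fact
  note [measurable] = sqint_measurable[OF u]
  have "\<forall>k. \<exists>N. \<forall>m\<ge>N. \<forall>n\<ge>N. l2n M (\<lambda>x. u m x - u n x) < (1/2) ^ k"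
    using cau by simp
  then obtain N where N: "\<And>k m n. m \<ge> N k \<Longrightarrow> n \<ge> N k \<Longrightarrow> l2n M (\<lambda>x. u m x - u n x) < (1/2) ^ k"
    by metis
  \<comment> \<open>The sum makes both \<open>r k\<close> and \<open>r (Suc k)\<close> at least
    \<open>N k\<close>; the summand \<open>k\<close> forces the indices to infinity.\<close>
  define r where "r k = (\<Sum>j\<le>k. N j) + k" for k
  have rN: "N k \<le> r k" for k
    unfolding r_def using member_le_sum[of k "{..k}" N] by simp
  have rN': "N k \<le> r (Suc k)" for k
    using rN[of k] by (simp add: r_def)
  have rk: "k \<le> r k" for k by (simp add: r_def)
  define D where "D k x = u (r (Suc k)) x - u (r k) x" for k x
  have D: "sqint M (D k)" for k unfolding D_def using u by (intro sqint_diff)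
  note [measurable] = sqint_measurable[OF D]
  define B where "B = l2n M (\<lambda>x. 1::real)"
  have one: "sqint M (\<lambda>x. 1::real)" by (rule sqint_bounded[OF fin, of _ 1]) auto
  have iD: "integrable M (\<lambda>x. norm (D k x))" for k
    using sqint_prod_integrable[OF D one] by simp
  have "(\<integral>x. norm (D k x) \<partial>M) \<le> (1/2) ^ k * B" for k
  proof -
    have "(\<integral>x. norm (D k x) \<partial>M) \<le> l2n M (D k) * B"
      using l2n_cauchy_schwarz[OF D one] by (simp add: B_def)
    also have "\<dots> \<le> (1/2) ^ k * B"
      using less_imp_le[OF N[OF rN' rN, of k]] unfolding D_def
      by (rule mult_right_mono) (simp add: B_def l2n_nonneg)
    finally show ?thesis .
  qed
  then have "summable (\<lambda>k. \<integral>x. norm (D k x) \<partial>M)"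
    by (intro summable_comparison_test'[OF summable_mult2[OF summable_geometric[of "1/2::real"], of B]])
      auto
  then have "(\<Sum>k. ennreal (\<integral>x. norm (D k x) \<partial>M)) \<noteq> top"
    by (subst suminf_ennreal2) auto
  moreover have "(\<integral>\<^sup>+x. (\<Sum>k. ennreal (norm (D k x))) \<partial>M) = (\<Sum>k. ennreal (\<integral>x. norm (D k x) \<partial>M))"
    by (subst nn_integral_suminf) (auto intro!: suminf_cong nn_integral_eq_integral iD)
  ultimately have "(\<integral>\<^sup>+x. (\<Sum>k. ennreal (norm (D k x))) \<partial>M) \<noteq> \<infinity>" by simp
  then have "AE x in M. (\<Sum>k. ennreal (norm (D k x))) \<noteq> \<infinity>"
    by (intro nn_integral_PInf_AE) auto
  then have conv: "AE x in M. (\<lambda>k. u (r k) x) \<longlonglongrightarrow> lim (\<lambda>k. u (r k) x)"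
  proof (rule AE_mp, intro AE_I2 impI)
    fix x assume "(\<Sum>k. ennreal (norm (D k x))) \<noteq> \<infinity>"
    then have "summable (\<lambda>k. norm (D k x))"
      by (intro summable_suminf_not_top) auto
    then have "summable (\<lambda>k. D k x)" by (rule summable_norm_cancel)
    then have "(\<lambda>n. \<Sum>k<n. D k x) \<longlonglongrightarrow> (\<Sum>k. D k x)" by (rule summable_LIMSEQ)
    then have "(\<lambda>n. u (r n) x - u (r 0) x) \<longlonglongrightarrow> (\<Sum>k. D k x)"
      by (simp add: D_def sum_lessThan_telescope[of "\<lambda>k. u (r k) x"])
    from tendsto_add[OF this tendsto_const[of "u (r 0) x"]]
    have "(\<lambda>n. u (r n) x) \<longlonglongrightarrow> (\<Sum>k. D k x) + u (r 0) x" by simp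
    then show "(\<lambda>k. u (r k) x) \<longlonglongrightarrow> lim (\<lambda>k. u (r k) x)"
      using convergentI convergent_LIMSEQ_iff by blast
  qed
  \<comment> \<open>Where the subsequence diverges \<open>lim\<close> has an unspecified value; by
    \<open>conv\<close> this happens on a null set only.\<close>
  define w where "w x = lim (\<lambda>k. u (r k) x)" for x
  have [measurable]: "w \<in> borel_measurable M"
    unfolding w_def by (rule borel_measurable_lim_metric) auto
  have key: "sqint M (\<lambda>x. u n x - w x) \<and> l2n M (\<lambda>x. u n x - w x) \<le> (1/2) ^ k"
    if n: "n \<ge> N k" for n k
  proof -
    have "(\<integral>\<^sup>+x. ennreal ((norm (u n x - w x))\<^sup>2) \<partial>M)
      = (\<integral>\<^sup>+x. liminf (\<lambda>j. ennreal ((norm (u n x - u (r j) x))\<^sup>2)) \<partial>M)"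
    proof (rule nn_integral_cong_AE, rule AE_mp[OF conv], intro AE_I2 impI)
      fix x assume "(\<lambda>k. u (r k) x) \<longlonglongrightarrow> lim (\<lambda>k. u (r k) x)"
      then have "(\<lambda>j. ennreal ((norm (u n x - u (r j) x))\<^sup>2)) \<longlonglongrightarrow> ennreal ((norm (u n x - w x))\<^sup>2)"
        unfolding w_def by (intro tendsto_intros)
      then show "ennreal ((norm (u n x - w x))\<^sup>2) = liminf (\<lambda>j. ennreal ((norm (u n x - u (r j) x))\<^sup>2))"
        by (rule lim_imp_Liminf[OF sequentially_bot, symmetric])
    qed
    also have "\<dots> \<le> liminf (\<lambda>j. \<integral>\<^sup>+x. ennreal ((norm (u n x - u (r j) x))\<^sup>2) \<partial>M)"
      by (rule nn_integral_liminf) auto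
    also have "\<dots> \<le> ennreal (((1/2) ^ k)\<^sup>2)"
    proof (rule Liminf_le)
      show "\<forall>\<^sub>F j in sequentially. (\<integral>\<^sup>+x. ennreal ((norm (u n x - u (r j) x))\<^sup>2) \<partial>M) \<le> ennreal (((1/2) ^ k)\<^sup>2)"
      proof (rule eventually_sequentiallyI[of "N k"])
        fix j assume "N k \<le> j"
        then have "N k \<le> r j" using rk le_trans by blast
        from N[OF n this] have "(l2n M (\<lambda>x. u n x - u (r j) x))\<^sup>2 \<le> ((1/2) ^ k)\<^sup>2"
          by (intro power_mono) (auto simp: l2n_nonneg)
        moreover have "(\<integral>\<^sup>+x. ennreal ((norm (u n x - u (r j) x))\<^sup>2) \<partial>M)
            = ennreal ((l2n M (\<lambda>x. u n x - u (r j) x))\<^sup>2)"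
          unfolding l2n_sq using sqint_diff[OF u u]
          by (intro nn_integral_eq_integral) (auto simp: sqint_def)
        ultimately show "(\<integral>\<^sup>+x. ennreal ((norm (u n x - u (r j) x))\<^sup>2) \<partial>M) \<le> ennreal (((1/2) ^ k)\<^sup>2)"
          by (simp add: ennreal_leI)
      qed
    qed simp
    finally have le: "(\<integral>\<^sup>+x. ennreal ((norm (u n x - w x))\<^sup>2) \<partial>M) \<le> ennreal (((1/2) ^ k)\<^sup>2)" .
    then have int: "integrable M (\<lambda>x. (norm (u n x - w x))\<^sup>2)"
      by (intro integrableI_nonneg) (auto simp: top_unique intro: le_less_trans)
    then have "(l2n M (\<lambda>x. u n x - w x))\<^sup>2 \<le> ((1/2) ^ k)\<^sup>2"
      using le by (subst (asm) nn_integral_eq_integral) (auto simp: l2n_sq)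
    then have "l2n M (\<lambda>x. u n x - w x) \<le> (1/2) ^ k"
      by (rule power2_le_imp_le) simp
    with int show ?thesis by (auto simp: sqint_def)
  qed
  have "sqint M (\<lambda>x. u (N 0) x - (u (N 0) x - w x))"
    by (rule sqint_diff[OF u]) (use key[of 0 "N 0"] in simp)
  then have w: "sqint M w" by simp
  have "(\<lambda>n. l2n M (\<lambda>x. u n x - w x)) \<longlonglongrightarrow> 0"
  proof (rule LIMSEQ_I)
    fix e :: real assume "0 < e"
    then obtain k where k: "(1/2) ^ k < e" using real_arch_pow_inv[of e "1/2"] by auto
    show "\<exists>no. \<forall>n\<ge>no. norm (l2n M (\<lambda>x. u n x - w x) - 0) < e"
      using key[of k] k by (intro exI[of _ "N k"]) (force simp: l2n_nonneg)
  qed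
  with w that show ?thesis by blast
qed

text \<open>Integrals of pointwise bilinear forms with a uniform bound. The two instances are the
  plain inner product, for right-hand sides, and the integrand of the weak form of the operator;
  what matters is \<open>form_tendsto\<close>, the joint continuity under L^2 convergence.\<close>

locale l2form =
  fixes M :: "'a measure" and K :: real and b :: "'a \<Rightarrow> 'b::euclidean_space \<Rightarrow> 'b \<Rightarrow> real"
  assumes bil: "x \<in> space M \<Longrightarrow> bilinear (b x)"
    and bnd: "x \<in> space M \<Longrightarrow> \<bar>b x p q\<bar> \<le> K * (norm p * norm q)"
    and meas: "U \<in> borel_measurable M \<Longrightarrow> V \<in> borel_measurable M \<Longrightarrow>
      (\<lambda>x. b x (U x) (V x)) \<in> borel_measurable M"
begin

definition form :: "('a \<Rightarrow> 'b) \<Rightarrow> ('a \<Rightarrow> 'b) \<Rightarrow> real" where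
  "form U V = (\<integral>x. b x (U x) (V x) \<partial>M)"

lemma form_integrable:
  assumes "sqint M U" "sqint M V"
  shows "integrable M (\<lambda>x. b x (U x) (V x))"
proof (rule Bochner_Integration.integrable_bound)
  show "integrable M (\<lambda>x. K * (norm (U x) * norm (V x)))"
    using sqint_prod_integrable[OF assms] by simp
  show "(\<lambda>x. b x (U x) (V x)) \<in> borel_measurable M"
    using assms by (intro meas) (auto simp: sqint_def)
  show "AE x in M. norm (b x (U x) (V x)) \<le> norm (K * (norm (U x) * norm (V x)))"
    using bnd by (intro AE_I2) (metis abs_ge_self order_trans real_norm_def)
qed

lemma form_bound:
  assumes "sqint M U" "sqint M V" "0 \<le> K"
  shows "\<bar>form U V\<bar> \<le> K * (l2n M U * l2n M V)"
proof -
  have "\<bar>form U V\<bar> \<le> (\<integral>x. \<bar>b x (U x) (V x)\<bar> \<partial>M)"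
    unfolding form_def by (rule integral_abs_bound)
  also have "\<dots> \<le> (\<integral>x. K * (norm (U x) * norm (V x)) \<partial>M)"
    using form_integrable[OF assms(1,2)] sqint_prod_integrable[OF assms(1,2)] bnd
    by (intro integral_mono) auto
  also have "\<dots> \<le> K * (l2n M U * l2n M V)"
    using l2n_cauchy_schwarz[OF assms(1,2)] assms(3) by (simp add: mult_left_mono)
  finally show ?thesis .
qed

lemma form_add_left:
  assumes "sqint M U" "sqint M V" "sqint M W"
  shows "form (\<lambda>x. U x + t *\<^sub>R V x) W = form U W + t * form V W"
proof -
  have "form (\<lambda>x. U x + t *\<^sub>R V x) W = (\<integral>x. b x (U x) (W x) + t * b x (V x) (W x) \<partial>M)"
    unfolding form_def
    by (intro Bochner_Integration.integral_cong) (auto simp: bilinear_ladd[OF bil] bilinear_lmul[OF bil])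
  then show ?thesis using form_integrable assms by (simp add: form_def)
qed

lemma form_add_right:
  assumes "sqint M U" "sqint M V" "sqint M W"
  shows "form W (\<lambda>x. U x + t *\<^sub>R V x) = form W U + t * form W V"
proof -
  have "form W (\<lambda>x. U x + t *\<^sub>R V x) = (\<integral>x. b x (W x) (U x) + t * b x (W x) (V x) \<partial>M)"
    unfolding form_def
    by (intro Bochner_Integration.integral_cong) (auto simp: bilinear_radd[OF bil] bilinear_rmul[OF bil])
  then show ?thesis using form_integrable assms by (simp add: form_def)
qed

lemma form_diff_left:
  "sqint M U \<Longrightarrow> sqint M V \<Longrightarrow> sqint M W \<Longrightarrow> form (\<lambda>x. U x - V x) W = form U W - form V W"
  using form_add_left[of U V W "-1"] by simp

lemma form_diff_right:
  "sqint M U \<Longrightarrow> sqint M V \<Longrightarrow> sqint M W \<Longrightarrow> form W (\<lambda>x. U x - V x) = form W U - form W V"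
  using form_add_right[of U V W "-1"] by simp

lemma form_tendsto:
  assumes U: "\<And>n. sqint M (Us n)" "sqint M U" "(\<lambda>n. l2n M (\<lambda>x. Us n x - U x)) \<longlonglongrightarrow> 0"
    and V: "\<And>n. sqint M (Vs n)" "sqint M V" "(\<lambda>n. l2n M (\<lambda>x. Vs n x - V x)) \<longlonglongrightarrow> 0"
    and K: "0 \<le> K"
  shows "(\<lambda>n. form (Us n) (Vs n)) \<longlonglongrightarrow> form U V"
proof (rule Lim_null[THEN iffD2], rule Lim_null_comparison)
  let ?d = "\<lambda>n. l2n M (\<lambda>x. Us n x - U x)" and ?e = "\<lambda>n. l2n M (\<lambda>x. Vs n x - V x)"
  show "(\<lambda>n. K * (?d n * (?e n + l2n M V)) + K * (l2n M U * ?e n)) \<longlonglongrightarrow> 0"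
    by (auto intro!: tendsto_eq_intros U(3) V(3))
  show "\<forall>\<^sub>F n in sequentially. norm (form (Us n) (Vs n) - form U V)
      \<le> K * (?d n * (?e n + l2n M V)) + K * (l2n M U * ?e n)"
  proof (intro always_eventually allI)
    fix n
    note d = sqint_diff[OF U(1)[of n] U(2)] and e = sqint_diff[OF V(1)[of n] V(2)]
    have "form (Us n) (Vs n) - form U V =
        form (\<lambda>x. Us n x - U x) (Vs n) + form U (\<lambda>x. Vs n x - V x)"
      using U V by (simp add: form_diff_left form_diff_right)
    also have "norm \<dots> \<le> K * (?d n * l2n M (Vs n)) + K * (l2n M U * ?e n)"
      using form_bound[OF d V(1)[of n] K] form_bound[OF U(2) e K] by simp
    also have "l2n M (Vs n) \<le> ?e n + l2n M V"
      using l2n_add[OF e V(2)] by simp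
    finally show "norm (form (Us n) (Vs n) - form U V)
      \<le> K * (?d n * (?e n + l2n M V)) + K * (l2n M U * ?e n)"
      using K by (simp add: l2n_nonneg mult_left_mono)
  qed
qed

end

lemma l2form_inner: "l2form M 1 (\<lambda>x. inner)"
  by standard (auto simp: bilinear_conv_bounded_bilinear bounded_bilinear_inner Cauchy_Schwarz_ineq2)

lemma l2n_tendsto:
  assumes "\<And>n. sqint M (us n)" "sqint M u" "(\<lambda>n. l2n M (\<lambda>x. us n x - u x)) \<longlonglongrightarrow> 0"
  shows "(\<lambda>n. l2n M (us n)) \<longlonglongrightarrow> l2n M u"
proof -
  interpret l2form M 1 "\<lambda>x. inner" by (rule l2form_inner)
  have "(\<lambda>n. sqrt (form (us n) (us n))) \<longlonglongrightarrow> sqrt (form u u)"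
    by (intro tendsto_real_sqrt form_tendsto assms) simp
  then show ?thesis by (simp add: l2n_def form_def dot_square_norm)
qed

section \<open>Directional derivatives\<close>

text \<open>Only the restriction of \<open>f\<close> to a line through \<open>x\<close> is
  differentiated, as in \<open>ipd\<close>; total derivatives never occur. Taking the derivative as
  a function \<open>f'\<close> lets the rules be chained without naming values.\<close>

definition has_pd :: "'a::euclidean_space \<Rightarrow> ('a \<Rightarrow> real) \<Rightarrow> ('a \<Rightarrow> real) \<Rightarrow> 'a \<Rightarrow> bool" where
  "has_pd e f f' x \<longleftrightarrow> ((\<lambda>t. f (x + t *\<^sub>R e)) has_real_derivative f' x) (at 0)"

lemma has_pd_at:
  assumes "has_pd e f f' (x + t *\<^sub>R e)"
  shows "((\<lambda>t. f (x + t *\<^sub>R e)) has_real_derivative f' (x + t *\<^sub>R e)) (at t)"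
proof -
  have "((\<lambda>s. f (x + t *\<^sub>R e + s *\<^sub>R e)) has_real_derivative f' (x + t *\<^sub>R e)) (at 0)"
    using assms by (simp add: has_pd_def)
  then have "((\<lambda>s. f (x + (s + t) *\<^sub>R e)) has_real_derivative f' (x + t *\<^sub>R e)) (at 0)"
    by (simp add: algebra_simps)
  then show ?thesis
    by (subst (asm) DERIV_shift[symmetric]) simp
qed

lemma has_pd_mult:
  assumes "has_pd e f f' x" "has_pd e g g' x"
  shows "has_pd e (\<lambda>x. f x * g x) (\<lambda>x. f' x * g x + f x * g' x) x"
  using DERIV_mult[OF assms[unfolded has_pd_def]] by (simp add: has_pd_def algebra_simps)

lemma has_pd_add:
  assumes "has_pd e f f' x" "has_pd e g g' x"
  shows "has_pd e (\<lambda>x. f x + g x) (\<lambda>x. f' x + g' x) x"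
  using DERIV_add[OF assms[unfolded has_pd_def]] by (simp add: has_pd_def)

lemma has_pd_cmult:
  assumes "has_pd e f f' x"
  shows "has_pd e (\<lambda>x. c * f x) (\<lambda>x. c * f' x) x"
  using DERIV_cmult[OF assms[unfolded has_pd_def]] by (simp add: has_pd_def)

lemma has_pd_const: "has_pd e (\<lambda>x. c) (\<lambda>x. 0) x"
  by (simp add: has_pd_def)

lemma has_pd_sum:
  assumes "\<And>i. i \<in> I \<Longrightarrow> has_pd e (f i) (f' i) x"
  shows "has_pd e (\<lambda>x. \<Sum>i\<in>I. f i x) (\<lambda>x. \<Sum>i\<in>I. f' i x) x"
  using assms unfolding has_pd_def by (intro DERIV_sum) auto

lemma has_pd_local:
  assumes "has_pd e f f' x" "open U" "x \<in> U" "\<And>y. y \<in> U \<Longrightarrow> f y = g y" "f' x = g' x"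
  shows "has_pd e g g' x"
proof -
  have "continuous (at 0) (\<lambda>t::real. x + t *\<^sub>R e)" by (intro continuous_intros)
  then have "\<forall>\<^sub>F t in nhds 0. x + t *\<^sub>R e \<in> U"
    using assms(2,3)
    by (simp add: continuous_at_open eventually_nhds)
  then have "\<forall>\<^sub>F t in nhds 0. f (x + t *\<^sub>R e) = g (x + t *\<^sub>R e)"
    by eventually_elim (use assms(4) in auto)
  then show ?thesis
    using assms(1,5) unfolding has_pd_def by (subst (asm) DERIV_cong_ev[OF refl]) auto
qed

lemma has_pd_zero_off:
  assumes "has_pd e f f' x" "closed K" "x \<notin> K" "\<And>y. y \<notin> K \<Longrightarrow> f y = 0"
  shows "f' x = 0"
proof -
  have "has_pd e (\<lambda>_. 0) f' x"
    by (rule has_pd_local[OF assms(1), of "- K"]) (use assms in auto)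
  then show ?thesis
    using has_pd_const[of e 0 x] DERIV_unique unfolding has_pd_def by blast
qed

section \<open>Second differences and the symmetry of mixed partial derivatives\<close>

lemma second_difference_mean_value:
  assumes f: "\<And>x. has_pd e f f1 x" and f1: "\<And>x. has_pd d f1 f2 x"
    and e: "norm e = 1" and d: "norm d = 1" and h: "0 < h"
  obtains y where "dist y x \<le> 2 * h"
    "f (x + h *\<^sub>R e + h *\<^sub>R d) - f (x + h *\<^sub>R e) - f (x + h *\<^sub>R d) + f x = h\<^sup>2 * f2 y"
proof -
  define p where "p s = f (x + h *\<^sub>R d + s *\<^sub>R e) - f (x + s *\<^sub>R e)" for s
  have p: "(p has_real_derivative f1 (x + h *\<^sub>R d + s *\<^sub>R e) - f1 (x + s *\<^sub>R e)) (at s)" for s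
    unfolding p_def by (intro DERIV_diff has_pd_at f)
  obtain \<sigma> where \<sigma>: "0 < \<sigma>" "\<sigma> < h"
    "p h - p 0 = (h - 0) * (f1 (x + h *\<^sub>R d + \<sigma> *\<^sub>R e) - f1 (x + \<sigma> *\<^sub>R e))"
    using MVT2[OF h p] by blast
  have q: "((\<lambda>t. f1 (x + \<sigma> *\<^sub>R e + t *\<^sub>R d)) has_real_derivative f2 (x + \<sigma> *\<^sub>R e + t *\<^sub>R d)) (at t)" for t
    by (intro has_pd_at f1)
  obtain \<tau> where \<tau>: "0 < \<tau>" "\<tau> < h"
    "f1 (x + \<sigma> *\<^sub>R e + h *\<^sub>R d) - f1 (x + \<sigma> *\<^sub>R e + 0 *\<^sub>R d) = (h - 0) * f2 (x + \<sigma> *\<^sub>R e + \<tau> *\<^sub>R d)"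
    using MVT2[OF h q] by blast
  show ?thesis
  proof
    have "dist (x + \<sigma> *\<^sub>R e + \<tau> *\<^sub>R d) x = norm (\<sigma> *\<^sub>R e + \<tau> *\<^sub>R d)"
      by (simp add: dist_norm algebra_simps)
    also have "\<dots> \<le> \<sigma> + \<tau>" using norm_triangle_ineq[of "\<sigma> *\<^sub>R e" "\<tau> *\<^sub>R d"] e d \<sigma> \<tau> by simp
    finally show "dist (x + \<sigma> *\<^sub>R e + \<tau> *\<^sub>R d) x \<le> 2 * h" using \<sigma> \<tau> by simp
    have "f (x + h *\<^sub>R e + h *\<^sub>R d) - f (x + h *\<^sub>R e) - f (x + h *\<^sub>R d) + f x = p h - p 0"
      by (simp add: p_def add.commute add.left_commute)
    also have "\<dots> = h\<^sup>2 * f2 (x + \<sigma> *\<^sub>R e + \<tau> *\<^sub>R d)"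
      using \<sigma>(3) \<tau>(3) by (simp add: power2_eq_square add.commute add.left_commute)
    finally show "f (x + h *\<^sub>R e + h *\<^sub>R d) - f (x + h *\<^sub>R e) - f (x + h *\<^sub>R d) + f x
      = h\<^sup>2 * f2 (x + \<sigma> *\<^sub>R e + \<tau> *\<^sub>R d)" .
  qed
qed

text \<open>Schwarz's theorem. The second difference over a parallelogram of side \<open>h\<close>
  is symmetric in the two directions and equals h^2 times either mixed derivative at some point
  within 2h of \<open>x\<close>; continuity finishes as h tends to 0.\<close>

lemma mixed_partials_commute:
  assumes f1: "\<And>x. has_pd e f f1 x" and f12: "\<And>x. has_pd d f1 f12 x"
    and f2: "\<And>x. has_pd d f f2 x" and f21: "\<And>x. has_pd e f2 f21 x"
    and cont: "continuous_on UNIV f12" "continuous_on UNIV f21"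
    and e: "norm e = 1" and d: "norm d = 1"
  shows "f12 x = f21 x"
proof -
  have "\<exists>y z. dist y x \<le> 2 * h \<and> dist z x \<le> 2 * h \<and> f12 y = f21 z" if h: "0 < h" for h
  proof -
    obtain y where y: "dist y x \<le> 2 * h"
      "f (x + h *\<^sub>R e + h *\<^sub>R d) - f (x + h *\<^sub>R e) - f (x + h *\<^sub>R d) + f x = h\<^sup>2 * f12 y"
      using second_difference_mean_value[OF f1 f12 e d h, of x] by blast
    obtain z where z: "dist z x \<le> 2 * h"
      "f (x + h *\<^sub>R d + h *\<^sub>R e) - f (x + h *\<^sub>R d) - f (x + h *\<^sub>R e) + f x = h\<^sup>2 * f21 z"
      using second_difference_mean_value[OF f2 f21 d e h, of x] by blast
    have "x + h *\<^sub>R d + h *\<^sub>R e = x + h *\<^sub>R e + h *\<^sub>R d" by (simp add: algebra_simps)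
    then have "h\<^sup>2 * f12 y = h\<^sup>2 * f21 z"
      unfolding y(2)[symmetric] z(2)[symmetric] by (simp only:)
    with h y z show ?thesis by auto
  qed
  then have "\<forall>n. \<exists>y z. dist y x \<le> 2 * inverse (real (Suc n)) \<and>
      dist z x \<le> 2 * inverse (real (Suc n)) \<and> f12 y = f21 z"
    by simp
  then obtain Y Z where YZ: "\<And>n. dist (Y n) x \<le> 2 * inverse (real (Suc n))"
    "\<And>n. dist (Z n) x \<le> 2 * inverse (real (Suc n))" "\<And>n. f12 (Y n) = f21 (Z n)"
    by metis
  have lim: "(\<lambda>n. 2 * inverse (real (Suc n))) \<longlonglongrightarrow> 0"
    using tendsto_mult[OF tendsto_const[of 2] LIMSEQ_inverse_real_of_nat] by simp
  have "Y \<longlonglongrightarrow> x" "Z \<longlonglongrightarrow> x"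
    using YZ by (auto intro!: metric_tendsto_imp_tendsto[OF lim] always_eventually simp del: of_nat_Suc)
  then have "(\<lambda>n. f12 (Y n)) \<longlonglongrightarrow> f12 x" "(\<lambda>n. f21 (Z n)) \<longlonglongrightarrow> f21 x"
    using cont by (auto intro: continuous_on_tendsto_compose)
  then show ?thesis using LIMSEQ_unique by (simp add: YZ(3))
qed

section \<open>Integration by parts for compactly supported functions\<close>

lemma continuous_on_extend_zero:
  fixes f :: "'a::topological_space \<Rightarrow> 'b::real_normed_vector"
  assumes "open S" "closed K" "K \<subseteq> S" "continuous_on S f" "\<And>x. x \<notin> K \<Longrightarrow> f x = 0"
  shows "continuous_on UNIV f"
proof -
  have "continuous_on (- K) f"
    using assms(5) continuous_on_cong[of "- K" "- K" f "\<lambda>_. 0"] by simp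
  then have "continuous_on (S \<union> - K) f"
    using assms by (intro continuous_on_open_Un) auto
  moreover have "S \<union> - K = UNIV" using assms by auto
  ultimately show ?thesis by simp
qed

lemma integrable_compact_support:
  fixes g :: "'a::euclidean_space \<Rightarrow> real"
  assumes K: "compact K" and g0: "\<And>x. x \<notin> K \<Longrightarrow> g x = 0" and cont: "continuous_on UNIV g"
  shows "integrable lborel g"
proof -
  have "compact (g ` K)" using K cont by (intro compact_continuous_image) (auto intro: continuous_on_subset)
  then obtain G where G: "\<forall>y\<in>g ` K. norm y \<le> G" using compact_imp_bounded bounded_iff by blast
  show ?thesis
  proof (rule Bochner_Integration.integrable_bound)
    show "integrable lborel (\<lambda>x. G * indicator K x)"
      using K by (intro integrable_mult_right integrable_real_indicator)
        (auto simp: emeasure_bounded_finite[unfolded infinity_ennreal_def] compact_imp_bounded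
          compact_imp_closed borel_closed)
    show "AE x in lborel. norm (g x) \<le> norm (G * indicator K x)"
      using G g0 by (intro AE_I2) (auto simp: indicator_def)
  qed (use cont in \<open>simp add: borel_measurable_continuous_onI\<close>)
qed

text \<open>Difference quotients integrate to zero by translation invariance of the Lebesgue measure.\<close>

lemma integral_pd_compact_support:
  fixes g g' :: "'a::euclidean_space \<Rightarrow> real"
  assumes K: "compact K" and g0: "\<And>x. x \<notin> K \<Longrightarrow> g x = 0"
    and pd: "\<And>x. has_pd e g g' x"
    and cont: "continuous_on UNIV g" "continuous_on UNIV g'"
  shows "(\<integral>x. g' x \<partial>lborel) = 0"
proof -
  have g'0: "g' x = 0" if "x \<notin> K" for x
    using has_pd_zero_off[OF pd compact_imp_closed[OF K] that g0] .
  have "compact (g' ` K)" using K cont by (intro compact_continuous_image) (auto intro: continuous_on_subset)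
  then obtain B0 where B0: "\<forall>y\<in>g' ` K. norm y \<le> B0" using compact_imp_bounded bounded_iff by blast
  define B where "B = max B0 0"
  have B: "\<bar>g' x\<bar> \<le> B" for x
    using B0 g'0[of x] by (cases "x \<in> K") (auto simp: B_def intro: max.coboundedI1)
  obtain R where R: "\<And>x. x \<in> K \<Longrightarrow> norm x \<le> R" using compact_imp_bounded[OF K] bounded_iff by metis
  define h where "h n = inverse (real (Suc n))" for n
  have h: "0 < h n" "h n \<le> 1" for n
    by (auto simp: h_def inverse_le_1_iff)
  have hl: "h \<longlonglongrightarrow> 0" unfolding h_def by (rule LIMSEQ_inverse_real_of_nat)
  define q where "q n x = (g (x + h n *\<^sub>R e) - g x) / h n" for n x
  have [measurable]: "g \<in> borel_measurable borel" "g' \<in> borel_measurable borel"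
    using cont by (auto intro: borel_measurable_continuous_onI)
  \<comment> \<open>An integrable majorant: the mean value theorem bounds the quotients by
    \<open>B\<close>, and as \<open>h n \<le> 1\<close> they vanish outside this ball.\<close>
  have qB: "\<bar>q n x\<bar> \<le> B * indicator (cball 0 (R + norm e)) x" for n x
  proof -
    obtain z where "g (x + h n *\<^sub>R e) - g (x + 0 *\<^sub>R e) = (h n - 0) * g' (x + z *\<^sub>R e)"
      using MVT2[OF h(1)[of n] has_pd_at[OF pd]] by blast
    then have "q n x = g' (x + z *\<^sub>R e)" using h(1)[of n] by (simp add: q_def)
    then have 1: "\<bar>q n x\<bar> \<le> B" using B by simp
    have 2: "q n x = 0" if "x \<notin> cball 0 (R + norm e)"
    proof -
      have "R + norm e < norm x" using that by simp
      moreover have "norm x \<le> norm (x + h n *\<^sub>R e) + norm e"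
      proof -
        have "norm x \<le> norm (x + h n *\<^sub>R e) + norm (h n *\<^sub>R e)"
          using norm_triangle_ineq4[of "x + h n *\<^sub>R e" "h n *\<^sub>R e"] by simp
        also have "norm (h n *\<^sub>R e) \<le> 1 * norm e"
          using h[of n] by (simp add: mult_left_le_one_le)
        finally show ?thesis by simp
      qed
      ultimately have "x \<notin> K" "x + h n *\<^sub>R e \<notin> K"
        using R[of x] R[of "x + h n *\<^sub>R e"] norm_ge_zero[of e] by linarith+
      then show ?thesis by (simp add: q_def g0)
    qed
    show ?thesis using 1 2 by (cases "x \<in> cball 0 (R + norm e)") auto
  qed
  have "(\<lambda>n. \<integral>x. q n x \<partial>lborel) \<longlonglongrightarrow> (\<integral>x. g' x \<partial>lborel)"
  proof (rule integral_dominated_convergence)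
    show "integrable lborel (\<lambda>x. B * indicator (cball 0 (R + norm e)) x)"
      by (intro integrable_mult_right integrable_real_indicator) (auto simp: emeasure_bounded_finite[unfolded infinity_ennreal_def])
    show "AE x in lborel. (\<lambda>n. q n x) \<longlonglongrightarrow> g' x"
    proof (intro AE_I2)
      fix x
      have "((\<lambda>t. (g (x + t *\<^sub>R e) - g x) / t) \<longlongrightarrow> g' x) (at 0)"
        using pd[of x] by (simp add: has_pd_def has_field_derivative_iff)
      moreover have "filterlim h (at 0) sequentially"
        using hl h by (auto simp: filterlim_at less_imp_neq intro!: always_eventually) (metis less_irrefl)
      ultimately show "(\<lambda>n. q n x) \<longlonglongrightarrow> g' x"
        unfolding q_def by (rule filterlim_compose)
    qed
    show "AE x in lborel. norm (q n x) \<le> B * indicator (cball 0 (R + norm e)) x" for n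
      using qB by simp
  qed (auto simp: q_def)
  moreover have "(\<integral>x. q n x \<partial>lborel) = 0" for n
  proof -
    have ig: "integrable lborel g" by (rule integrable_compact_support[OF K g0 cont(1)])
    have d: "lborel = distr lborel borel ((+) (h n *\<^sub>R e))" by (rule lborel_distr_plus[symmetric])
    have ig': "integrable lborel (\<lambda>x. g (x + h n *\<^sub>R e))"
      using ig by (subst (asm) d, subst (asm) integrable_distr_eq) (auto simp: add.commute)
    have eq: "(\<integral>x. g (x + h n *\<^sub>R e) \<partial>lborel) = (\<integral>x. g x \<partial>lborel)"
      by (subst (2) d, subst integral_distr) (auto simp: add.commute)
    show ?thesis unfolding q_def using ig ig' eq by simp
  qed
  ultimately show ?thesis by (simp add: LIMSEQ_const_iff)
qed

text \<open>The derivative of \<open>c * h\<close> integrates to zero without boundary terms. The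
  coefficient \<open>c\<close> is regular on \<Omega> only, but \<open>h\<close> vanishes off a
  compact subset, so the product is globally regular. With \<open>c = 1\<close> this gives weak
  derivatives, with products of the \<open>a l\<close> the cancellation of the mixed terms.\<close>

lemma integral_pd_product:
  fixes c c' h h' :: "'a::euclidean_space \<Rightarrow> real"
  assumes \<Omega>: "open \<Omega>" and K: "compact K" "K \<subseteq> \<Omega>" and h0: "\<And>x. x \<notin> K \<Longrightarrow> h x = 0"
    and pdh: "\<And>x. has_pd e h h' x" and pdc: "\<And>x. x \<in> \<Omega> \<Longrightarrow> has_pd e c c' x"
    and conth: "continuous_on UNIV h" "continuous_on UNIV h'"
    and contc: "continuous_on \<Omega> c" "continuous_on \<Omega> c'"
  shows "(\<integral>x. c' x * h x + c x * h' x \<partial>(lebesgue_on \<Omega>)) = 0"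
    and "integrable (lebesgue_on \<Omega>) (\<lambda>x. c' x * h x + c x * h' x)"
proof -
  have cK: "closed K" using K compact_imp_closed by blast
  have h'0: "h' x = 0" if "x \<notin> K" for x
    using has_pd_zero_off[OF pdh cK that h0] .
  let ?g = "\<lambda>x. c' x * h x + c x * h' x"
  have cont: "continuous_on UNIV (\<lambda>x. c x * h x)" "continuous_on UNIV ?g"
    by (rule continuous_on_extend_zero[OF \<Omega> cK K(2)];
        auto simp: h0 h'0 intro!: continuous_intros contc continuous_on_subset[OF conth(1)]
          continuous_on_subset[OF conth(2)])+
  have pd: "has_pd e (\<lambda>x. c x * h x) ?g x" for x
  proof (cases "x \<in> K")
    case True
    then show ?thesis using has_pd_mult[OF pdc pdh, of x] K by auto
  next
    case False
    show ?thesis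
      by (rule has_pd_local[OF has_pd_const[of e 0 x], of "- K"]) (use False cK h0 h'0 in auto)
  qed
  have "(\<integral>x. ?g x \<partial>lborel) = 0"
    by (rule integral_pd_compact_support[OF K(1) _ pd cont]) (simp add: h0)
  then have 1: "(\<integral>x. ?g x \<partial>lebesgue) = 0"
    using cont(2) by (subst integral_completion) (auto intro: borel_measurable_continuous_onI)
  have 2: "(\<integral>x. ?g x \<partial>(lebesgue_on \<Omega>)) = (\<integral>x. indicator \<Omega> x *\<^sub>R ?g x \<partial>lebesgue)"
    using \<Omega> by (intro integral_restrict_space) auto
  have 3: "indicator \<Omega> x *\<^sub>R ?g x = ?g x" for x
    using K h0[of x] h'0[of x] by (cases "x \<in> K") auto
  show "(\<integral>x. ?g x \<partial>(lebesgue_on \<Omega>)) = 0" using 1 2 3 by (simp only:)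
  have "integrable lborel ?g"
    by (rule integrable_compact_support[OF K(1) _ cont(2)]) (simp add: h0 h'0)
  then have "integrable lebesgue (\<lambda>x. indicator \<Omega> x *\<^sub>R ?g x)"
    unfolding 3 using cont(2) by (subst integrable_completion) (auto intro: borel_measurable_continuous_onI)
  then show "integrable (lebesgue_on \<Omega>) ?g"
    using \<Omega> by (subst integrable_restrict_space) auto
qed

section \<open>Smooth functions through iterated partial derivatives\<close>

lemma ipd_append: "ipd (ls @ ks) f = ipd ls (ipd ks f)"
  by (induction ls) auto

text \<open>A class of continuous functions closed under first partial derivatives contains all
  iterated ones, by induction on the list of directions. Smoothness proofs thus reduce to exhibiting
  such a class.\<close>

lemma smooth_on_UNIV_coinduct:
  assumes "f \<in> C"
    and C: "\<And>f. f \<in> C \<Longrightarrow> continuous_on UNIV f \<and> (\<forall>l. \<exists>f'\<in>C. \<forall>x. has_pd (axis l 1) f f' x)"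
  shows "smooth_on UNIV f"
proof -
  have ipd1: "\<exists>f'\<in>C. ipd [l] f = f'" if "f \<in> C" for f l
  proof -
    obtain f' where f': "f' \<in> C" "\<And>x. has_pd (axis l 1) f f' x" using C[OF \<open>f \<in> C\<close>] by blast
    have "ipd [l] f x = f' x" for x
      using f'(2)[of x] DERIV_imp_deriv by (simp add: has_pd_def)
    with f'(1) show ?thesis by auto
  qed
  have ipdC: "ipd ls f \<in> C" for ls
  proof (induction ls)
    case (Cons l ls)
    then show ?case using ipd1[of "ipd ls f" l] by simp
  qed (use assms in simp)
  show ?thesis
    unfolding smooth_on_def
  proof (intro allI conjI ballI)
    fix ls l x
    show "continuous_on UNIV (ipd ls f)" using C ipdC by blast
    obtain f' where "has_pd (axis l 1) (ipd ls f) f' x" using C[OF ipdC] by blast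
    then show "(\<lambda>t. ipd ls f (x + t *\<^sub>R axis l 1)) differentiable (at 0)"
      by (auto simp: has_pd_def real_differentiable_def)
  qed
qed

lemma smooth_on_continuous: "smooth_on UNIV f \<Longrightarrow> continuous_on UNIV f"
  unfolding smooth_on_def by (metis ipd.simps(1))

lemma smooth_on_ipd: "smooth_on UNIV f \<Longrightarrow> smooth_on UNIV (ipd ks f)"
  unfolding smooth_on_def by (metis ipd_append)

lemma smooth_on_has_pd:
  assumes "smooth_on UNIV f"
  shows "has_pd (axis l 1) f (ipd [l] f) x"
proof -
  have "(\<lambda>t. ipd [] f (x + t *\<^sub>R axis l 1)) differentiable (at 0)"
    using assms unfolding smooth_on_def by blast
  then show ?thesis
    by (simp add: has_pd_def) (metis DERIV_imp_deriv real_differentiable_def)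
qed

lemma has_pd_imp_ipd: "(\<And>x. has_pd (axis l 1) f f' x) \<Longrightarrow> ipd [l] f = f'"
  by (auto simp: has_pd_def DERIV_imp_deriv)

lemma smooth_on_lincomb:
  assumes "smooth_on UNIV f" "smooth_on UNIV g"
  shows "smooth_on UNIV (\<lambda>x. c * f x + d * g x)"
proof (rule smooth_on_UNIV_coinduct)
  let ?C = "{\<lambda>x. c * f x + d * g x | f g. smooth_on UNIV f \<and> smooth_on UNIV g}"
  show "(\<lambda>x. c * f x + d * g x) \<in> ?C" using assms by blast
  fix F assume "F \<in> ?C"
  then obtain f g where F: "F = (\<lambda>x. c * f x + d * g x)" "smooth_on UNIV f" "smooth_on UNIV g"
    by blast
  have "continuous_on UNIV F"
    unfolding F(1) by (intro continuous_intros smooth_on_continuous F)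
  moreover have "\<exists>f'\<in>?C. \<forall>x. has_pd (axis l 1) F f' x" for l
  proof (rule bexI[of _ "\<lambda>x. c * ipd [l] f x + d * ipd [l] g x"], intro allI)
    show "has_pd (axis l 1) F (\<lambda>x. c * ipd [l] f x + d * ipd [l] g x) x" for x
      unfolding F(1) by (intro has_pd_add has_pd_cmult smooth_on_has_pd F)
  qed (use F smooth_on_ipd in blast)
  ultimately show "continuous_on UNIV F \<and> (\<forall>l. \<exists>f'\<in>?C. \<forall>x. has_pd (axis l 1) F f' x)" by blast
qed

lemma ipd_lincomb:
  assumes "smooth_on UNIV f" "smooth_on UNIV g"
  shows "ipd [l] (\<lambda>x. c * f x + d * g x) x = c * ipd [l] f x + d * ipd [l] g x"
proof -
  have "ipd [l] (\<lambda>x. c * f x + d * g x) = (\<lambda>x. c * ipd [l] f x + d * ipd [l] g x)"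
    by (intro has_pd_imp_ipd has_pd_add has_pd_cmult smooth_on_has_pd assms)
  then show ?thesis by metis
qed

lemma ipd_commute:
  assumes "smooth_on UNIV f"
  shows "ipd [l] (ipd [m] f) x = ipd [m] (ipd [l] f) x"
proof (rule mixed_partials_commute[where f = f and e = "axis m 1" and d = "axis l 1"])
  show "has_pd (axis m 1) f (ipd [m] f) x" "has_pd (axis l 1) f (ipd [l] f) x"
    "has_pd (axis l 1) (ipd [m] f) (ipd [l] (ipd [m] f)) x"
    "has_pd (axis m 1) (ipd [l] f) (ipd [m] (ipd [l] f)) x" for x
    by (intro smooth_on_has_pd smooth_on_ipd assms)+
  show "continuous_on UNIV (ipd [l] (ipd [m] f))" "continuous_on UNIV (ipd [m] (ipd [l] f))"
    by (intro smooth_on_continuous smooth_on_ipd assms)+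
qed auto

section \<open>Bump functions and the fundamental lemma of the calculus of variations\<close>

text \<open>With \<open>X t = (t - \<alpha>) (\<beta> - t)\<close>, the functions \<open>P X\<^sup>-\<^sup>k exp (- c / X)\<close> on \<open>(\<alpha>, \<beta>)\<close>, extended by zero,
  form a class that is closed under differentiation.\<close>

definition bumpX :: "real \<Rightarrow> real \<Rightarrow> real poly" where
  "bumpX \<alpha> \<beta> = [:- (\<alpha> * \<beta>), \<alpha> + \<beta>, -1:]"

definition bump :: "real \<Rightarrow> real \<Rightarrow> real \<Rightarrow> real poly \<Rightarrow> nat \<Rightarrow> real \<Rightarrow> real" where
  "bump c \<alpha> \<beta> P k t = (if \<alpha> < t \<and> t < \<beta>
     then poly P t / poly (bumpX \<alpha> \<beta>) t ^ k * exp (- c / poly (bumpX \<alpha> \<beta>) t) else 0)"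

lemma poly_bumpX: "poly (bumpX \<alpha> \<beta>) t = (t - \<alpha>) * (\<beta> - t)"
  by (simp add: bumpX_def algebra_simps)

lemma power_over_fact_le_exp:
  fixes y :: real
  assumes "0 \<le> y"
  shows "y ^ n / fact n \<le> exp y"
proof -
  have "sum (\<lambda>m. y ^ m /\<^sub>R fact m) {n} \<le> (\<Sum>m. y ^ m /\<^sub>R fact m)"
    using assms by (intro sum_le_suminf sums_summable[OF exp_converges]) auto
  then show ?thesis by (simp add: exp_def divide_inverse mult.commute)
qed

text \<open>One term of the exponential series of c/x, of order k + 2, already beats the pole of
  order k and leaves two powers of x. They make the extension by zero differentiable at the end
  points.\<close>

lemma exp_inverse_bound:
  fixes c :: real
  assumes c: "0 < c"
  obtains A where "0 \<le> A" "\<And>x. 0 < x \<Longrightarrow> exp (- c / x) / x ^ k \<le> A * x\<^sup>2"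
proof
  define m where "m = k + 2"
  show "0 \<le> fact m / c ^ m" using c by simp
  show "exp (- c / x) / x ^ k \<le> fact m / c ^ m * x\<^sup>2" if x: "0 < x" for x
  proof -
    have "(c / x) ^ m / fact m \<le> exp (c / x)"
      using x c by (intro power_over_fact_le_exp) auto
    then have "c ^ m \<le> exp (c / x) * (fact m * x ^ m)"
      using x by (simp add: power_divide divide_le_eq mult_ac)
    then have "exp (- c / x) * c ^ m \<le> exp (- c / x) * (exp (c / x) * (fact m * x ^ m))"
      by (intro mult_left_mono) auto
    also have "\<dots> = fact m * x ^ m"
      using exp_add[of "- c / x" "c / x"] by (simp add: mult.assoc[symmetric])
    also have "\<dots> = fact m * x\<^sup>2 * x ^ k"
      by (simp add: m_def power_add power2_eq_square)
    finally have "exp (- c / x) * c ^ m \<le> fact m * x\<^sup>2 * x ^ k" .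
    then show ?thesis
      using x c by (simp add: pos_divide_le_eq pos_le_divide_eq mult_ac)
  qed
qed

lemma DERIV_zero_of_quadratic_bound:
  fixes f :: "real \<Rightarrow> real"
  assumes "f a = 0" "\<And>t. \<bar>f t\<bar> \<le> L * (t - a)\<^sup>2"
  shows "(f has_real_derivative 0) (at a)"
  unfolding has_field_derivative_iff
proof (rule Lim_null_comparison)
  show "((\<lambda>h. \<bar>L\<bar> * \<bar>h - a\<bar>) \<longlongrightarrow> 0) (at a)"
    by (auto intro!: tendsto_eq_intros)
  show "\<forall>\<^sub>F h in at a. norm ((f h - f a) / (h - a)) \<le> \<bar>L\<bar> * \<bar>h - a\<bar>"
  proof (rule eventually_mono[OF eventually_neq_at_within[of a]])
    fix h assume "h \<noteq> a"
    have "\<bar>f h\<bar> \<le> \<bar>L\<bar> * \<bar>h - a\<bar> * \<bar>h - a\<bar>"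
      using assms(2)[of h] mult_right_mono[OF abs_ge_self[of L] zero_le_power2[of "h - a"]]
      by (simp add: power2_eq_square mult.assoc)
    then show "norm ((f h - f a) / (h - a)) \<le> \<bar>L\<bar> * \<bar>h - a\<bar>"
      using \<open>h \<noteq> a\<close> assms(1) by (simp add: field_simps)
  qed
qed

lemma bump_outside: "\<not> (\<alpha> < t \<and> t < \<beta>) \<Longrightarrow> bump c \<alpha> \<beta> P k t = 0"
  unfolding bump_def by (rule if_not_P)

lemma bump_inside: "\<alpha> < t \<and> t < \<beta> \<Longrightarrow> bump c \<alpha> \<beta> P k t =
    poly P t / poly (bumpX \<alpha> \<beta>) t ^ k * exp (- c / poly (bumpX \<alpha> \<beta>) t)"
  unfolding bump_def by (rule if_P)

text \<open>For t inside the interval and \<open>a\<close> outside it or at an end, one factor of (t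
  - \<alpha>)(\<beta> - t) is at most |t - a| and the other at most \<beta> - \<alpha>. So the
  quadratic decay in X is quadratic decay in t - a, which forces derivative zero at
  \<open>a\<close>.\<close>

lemma bump_quadratic_bound:
  assumes c: "0 < c" and a: "\<not> (\<alpha> < a \<and> a < \<beta>)"
  obtains L where "\<And>t. \<bar>bump c \<alpha> \<beta> P k t\<bar> \<le> L * (t - a)\<^sup>2"
proof -
  have "compact (poly P ` {\<alpha>..\<beta>})" by (intro compact_continuous_image continuous_intros) auto
  then obtain B where B: "\<And>t. t \<in> {\<alpha>..\<beta>} \<Longrightarrow> \<bar>poly P t\<bar> \<le> B"
    using compact_imp_bounded bounded_iff by (metis image_eqI real_norm_def)
  obtain A where A: "0 \<le> A" "\<And>x. 0 < x \<Longrightarrow> exp (- c / x) / x ^ k \<le> A * x\<^sup>2"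
    using exp_inverse_bound[OF c] by blast
  let ?L = "\<bar>B\<bar> * (A * (\<beta> - \<alpha>)\<^sup>2)"
  have "\<bar>bump c \<alpha> \<beta> P k t\<bar> \<le> ?L * (t - a)\<^sup>2" for t
  proof (cases "\<alpha> < t \<and> t < \<beta>")
    case False
    have "0 \<le> ?L * (t - a)\<^sup>2" using A by simp
    with bump_outside[OF False] show ?thesis by simp
  next
    case t: True
    define x where "x = (t - \<alpha>) * (\<beta> - t)"
    have x: "0 < x" using t by (simp add: x_def)
    have xle: "x \<le> (\<beta> - \<alpha>) * \<bar>t - a\<bar>"
    proof (cases "a \<le> \<alpha>")
      case True
      have "x \<le> \<bar>t - a\<bar> * (\<beta> - \<alpha>)"
        unfolding x_def using t True by (intro mult_mono) auto
      then show ?thesis by (simp add: mult.commute)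
    next
      case False
      then show ?thesis unfolding x_def using t a by (intro mult_mono) auto
    qed
    have "\<bar>bump c \<alpha> \<beta> P k t\<bar> = \<bar>poly P t\<bar> * (exp (- c / x) / x ^ k)"
      using x by (simp add: bump_inside[OF t] poly_bumpX x_def[symmetric] abs_mult)
    also have "\<dots> \<le> \<bar>B\<bar> * (A * x\<^sup>2)"
      using B[of t] t x A by (intro mult_mono) auto
    also have "\<dots> \<le> \<bar>B\<bar> * (A * ((\<beta> - \<alpha>) * \<bar>t - a\<bar>)\<^sup>2)"
      using x xle A by (intro mult_left_mono power_mono) auto
    also have "\<dots> = ?L * (t - a)\<^sup>2" by (simp add: power_mult_distrib)
    finally show ?thesis .
  qed
  then show ?thesis using that by blast
qed

text \<open>The quotient and chain rules, brought to the common denominator x^(k+2): the new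
  numerator is again polynomial in t, so differentiation keeps the shape of the class. The truncated
  exponent \<open>k - Suc 0\<close> requires the case split.\<close>

lemma bump_derivative_identity:
  fixes p p' x x' E c :: real
  assumes "0 < x"
  shows "(p' * x ^ k - p * (of_nat k * (x' * x ^ (k - Suc 0)))) / (x ^ k * x ^ k) * E
      + E * (c * x' / (x * x)) * (p / x ^ k)
    = (p' * x\<^sup>2 - of_nat k * (p * x' * x) + c * (p * x')) / x ^ (k + 2) * E"
proof (cases k)
  case 0
  with assms show ?thesis by (simp add: field_simps power2_eq_square)
next
  case (Suc j)
  define y where "y = x ^ j"
  have y: "0 < y" using assms by (simp add: y_def)
  have e: "x ^ k = x * y" "x ^ (k - Suc 0) = y" "x ^ (k + 2) = x * y * (x * x)"
    by (auto simp: Suc y_def power_add power2_eq_square)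
  show ?thesis unfolding e using assms y by (simp add: field_simps power2_eq_square)
qed

lemma bump_has_derivative:
  assumes c: "0 < c"
  obtains Q where "\<And>t. (bump c \<alpha> \<beta> P k has_real_derivative bump c \<alpha> \<beta> Q (k + 2) t) (at t)"
proof
  let ?X = "bumpX \<alpha> \<beta>"
  define Q where "Q = pderiv P * ?X ^ 2 - smult (of_nat k) (P * pderiv ?X * ?X) + smult c (P * pderiv ?X)"
  fix t
  show "(bump c \<alpha> \<beta> P k has_real_derivative bump c \<alpha> \<beta> Q (k + 2) t) (at t)"
  proof (cases "\<alpha> < t \<and> t < \<beta>")
    case False
    then obtain L where "\<And>s. \<bar>bump c \<alpha> \<beta> P k s\<bar> \<le> L * (s - t)\<^sup>2"
      using bump_quadratic_bound[OF c False, of P k] by blast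
    with DERIV_zero_of_quadratic_bound[of "bump c \<alpha> \<beta> P k" t, OF bump_outside[OF False]] show ?thesis
      unfolding bump_outside[OF False, of c Q] by blast
  next
    case True
    define x where "x = poly ?X t"
    have x: "0 < x" using True by (simp add: poly_bumpX x_def)
    have X: "(poly ?X has_real_derivative poly (pderiv ?X) t) (at t)" by (rule poly_DERIV)
    have "((\<lambda>t. poly P t / poly ?X t ^ k) has_real_derivative
       (poly (pderiv P) t * x ^ k - poly P t * (of_nat k * (poly (pderiv ?X) t * x ^ (k - Suc 0))))
         / (x ^ k * x ^ k)) (at t)"
      unfolding x_def by (rule DERIV_divide[OF poly_DERIV DERIV_power[OF X]]) (use x x_def in simp)
    moreover have "((\<lambda>t. exp (- c / poly ?X t)) has_real_derivative
       exp (- c / x) * (c * poly (pderiv ?X) t / (x * x))) (at t)"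
      unfolding x_def
      by (rule DERIV_chain2[OF DERIV_exp] derivative_eq_intros X refl)+ (use x x_def in simp_all)
    ultimately have "((\<lambda>t. poly P t / poly ?X t ^ k * exp (- c / poly ?X t)) has_real_derivative
       (poly (pderiv P) t * x ^ k - poly P t * (of_nat k * (poly (pderiv ?X) t * x ^ (k - Suc 0))))
         / (x ^ k * x ^ k) * exp (- c / x)
       + exp (- c / x) * (c * poly (pderiv ?X) t / (x * x)) * (poly P t / x ^ k)) (at t)"
      unfolding x_def by (rule DERIV_mult)
    then have "((\<lambda>t. poly P t / poly ?X t ^ k * exp (- c / poly ?X t)) has_real_derivative
       (poly (pderiv P) t * x\<^sup>2 - of_nat k * (poly P t * poly (pderiv ?X) t * x)
          + c * (poly P t * poly (pderiv ?X) t)) / x ^ (k + 2) * exp (- c / x)) (at t)"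
      by (simp only: bump_derivative_identity[OF x])
    also have "poly (pderiv P) t * x\<^sup>2 - of_nat k * (poly P t * poly (pderiv ?X) t * x)
          + c * (poly P t * poly (pderiv ?X) t) = poly Q t"
      by (simp add: Q_def x_def)
    also have "poly Q t / x ^ (k + 2) * exp (- c / x) = bump c \<alpha> \<beta> Q (k + 2) t"
      unfolding bump_inside[OF True] x_def ..
    finally have "((\<lambda>t. poly P t / poly ?X t ^ k * exp (- c / poly ?X t)) has_real_derivative
        bump c \<alpha> \<beta> Q (k + 2) t) (at t)" .
    then show ?thesis
    proof (rule has_field_derivative_transform_within_open)
      show "open {\<alpha><..<\<beta>}" by simp
    qed (use True in \<open>auto simp: bump_inside\<close>)
  qed
qed

definition box_bump :: "real \<Rightarrow> real^3 \<Rightarrow> real^3 \<Rightarrow> (3 \<Rightarrow> real poly) \<Rightarrow> (3 \<Rightarrow> nat) \<Rightarrow> real^3 \<Rightarrow> real" where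
  "box_bump c \<alpha> \<beta> P k x = (\<Prod>i\<in>UNIV. bump c (\<alpha>$i) (\<beta>$i) (P i) (k i) (x$i))"

text \<open>Each coordinate carries its own polynomial and exponent: differentiating in direction
  \<open>l\<close> changes only \<open>P l\<close> and \<open>k l\<close>, so the class is closed
  under all partial derivatives.\<close>

lemma box_bump_smooth:
  assumes c: "0 < c"
  shows "smooth_on UNIV (box_bump c \<alpha> \<beta> P k)"
proof (rule smooth_on_UNIV_coinduct)
  let ?C = "{box_bump c \<alpha> \<beta> P k | P k. True}"
  show "box_bump c \<alpha> \<beta> P k \<in> ?C" by blast
  fix F assume "F \<in> ?C"
  then obtain P k where F: "F = box_bump c \<alpha> \<beta> P k" by blast
  have "continuous_on UNIV (bump c (\<alpha>$i) (\<beta>$i) (P i) (k i))" for i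
    using bump_has_derivative[OF c, of "\<alpha>$i" "\<beta>$i" "P i" "k i"]
    by (meson DERIV_continuous_on has_field_derivative_at_within)
  then have "continuous_on UNIV (\<lambda>x::real^3. bump c (\<alpha>$i) (\<beta>$i) (P i) (k i) (x$i))" for i
    by (rule continuous_on_compose2[where t = UNIV]) (auto intro: continuous_intros)
  then have "continuous_on UNIV F"
    unfolding F box_bump_def by (rule continuous_on_prod)
  moreover have "\<exists>f'\<in>?C. \<forall>x. has_pd (axis l 1) F f' x" for l
  proof -
    obtain Q where Q: "\<And>t. (bump c (\<alpha>$l) (\<beta>$l) (P l) (k l) has_real_derivative
        bump c (\<alpha>$l) (\<beta>$l) Q (k l + 2) t) (at t)"
      using bump_has_derivative[OF c] by blast
    have split: "box_bump c \<alpha> \<beta> P' k' x = bump c (\<alpha>$l) (\<beta>$l) (P' l) (k' l) (x$l) *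
        (\<Prod>i\<in>UNIV - {l}. bump c (\<alpha>$i) (\<beta>$i) (P' i) (k' i) (x$i))" for P' k' x
      unfolding box_bump_def by (rule prod.remove) auto
    have "has_pd (axis l 1) F (box_bump c \<alpha> \<beta> (P(l := Q)) (k(l := k l + 2))) x" for x
    proof -
      let ?R = "\<Prod>i\<in>UNIV - {l}. bump c (\<alpha>$i) (\<beta>$i) (P i) (k i) (x$i)"
      have 1: "F (x + t *\<^sub>R axis l 1) = bump c (\<alpha>$l) (\<beta>$l) (P l) (k l) (x$l + t) * ?R" for t
        unfolding F split
        by (intro arg_cong2[where f = times] prod.cong) (auto simp: axis_def)
      have 2: "box_bump c \<alpha> \<beta> (P(l := Q)) (k(l := k l + 2)) x = bump c (\<alpha>$l) (\<beta>$l) Q (k l + 2) (x$l) * ?R"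
        unfolding split by (intro arg_cong2[where f = times] prod.cong) auto
      have "((\<lambda>t. bump c (\<alpha>$l) (\<beta>$l) (P l) (k l) (x$l + t)) has_real_derivative
          bump c (\<alpha>$l) (\<beta>$l) Q (k l + 2) (x$l)) (at 0)"
        using Q[of "x$l"] DERIV_shift[of _ _ 0 "x$l"] by (simp add: add.commute)
      then show ?thesis
        unfolding has_pd_def 1 2 by (rule DERIV_cmult_right)
    qed
    then show ?thesis by blast
  qed
  ultimately show "continuous_on UNIV F \<and> (\<forall>l. \<exists>f'\<in>?C. \<forall>x. has_pd (axis l 1) F f' x)" by blast
qed

lemma box_bump_zero: "x \<notin> cbox \<alpha> \<beta> \<Longrightarrow> box_bump c \<alpha> \<beta> P k x = 0"
proof -
  assume "x \<notin> cbox \<alpha> \<beta>"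
  then obtain i where "\<not> (\<alpha>$i < x$i \<and> x$i < \<beta>$i)"
    by (auto simp: mem_box_cart) (meson less_imp_le)+
  then show ?thesis
    unfolding box_bump_def by (intro prod_zero[of UNIV]) (auto simp: bump_def)
qed

lemma box_bump_bounds:
  assumes "0 < c"
  shows "\<bar>box_bump c \<alpha> \<beta> (\<lambda>_. 1) (\<lambda>_. 0) x\<bar> \<le> 1"
proof -
  have "\<bar>bump c \<alpha> \<beta> 1 0 t\<bar> \<le> 1" for \<alpha> \<beta> t
    using assms by (auto simp: bump_def poly_bumpX)
  then show ?thesis
    unfolding box_bump_def abs_prod by (intro prod_le_1) auto
qed

text \<open>For fixed X > 0, exp (- c / X) tends to 1 as c tends to 0. Box indicators are therefore
  pointwise limits of test functions bounded by 1, ready for dominated convergence.\<close>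

lemma box_bump_tendsto:
  "(\<lambda>n. box_bump (inverse (real (Suc n))) \<alpha> \<beta> (\<lambda>_. 1) (\<lambda>_. 0) x) \<longlonglongrightarrow> indicator (box \<alpha> \<beta>) x"
proof -
  have "(\<lambda>n. bump (inverse (real (Suc n))) (\<alpha>$i) (\<beta>$i) 1 0 (x$i))
      \<longlonglongrightarrow> (if \<alpha>$i < x$i \<and> x$i < \<beta>$i then 1 else 0)" for i
  proof (cases "\<alpha>$i < x$i \<and> x$i < \<beta>$i")
    case True
    then have "0 < (x$i - \<alpha>$i) * (\<beta>$i - x$i)" by simp
    then have "(\<lambda>n. exp (- inverse (real (Suc n)) / ((x$i - \<alpha>$i) * (\<beta>$i - x$i)))) \<longlonglongrightarrow> exp (- 0 / ((x$i - \<alpha>$i) * (\<beta>$i - x$i)))"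
      by (intro tendsto_intros LIMSEQ_inverse_real_of_nat) auto
    with True show ?thesis by (simp add: bump_def poly_bumpX)
  qed (auto simp: bump_def)
  then have "(\<lambda>n. box_bump (inverse (real (Suc n))) \<alpha> \<beta> (\<lambda>_. 1) (\<lambda>_. 0) x)
      \<longlonglongrightarrow> (\<Prod>i\<in>UNIV. if \<alpha>$i < x$i \<and> x$i < \<beta>$i then 1 else 0)"
    unfolding box_bump_def by (intro tendsto_prod)
  also have "(\<Prod>i\<in>UNIV. if \<alpha>$i < x$i \<and> x$i < \<beta>$i then 1 else 0 :: real) = indicator (box \<alpha> \<beta>) x"
  proof (cases "x \<in> box \<alpha> \<beta>")
    case True
    then show ?thesis by (simp add: mem_box_cart)
  next
    case False
    then obtain i where "\<not> (\<alpha>$i < x$i \<and> x$i < \<beta>$i)" by (auto simp: mem_box_cart)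
    then have "(\<Prod>i\<in>UNIV. if \<alpha>$i < x$i \<and> x$i < \<beta>$i then 1 else 0 :: real) = 0"
      by (intro prod_zero) auto
    with False show ?thesis by simp
  qed
  finally show ?thesis .
qed

text \<open>Testing with bumps shows that \<open>g\<close> has integral zero over every closed box
  inside \<Omega>. Lebesgue differentiation then gives \<open>g = 0\<close> a.e. on each such box,
  and countably many of them cover \<Omega>.\<close>

lemma fundamental_lemma:
  fixes g :: "real^3 \<Rightarrow> 'b::euclidean_space"
  assumes \<Omega>: "open \<Omega>" and g: "integrable (lebesgue_on \<Omega>) g"
    and test: "\<And>\<psi>. test_fun \<Omega> \<psi> \<Longrightarrow> (\<integral>x. \<psi> x *\<^sub>R g x \<partial>(lebesgue_on \<Omega>)) = 0"
  shows "AE x in lebesgue_on \<Omega>. g x = 0"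
proof -
  have S: "\<Omega> \<in> sets lebesgue" using \<Omega> by auto
  have [measurable]: "g \<in> borel_measurable (lebesgue_on \<Omega>)" using g by auto
  have box0: "integral (cbox \<alpha> \<beta>) g = 0" if sub: "cbox \<alpha> \<beta> \<subseteq> \<Omega>" for \<alpha> \<beta>
  proof -
    define \<psi> where "\<psi> n = box_bump (inverse (real (Suc n))) \<alpha> \<beta> (\<lambda>_. 1) (\<lambda>_. 0)" for n
    have t: "test_fun \<Omega> (\<psi> n)" for n
      unfolding test_fun_def \<psi>_def
      by (intro conjI box_bump_smooth exI[of _ "cbox \<alpha> \<beta>"] allI impI box_bump_zero sub compact_cbox)
        (auto simp del: of_nat_Suc)
    have cont: "continuous_on UNIV (\<psi> n)" for n
      using t by (auto simp: test_fun_def intro: smooth_on_continuous)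
    have [measurable]: "\<psi> n \<in> borel_measurable (lebesgue_on \<Omega>)" for n
      using continuous_on_subset[OF cont, of \<Omega>] S by (intro continuous_imp_measurable_on_sets_lebesgue) auto
    have "(\<lambda>n. \<integral>x. \<psi> n x *\<^sub>R g x \<partial>(lebesgue_on \<Omega>)) \<longlonglongrightarrow> (\<integral>x. indicator (box \<alpha> \<beta>) x *\<^sub>R g x \<partial>(lebesgue_on \<Omega>))"
    proof (rule integral_dominated_convergence)
      show "integrable (lebesgue_on \<Omega>) (\<lambda>x. norm (g x))" using g by (rule integrable_norm)
      have "box \<alpha> \<beta> \<subseteq> \<Omega>" using sub box_subset_cbox by blast
      then have "box \<alpha> \<beta> \<in> sets (lebesgue_on \<Omega>)" using S by (subst sets_restrict_space_iff) auto
      then show "(\<lambda>x. indicator (box \<alpha> \<beta>) x *\<^sub>R g x) \<in> borel_measurable (lebesgue_on \<Omega>)"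
        by measurable
      show "AE x in lebesgue_on \<Omega>. (\<lambda>n. \<psi> n x *\<^sub>R g x) \<longlonglongrightarrow> indicator (box \<alpha> \<beta>) x *\<^sub>R g x"
        unfolding \<psi>_def by (intro AE_I2 tendsto_scaleR box_bump_tendsto tendsto_const)
      show "AE x in lebesgue_on \<Omega>. norm (\<psi> n x *\<^sub>R g x) \<le> norm (g x)" for n
        unfolding \<psi>_def using box_bump_bounds[of "inverse (real (Suc n))" \<alpha> \<beta>]
        by (intro AE_I2) (simp add: mult_left_le_one_le del: of_nat_Suc)
    qed auto
    then have "(\<integral>x. indicator (box \<alpha> \<beta>) x *\<^sub>R g x \<partial>(lebesgue_on \<Omega>)) = 0"
      using test[OF t] by (simp add: LIMSEQ_const_iff)
    moreover have "integrable (lebesgue_on \<Omega>) (\<lambda>x. indicator (box \<alpha> \<beta>) x *\<^sub>R g x)"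
    proof (rule Bochner_Integration.integrable_bound[OF g])
      have "box \<alpha> \<beta> \<subseteq> \<Omega>" using sub box_subset_cbox by blast
      then have "box \<alpha> \<beta> \<in> sets (lebesgue_on \<Omega>)" using S by (subst sets_restrict_space_iff) auto
      then show "(\<lambda>x. indicator (box \<alpha> \<beta>) x *\<^sub>R g x) \<in> borel_measurable (lebesgue_on \<Omega>)"
        by measurable
    qed (auto simp: indicator_def)
    ultimately have "integral \<Omega> (\<lambda>x. indicator (box \<alpha> \<beta>) x *\<^sub>R g x) = 0"
      using lebesgue_integral_eq_integral[OF _ S] by metis
    also have "(\<lambda>x. indicator (box \<alpha> \<beta>) x *\<^sub>R g x) = (\<lambda>x. if x \<in> box \<alpha> \<beta> then g x else 0)"
      by (auto simp: indicator_def)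
    also have "integral \<Omega> \<dots> = integral (box \<alpha> \<beta> \<inter> \<Omega>) g" by (rule integral_restrict_Int)
    also have "box \<alpha> \<beta> \<inter> \<Omega> = box \<alpha> \<beta>" using sub box_subset_cbox by blast
    finally show ?thesis by (simp add: integral_open_interval)
  qed
  have gi: "g integrable_on cbox \<alpha> \<beta>" if sub: "cbox \<alpha> \<beta> \<subseteq> \<Omega>" for \<alpha> \<beta>
  proof -
    have "g absolutely_integrable_on \<Omega>"
      using g S by (simp add: integrable_restrict_space set_integrable_def)
    then have "g absolutely_integrable_on cbox \<alpha> \<beta>"
      by (rule set_integrable_subset) (use sub in auto)
    then show ?thesis using set_lebesgue_integral_eq_integral(1) by blast
  qed
  have cell: "\<exists>N. negligible N \<and> (\<forall>x\<in>cbox a b - N. g x = 0)" if Q: "cbox a b \<subseteq> \<Omega>" for a b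
  proof -
    \<comment> \<open>Cut off to one box, since the differentiation theorem needs integrability over
      arbitrary boxes. Two boxes meet in a box, so every box integral of \<open>F\<close> still
      vanishes, and so do the averages.\<close>
    define F where "F x = (if x \<in> cbox a b then g x else 0)" for x
    have int: "\<exists>c d. cbox a b \<inter> cbox x y = cbox c d" for x y :: "real^3"
      unfolding Int_interval by blast
    have F: "F integrable_on cbox x y" "integral (cbox x y) F = 0" for x y
    proof -
      obtain c d where cd: "cbox a b \<inter> cbox x y = cbox c d" using int by blast
      then have sub: "cbox c d \<subseteq> \<Omega>" using Q by blast
      show "F integrable_on cbox x y" unfolding F_def integrable_restrict_Int cd using gi[OF sub] .
      show "integral (cbox x y) F = 0" unfolding F_def integral_restrict_Int cd using box0[OF sub] .
    qed
    obtain N where N: "negligible N"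
      "\<And>x e. \<lbrakk>x \<notin> N; 0 < e\<rbrakk> \<Longrightarrow> \<exists>d>0. \<forall>h. 0 < h \<and> h < d \<longrightarrow>
          norm (integral (cbox x (x + h *\<^sub>R One)) F /\<^sub>R h ^ DIM(real^3) - F x) < e"
      using integrable_ccontinuous_explicit[of F] F(1) by metis
    have "F x = 0" if "x \<notin> N" for x
    proof (rule ccontr)
      assume "F x \<noteq> 0"
      then obtain d where d: "d > 0" "\<And>h. 0 < h \<Longrightarrow> h < d \<Longrightarrow>
          norm (integral (cbox x (x + h *\<^sub>R One)) F /\<^sub>R h ^ DIM(real^3) - F x) < norm (F x)"
        using N(2)[OF \<open>x \<notin> N\<close>, of "norm (F x)"] by auto
      show False using d(2)[of "d / 2"] d(1) F(2) by simp
    qed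
    with N(1) show ?thesis by (intro exI[of _ N]) (metis Diff_iff F_def)
  qed
  obtain \<D> where D: "countable \<D>" "\<D> \<subseteq> Pow \<Omega>" "\<And>X. X \<in> \<D> \<Longrightarrow> \<exists>a b. X = cbox a b" "\<Union>\<D> = \<Omega>"
    by (rule open_countable_Union_open_cbox[OF \<Omega>], rule that)
  have "\<forall>X\<in>\<D>. \<exists>N. negligible N \<and> (\<forall>x\<in>X - N. g x = 0)"
  proof
    fix X assume X: "X \<in> \<D>"
    then obtain a b where ab: "X = cbox a b" using D(3) by blast
    with X D(2) have "cbox a b \<subseteq> \<Omega>" by auto
    from cell[OF this] show "\<exists>N. negligible N \<and> (\<forall>x\<in>X - N. g x = 0)" by (simp add: ab)
  qed
  then obtain N where N: "\<And>X. X \<in> \<D> \<Longrightarrow> negligible (N X)" "\<And>X x. X \<in> \<D> \<Longrightarrow> x \<in> X - N X \<Longrightarrow> g x = 0"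
    by metis
  have "negligible (\<Union>(N ` \<D>))"
    using N(1) D(1) by (intro negligible_countable_Union) auto
  then have "AE x in lebesgue. x \<notin> \<Union>(N ` \<D>)"
    unfolding negligible_iff_null_sets by (rule AE_not_in)
  then have "AE x in lebesgue. x \<in> \<Omega> \<longrightarrow> g x = 0"
    by (rule AE_mp, intro AE_I2 impI) (use N(2) D(4) in blast)
  then show ?thesis
    using S by (subst AE_restrict_space_iff) auto
qed

section \<open>Quaternion algebra\<close>

lemma distinct_4: "(1::4) \<noteq> 0" "(2::4) \<noteq> 0" "(3::4) \<noteq> 0" "(2::4) \<noteq> 1" "(3::4) \<noteq> 1" "(3::4) \<noteq> 2"
  by simp_all

lemma distinct_3: "(1::3) \<noteq> 0" "(2::3) \<noteq> 0" "(2::3) \<noteq> 1"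
  by simp_all

text \<open>Numerals of this type are taken modulo 4, so the index 4 is the index 0 of the real
  part.\<close>

lemma UNIV_4_from_0: "(UNIV::4 set) = {0, 1, 2, 3}"
proof -
  have "(4::4) = 0" by simp
  then show ?thesis using UNIV_4 by auto
qed

lemma UNIV_3_from_0: "(UNIV::3 set) = {0, 1, 2}"
proof -
  have "(3::3) = 0" by simp
  then show ?thesis using UNIV_3 by auto
qed

lemma quat_eq_iff: "(p::quat) = q \<longleftrightarrow> p$0 = q$0 \<and> p$1 = q$1 \<and> p$2 = q$2 \<and> p$3 = q$3"
proof -
  have "p = q \<longleftrightarrow> (\<forall>i\<in>UNIV. p$i = q$i)" by (simp add: vec_eq_iff)
  then show ?thesis unfolding UNIV_4_from_0 by simp
qed

lemma quat_inner: "(p::quat) \<bullet> q = p$0*q$0 + p$1*q$1 + p$2*q$2 + p$3*q$3"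
  unfolding inner_vec_def UNIV_4_from_0 using distinct_4 by simp

lemma sum_UNIV_3: "sum f (UNIV::3 set) = f 0 + f 1 + f 2"
  unfolding UNIV_3_from_0 using distinct_3 by (simp add: add.assoc)

lemma all_3: "(\<forall>l::3. P l) \<longleftrightarrow> P 0 \<and> P 1 \<and> P 2"
proof -
  have "(\<forall>l::3. P l) \<longleftrightarrow> (\<forall>l\<in>UNIV. P l)" by simp
  then show ?thesis unfolding UNIV_3_from_0 by simp
qed

lemma qmul_nth:
  "qmul p q $ 0 = p$0*q$0 - p$1*q$1 - p$2*q$2 - p$3*q$3"
  "qmul p q $ 1 = p$0*q$1 + p$1*q$0 + p$2*q$3 - p$3*q$2"
  "qmul p q $ 2 = p$0*q$2 - p$1*q$3 + p$2*q$0 + p$3*q$1"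
  "qmul p q $ 3 = p$0*q$3 + p$1*q$2 - p$2*q$1 + p$3*q$0"
  using distinct_4 by (simp_all add: qmul_def)

lemma qcnj_nth: "qcnj p $ 0 = p$0" "qcnj p $ 1 = - p$1" "qcnj p $ 2 = - p$2" "qcnj p $ 3 = - p$3"
  using distinct_4 by (simp_all add: qcnj_def)

lemma qe_nth:
  "qe 0 $ 0 = 0" "qe 0 $ 1 = 1" "qe 0 $ 2 = 0" "qe 0 $ 3 = 0"
  "qe 1 $ 0 = 0" "qe 1 $ 1 = 0" "qe 1 $ 2 = 1" "qe 1 $ 3 = 0"
  "qe 2 $ 0 = 0" "qe 2 $ 1 = 0" "qe 2 $ 2 = 0" "qe 2 $ 3 = 1"
  using distinct_4 distinct_3 distinct_4[symmetric] distinct_3[symmetric] by (simp_all add: qe_def)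

lemma axis_4_nth:
  "axis (0::4) (1::real) $ 0 = 1" "axis (0::4) (1::real) $ 1 = 0" "axis (0::4) (1::real) $ 2 = 0" "axis (0::4) (1::real) $ 3 = 0"
  "axis (1::4) (1::real) $ 0 = 0" "axis (1::4) (1::real) $ 1 = 1" "axis (1::4) (1::real) $ 2 = 0" "axis (1::4) (1::real) $ 3 = 0"
  "axis (2::4) (1::real) $ 0 = 0" "axis (2::4) (1::real) $ 1 = 0" "axis (2::4) (1::real) $ 2 = 1" "axis (2::4) (1::real) $ 3 = 0"
  "axis (3::4) (1::real) $ 0 = 0" "axis (3::4) (1::real) $ 1 = 0" "axis (3::4) (1::real) $ 2 = 0" "axis (3::4) (1::real) $ 3 = 1"
  using distinct_4 distinct_4[symmetric] by (simp_all add: axis_def)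

lemma bilinear_qmul: "bilinear qmul"
  unfolding bilinear_def
  by (intro conjI allI linearI) (simp_all add: quat_eq_iff qmul_nth algebra_simps)

lemmas qmul_add_left = bilinear_ladd[OF bilinear_qmul]
  and qmul_add_right = bilinear_radd[OF bilinear_qmul]
  and qmul_scaleR_left = bilinear_lmul[OF bilinear_qmul]
  and qmul_scaleR_right = bilinear_rmul[OF bilinear_qmul]

lemma linear_qmul_right: "linear (qmul p)" and linear_qmul_left: "linear (\<lambda>p. qmul p q)"
  using bilinear_qmul by (auto simp: bilinear_def)

lemma qmul_assoc: "qmul (qmul p q) r = qmul p (qmul q r)"
  by (simp add: quat_eq_iff qmul_nth algebra_simps)

lemma norm_qmul: "norm (qmul p q) = norm p * norm q"
proof -
  have "(norm (qmul p q))\<^sup>2 = (norm p)\<^sup>2 * (norm q)\<^sup>2"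
    unfolding power2_norm_eq_inner quat_inner qmul_nth by (simp add: algebra_simps)
  then have "(norm (qmul p q))\<^sup>2 = (norm p * norm q)\<^sup>2" by (simp add: power_mult_distrib)
  then show ?thesis by (rule power2_eq_imp_eq) auto
qed

lemma norm_qcnj: "norm (qcnj p) = norm p"
  by (simp add: norm_eq quat_inner qcnj_nth)

lemma norm_qe: "norm (qe l) = 1"
proof -
  have "\<forall>l. norm (qe l) = 1"
    unfolding all_3 by (simp add: norm_eq_1 quat_inner qe_nth)
  then show ?thesis by blast
qed

text \<open>The i-th component of r is the real part of r times the conjugate of the i-th unit, and
  the real part of conj(p) q is the Euclidean inner product. Components of the quaternionic pairing
  become real pairings with a right-multiplied second argument.\<close>

lemma qmul_qcnj_nth: "qmul (qcnj p) q $ i = p \<bullet> qmul q (qcnj (axis i 1))"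
proof -
  have "\<forall>i\<in>UNIV. qmul (qcnj p) q $ i = p \<bullet> qmul q (qcnj (axis i 1))"
    unfolding UNIV_4_from_0
    by (simp add: quat_inner qmul_nth qcnj_nth axis_4_nth)
  then show ?thesis by blast
qed

lemma qmul_one: "qmul q (qcnj (axis 0 1)) = q"
  by (simp add: quat_eq_iff qmul_nth qcnj_nth axis_4_nth)

lemma qmul_qe_inner: "qmul (qe l) p \<bullet> qmul (qe l) q = p \<bullet> q"
proof -
  have "\<forall>l. qmul (qe l) p \<bullet> qmul (qe l) q = p \<bullet> q"
    unfolding all_3 by (simp add: quat_inner qmul_nth qe_nth)
  then show ?thesis by blast
qed

text \<open>For distinct units the product conj(e_l) e_m is, up to sign, another imaginary unit, and
  left multiplication by it is antisymmetric for the inner product. This is the form in which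
  anticommutativity is used.\<close>

lemma qmul_qe_inner_skew:
  assumes "l \<noteq> m"
  shows "qmul (qe l) q \<bullet> qmul (qe m) p = - (qmul (qe l) p \<bullet> qmul (qe m) q)"
proof -
  have "\<forall>l m. l \<noteq> m \<longrightarrow> qmul (qe l) q \<bullet> qmul (qe m) p = - (qmul (qe l) p \<bullet> qmul (qe m) q)"
    unfolding all_3 by (simp add: quat_inner qmul_nth qe_nth algebra_simps)
  with assms show ?thesis by blast
qed

section \<open>Test functions and weak derivatives\<close>

lemma smooth_on_zero: "smooth_on UNIV (\<lambda>x. 0)"
  by (rule smooth_on_UNIV_coinduct[of _ "{\<lambda>x. 0}"]) (auto intro: has_pd_const)

lemma smooth_on_sum:
  assumes "finite J" "\<And>j. j \<in> J \<Longrightarrow> smooth_on UNIV (f j)"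
  shows "smooth_on UNIV (\<lambda>x. \<Sum>j\<in>J. c j * f j x)"
  using assms
proof (induction J rule: finite_induct)
  case empty
  show ?case using smooth_on_zero by simp
next
  case (insert j J)
  then have "smooth_on UNIV (\<lambda>x. c j * f j x + 1 * (\<Sum>j\<in>J. c j * f j x))"
    by (intro smooth_on_lincomb) auto
  with insert show ?case by simp
qed

lemma ipd_sum:
  assumes "\<And>j. j \<in> J \<Longrightarrow> smooth_on UNIV (f j)"
  shows "ipd [l] (\<lambda>x. \<Sum>j\<in>J. c j * f j x) x = (\<Sum>j\<in>J. c j * ipd [l] (f j) x)"
proof -
  have "ipd [l] (\<lambda>x. \<Sum>j\<in>J. c j * f j x) = (\<lambda>x. \<Sum>j\<in>J. c j * ipd [l] (f j) x)"
    by (intro has_pd_imp_ipd has_pd_sum has_pd_cmult smooth_on_has_pd assms)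
  then show ?thesis by metis
qed

text \<open>Function and gradient in one Euclidean-valued map: convergence in H^1 becomes plain L^2
  convergence of jets.\<close>

definition jet :: "(real^3 \<Rightarrow> quat) \<Rightarrow> real^3 \<Rightarrow> quat \<times> (quat^3)" where
  "jet \<phi> x = (\<phi> x, \<chi> l. qpd l \<phi> x)"

lemma qpd_nth: "qpd l \<phi> x $ i = ipd [l] (\<lambda>y. \<phi> y $ i) x"
  by (simp add: qpd_def del: ipd.simps)

lemma qtest_smooth: "qtest \<Omega> \<phi> \<Longrightarrow> smooth_on UNIV (\<lambda>x. \<phi> x $ i)"
  by (simp add: qtest_def test_fun_def)

lemma qtest_support:
  assumes "qtest \<Omega> \<phi>"
  obtains K where "compact K" "K \<subseteq> \<Omega>" "\<And>x. x \<notin> K \<Longrightarrow> \<phi> x = 0" "\<And>x l. x \<notin> K \<Longrightarrow> qpd l \<phi> x = 0"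
proof -
  have "\<forall>i. \<exists>K. compact K \<and> K \<subseteq> \<Omega> \<and> (\<forall>x. x \<notin> K \<longrightarrow> \<phi> x $ i = 0)"
    using assms by (auto simp: qtest_def test_fun_def)
  then obtain K where K: "\<And>i. compact (K i)" "\<And>i. K i \<subseteq> \<Omega>" "\<And>i x. x \<notin> K i \<Longrightarrow> \<phi> x $ i = 0"
    by metis
  show ?thesis
  proof
    show c: "compact (\<Union>i. K i)" using K(1) by (intro compact_UN) auto
    show "(\<Union>i. K i) \<subseteq> \<Omega>" using K(2) by blast
    show z: "\<phi> x = 0" if "x \<notin> (\<Union>i. K i)" for x
      using that K(3) by (auto simp: vec_eq_iff)
    show "qpd l \<phi> x = 0" if "x \<notin> (\<Union>i. K i)" for x l
    proof -
      have "ipd [l] (\<lambda>y. \<phi> y $ i) x = 0" for i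
        by (rule has_pd_zero_off[OF smooth_on_has_pd[OF qtest_smooth[OF assms]] compact_imp_closed[OF c] that])
          (simp add: z)
      then show ?thesis by (simp add: vec_eq_iff qpd_nth)
    qed
  qed
qed

lemma continuous_on_vec_nth:
  fixes f :: "'a::topological_space \<Rightarrow> 'b::topological_space ^ 'n"
  assumes "\<And>i. continuous_on S (\<lambda>x. f x $ i)"
  shows "continuous_on S f"
  using continuous_on_vec_lambda[of S "\<lambda>i x. f x $ i"] assms by simp

lemma continuous_on_If_const:
  "continuous_on S f \<Longrightarrow> continuous_on S g \<Longrightarrow> continuous_on S (\<lambda>x. if b then f x else g x)"
  by (cases b) auto

lemma qtest_continuous: "qtest \<Omega> \<phi> \<Longrightarrow> continuous_on UNIV \<phi>"
  by (rule continuous_on_vec_nth) (rule smooth_on_continuous[OF qtest_smooth])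

lemma qpd_continuous: "qtest \<Omega> \<phi> \<Longrightarrow> continuous_on UNIV (qpd l \<phi>)"
  by (rule continuous_on_vec_nth)
    (unfold qpd_nth, rule smooth_on_continuous[OF smooth_on_ipd[OF qtest_smooth]])

lemma jet_continuous: "qtest \<Omega> \<phi> \<Longrightarrow> continuous_on UNIV (jet \<phi>)"
  unfolding jet_def[abs_def]
  by (intro continuous_on_Pair continuous_on_vec_lambda qtest_continuous qpd_continuous)

lemma qtest_comb:
  assumes "qtest \<Omega> \<phi>" "qtest \<Omega> \<psi>"
  shows "qtest \<Omega> (\<lambda>x. \<phi> x + t *\<^sub>R \<psi> x)"
    and "jet (\<lambda>x. \<phi> x + t *\<^sub>R \<psi> x) x = jet \<phi> x + t *\<^sub>R jet \<psi> x"
proof -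
  have s: "smooth_on UNIV (\<lambda>x. \<phi> x $ i)" "smooth_on UNIV (\<lambda>x. \<psi> x $ i)" for i
    using assms qtest_smooth by auto
  obtain K1 where K1: "compact K1" "K1 \<subseteq> \<Omega>" "\<And>x. x \<notin> K1 \<Longrightarrow> \<phi> x = 0"
    using qtest_support[OF assms(1)] by metis
  obtain K2 where K2: "compact K2" "K2 \<subseteq> \<Omega>" "\<And>x. x \<notin> K2 \<Longrightarrow> \<psi> x = 0"
    using qtest_support[OF assms(2)] by metis
  show "qtest \<Omega> (\<lambda>x. \<phi> x + t *\<^sub>R \<psi> x)"
    unfolding qtest_def test_fun_def
  proof (intro allI conjI exI[of _ "K1 \<union> K2"])
    show "smooth_on UNIV (\<lambda>x. (\<phi> x + t *\<^sub>R \<psi> x) $ i)" for i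
      using smooth_on_lincomb[OF s(1)[of i] s(2)[of i], of 1 t] by simp
  qed (use K1 K2 in auto)
  show "jet (\<lambda>x. \<phi> x + t *\<^sub>R \<psi> x) x = jet \<phi> x + t *\<^sub>R jet \<psi> x"
    using ipd_lincomb[OF s(1) s(2), of _ 1 _ t]
    by (simp add: jet_def vec_eq_iff qpd_nth del: ipd.simps)
qed

lemma qtest_zero: "qtest \<Omega> (\<lambda>x. 0)"
  using smooth_on_zero by (auto simp: qtest_def test_fun_def intro: exI[of _ "{}"])

lemma qtest_linear:
  assumes "qtest \<Omega> \<phi>" "linear L"
  shows "qtest \<Omega> (\<lambda>x. L (\<phi> x))" and "qpd l (\<lambda>x. L (\<phi> x)) x = L (qpd l \<phi> x)"
proof -
  have L: "L v $ i = (\<Sum>j\<in>UNIV. matrix L $ i $ j * v $ j)" for v i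
  proof -
    have "L v = matrix L *v v" using matrix_vector_mul(2)[OF assms(2)] by metis
    then show ?thesis by (simp add: matrix_vector_mult_def)
  qed
  note s = qtest_smooth[OF assms(1)]
  obtain K where K: "compact K" "K \<subseteq> \<Omega>" "\<And>x. x \<notin> K \<Longrightarrow> \<phi> x = 0"
    using qtest_support[OF assms(1)] by metis
  show "qtest \<Omega> (\<lambda>x. L (\<phi> x))"
    unfolding qtest_def test_fun_def
  proof (intro allI conjI exI[of _ K])
    show "smooth_on UNIV (\<lambda>x. L (\<phi> x) $ i)" for i
      unfolding L by (rule smooth_on_sum) (use s in auto)
  qed (use K linear_0[OF assms(2)] in auto)
  show "qpd l (\<lambda>x. L (\<phi> x)) x = L (qpd l \<phi> x)"
    unfolding vec_eq_iff qpd_nth L by (intro allI ipd_sum s)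
qed

section \<open>Square-integrable functions and weak derivatives on a bounded open set\<close>

locale bounded_open =
  fixes \<Omega> :: "(real^3) set"
  assumes \<Omega>_open: "open \<Omega>" and \<Omega>_bounded: "bounded \<Omega>"
begin

abbreviation "M \<equiv> lebesgue_on \<Omega>"

lemma \<Omega>_sets: "\<Omega> \<in> sets lebesgue"
  using \<Omega>_open by auto

lemma finite_M: "finite_measure M"
  using \<Omega>_open \<Omega>_bounded by (intro finite_measure_lebesgue_on lmeasurable_open)

lemma space_M: "space M = \<Omega>"
  by (simp add: space_restrict_space)

lemma set_integral_M: "(LINT x:\<Omega>|lebesgue. f x) = (\<integral>x. f x \<partial>M)"
  for f :: "real^3 \<Rightarrow> 'b::{banach, second_countable_topology}"
  using \<Omega>_sets by (simp add: set_lebesgue_integral_def integral_restrict_space)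

lemma L2_iff_sqint: "L2 \<Omega> u \<longleftrightarrow> sqint M u"
  using \<Omega>_sets unfolding L2_def sqint_def set_borel_measurable_def set_integrable_def
  by (simp add: borel_measurable_restrict_space_iff integrable_restrict_space)

lemma L2norm_eq_l2n: "L2norm \<Omega> u = l2n M u"
  unfolding L2norm_def l2n_def set_integral_M ..

lemma continuous_measurable_M:
  fixes f :: "real^3 \<Rightarrow> 'b::euclidean_space"
  assumes "continuous_on \<Omega> f"
  shows "f \<in> borel_measurable M"
  using assms \<Omega>_sets by (rule continuous_imp_measurable_on_sets_lebesgue)

lemma sqint_compact_support:
  fixes f :: "real^3 \<Rightarrow> 'b::euclidean_space"
  assumes "continuous_on UNIV f" "compact K" "\<And>x. x \<notin> K \<Longrightarrow> f x = 0"
  shows "sqint M f"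
proof -
  have "compact (f ` K)" using assms by (intro compact_continuous_image) (auto intro: continuous_on_subset)
  then obtain G where G: "\<forall>y\<in>f ` K. norm y \<le> G" using compact_imp_bounded bounded_iff by blast
  show ?thesis
  proof (rule sqint_bounded[OF finite_M])
    show "f \<in> borel_measurable M"
      using assms(1) by (intro continuous_measurable_M) (auto intro: continuous_on_subset)
    show "norm (f x) \<le> max G 0" for x
      using G assms(3)[of x] by (cases "x \<in> K") (auto intro: max.coboundedI1)
  qed
qed

lemma jet_sqint:
  assumes "qtest \<Omega> \<phi>"
  shows "sqint M (jet \<phi>)"
proof -
  obtain K where K: "compact K" "\<And>x. x \<notin> K \<Longrightarrow> \<phi> x = 0" "\<And>x l. x \<notin> K \<Longrightarrow> qpd l \<phi> x = 0"
    using qtest_support[OF assms] by metis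
  show ?thesis
    by (rule sqint_compact_support[OF jet_continuous[OF assms] K(1)])
      (simp add: jet_def K vec_eq_iff zero_prod_def)
qed

lemma sqint_fst:
  assumes "sqint M U"
  shows "sqint M (\<lambda>x. fst (U x))" "l2n M (\<lambda>x. fst (U x)) \<le> l2n M U"
proof -
  have "(\<lambda>x. fst (U x)) \<in> borel_measurable M"
    by (rule measurable_compose[OF sqint_measurable[OF assms]])
      (intro borel_measurable_continuous_onI continuous_intros)
  note m = this
  have 1: "norm (fst (U x)) \<le> 1 * norm (U x)" for x
    by (metis mult_1 norm_fst_le prod.collapse)
  show "sqint M (\<lambda>x. fst (U x))" "l2n M (\<lambda>x. fst (U x)) \<le> l2n M U"
    using sqint_bound[OF assms m 1] l2n_bound[OF assms m 1] by auto
qed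

lemma measurable_snd_nth:
  fixes U :: "real^3 \<Rightarrow> quat \<times> (quat^3)"
  assumes "U \<in> borel_measurable M"
  shows "(\<lambda>x. snd (U x)) \<in> borel_measurable M" "(\<lambda>x. snd (U x) $ l) \<in> borel_measurable M"
  by (rule measurable_compose[OF assms], intro borel_measurable_continuous_onI continuous_intros)+

lemma sqint_snd:
  fixes U :: "real^3 \<Rightarrow> quat \<times> (quat^3)"
  assumes "sqint M U"
  shows "sqint M (\<lambda>x. snd (U x))" "sqint M (\<lambda>x. snd (U x) $ l)"
    "l2n M (\<lambda>x. snd (U x)) \<le> l2n M U" "l2n M (\<lambda>x. snd (U x) $ l) \<le> l2n M U"
proof -
  have m: "(\<lambda>x. snd (U x)) \<in> borel_measurable M" "(\<lambda>x. snd (U x) $ l) \<in> borel_measurable M"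
    using assms measurable_snd_nth by (auto simp: sqint_def)
  have 1: "norm (snd (U x)) \<le> 1 * norm (U x)" for x
    by (metis mult_1 norm_snd_le prod.collapse)
  have 2: "norm (snd (U x) $ l) \<le> 1 * norm (U x)" for x
    using 1[of x] Finite_Cartesian_Product.norm_nth_le[of "snd (U x)" l] by linarith
  show "sqint M (\<lambda>x. snd (U x))" "l2n M (\<lambda>x. snd (U x)) \<le> l2n M U"
    using sqint_bound[OF assms m(1) 1] l2n_bound[OF assms m(1) 1] by auto
  show "sqint M (\<lambda>x. snd (U x) $ l)" "l2n M (\<lambda>x. snd (U x) $ l) \<le> l2n M U"
    using sqint_bound[OF assms m(2) 2] l2n_bound[OF assms m(2) 2] by auto
qed

lemma sqint_Pair:
  fixes g :: "3 \<Rightarrow> real^3 \<Rightarrow> quat" and u :: "real^3 \<Rightarrow> quat"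
  assumes "sqint M u" "\<And>l. sqint M (g l)"
  shows "sqint M (\<lambda>x. (u x, \<chi> l. g l x))"
    and "(l2n M (\<lambda>x. (u x, \<chi> l. g l x)))\<^sup>2 = (l2n M u)\<^sup>2 + (\<Sum>l\<in>UNIV. (l2n M (g l))\<^sup>2)"
proof -
  have m[measurable]: "u \<in> borel_measurable M" "g l \<in> borel_measurable M" for l
    using assms by (auto simp: sqint_def)
  have "(\<lambda>x. \<chi> l. g l x) \<in> borel_measurable M"
  proof -
    have "(\<lambda>x. \<chi> l. g l x) = (\<lambda>x. \<Sum>l\<in>UNIV. axis l (g l x))"
      by (auto simp: fun_eq_iff vec_eq_iff axis_def sum_component)
    moreover have "(\<lambda>x. axis l (g l x) :: quat^3) \<in> borel_measurable M" for l
    proof (rule measurable_compose[OF m(2)[of l]], rule borel_measurable_continuous_onI)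
      show "continuous_on UNIV (axis l :: quat \<Rightarrow> quat^3)"
        by (rule continuous_on_vec_nth) (simp only: axis_def vec_lambda_beta, intro continuous_on_If_const continuous_intros)
    qed
    ultimately show ?thesis by simp
  qed
  then have "(\<lambda>x. (u x, \<chi> l. g l x)) \<in> borel_measurable M" by measurable
  moreover have n: "(norm (u x, \<chi> l. g l x))\<^sup>2 = (norm (u x))\<^sup>2 + (\<Sum>l\<in>UNIV. (norm (g l x))\<^sup>2)" for x
    by (simp add: norm_Pair norm_vec_def L2_set_def sum_nonneg)
  moreover have i: "integrable M (\<lambda>x. (norm (u x))\<^sup>2)" "integrable M (\<lambda>x. (norm (g l x))\<^sup>2)" for l
    using assms by (auto simp: sqint_def)
  ultimately show "sqint M (\<lambda>x. (u x, \<chi> l. g l x))"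
    by (simp add: sqint_def)
  show "(l2n M (\<lambda>x. (u x, \<chi> l. g l x)))\<^sup>2 = (l2n M u)\<^sup>2 + (\<Sum>l\<in>UNIV. (l2n M (g l))\<^sup>2)"
    unfolding l2n_sq n using i by (simp add: Bochner_Integration.integral_sum)
qed

lemma sqint_integrable: "sqint M u \<Longrightarrow> integrable M u"
  for u :: "real^3 \<Rightarrow> 'b::euclidean_space"
proof -
  assume u: "sqint M u"
  have "sqint M (\<lambda>x. 1::real)" by (rule sqint_bounded[OF finite_M, of _ 1]) auto
  from sqint_prod_integrable[OF u this] have "integrable M (\<lambda>x. norm (u x))" by simp
  then show ?thesis using u by (simp add: sqint_def integrable_norm_iff)
qed

lemma test_fun_sqint:
  assumes "test_fun \<Omega> \<psi>"
  shows "sqint M \<psi>" "sqint M (ipd [l] \<psi>)"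
proof -
  obtain K where K: "compact K" "\<And>x. x \<notin> K \<Longrightarrow> \<psi> x = 0" "smooth_on UNIV \<psi>"
    using assms by (auto simp: test_fun_def)
  show "sqint M \<psi>" by (rule sqint_compact_support[OF smooth_on_continuous[OF K(3)] K(1,2)])
  show "sqint M (ipd [l] \<psi>)"
    by (rule sqint_compact_support[OF smooth_on_continuous[OF smooth_on_ipd[OF K(3)]] K(1)])
      (rule has_pd_zero_off[OF smooth_on_has_pd[OF K(3)] compact_imp_closed[OF K(1)] _ K(2)])
qed

lemma scaleR_integrable:
  fixes \<psi> :: "real^3 \<Rightarrow> real" and u :: "real^3 \<Rightarrow> 'b::euclidean_space"
  assumes "sqint M \<psi>" "sqint M u"
  shows "integrable M (\<lambda>x. \<psi> x *\<^sub>R u x)"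
  by (rule Bochner_Integration.integrable_bound[OF sqint_prod_integrable[OF assms]])
    (use assms in \<open>auto simp: sqint_def\<close>)

lemma scaleR_tendsto:
  fixes \<psi> :: "real^3 \<Rightarrow> real" and u :: "real^3 \<Rightarrow> 'b::euclidean_space"
  assumes \<psi>: "sqint M \<psi>" and us: "\<And>n. sqint M (us n)" and u: "sqint M u"
    and lim: "(\<lambda>n. l2n M (\<lambda>x. us n x - u x)) \<longlonglongrightarrow> 0"
  shows "(\<lambda>n. \<integral>x. \<psi> x *\<^sub>R us n x \<partial>M) \<longlonglongrightarrow> (\<integral>x. \<psi> x *\<^sub>R u x \<partial>M)"
proof (rule Lim_null[THEN iffD2], rule Lim_null_comparison)
  show "(\<lambda>n. l2n M \<psi> * l2n M (\<lambda>x. us n x - u x)) \<longlonglongrightarrow> 0"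
    by (auto intro!: tendsto_eq_intros lim)
  show "\<forall>\<^sub>F n in sequentially. norm ((\<integral>x. \<psi> x *\<^sub>R us n x \<partial>M) - (\<integral>x. \<psi> x *\<^sub>R u x \<partial>M))
      \<le> l2n M \<psi> * l2n M (\<lambda>x. us n x - u x)"
  proof (intro always_eventually allI)
    fix n
    have "(\<integral>x. \<psi> x *\<^sub>R us n x \<partial>M) - (\<integral>x. \<psi> x *\<^sub>R u x \<partial>M) = (\<integral>x. \<psi> x *\<^sub>R (us n x - u x) \<partial>M)"
      using scaleR_integrable[OF \<psi> us[of n]] scaleR_integrable[OF \<psi> u]
      by (simp add: scaleR_diff_right)
    also have "norm \<dots> \<le> (\<integral>x. norm (\<psi> x *\<^sub>R (us n x - u x)) \<partial>M)"
      by (rule integral_norm_bound)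
    also have "\<dots> \<le> l2n M \<psi> * l2n M (\<lambda>x. us n x - u x)"
      using l2n_cauchy_schwarz[OF \<psi> sqint_diff[OF us[of n] u]] by simp
    finally show "norm ((\<integral>x. \<psi> x *\<^sub>R us n x \<partial>M) - (\<integral>x. \<psi> x *\<^sub>R u x \<partial>M))
      \<le> l2n M \<psi> * l2n M (\<lambda>x. us n x - u x)" .
  qed
qed

lemma weak_partial_M:
  "weak_partial \<Omega> l u g \<longleftrightarrow> (\<forall>\<psi>. test_fun \<Omega> \<psi> \<longrightarrow>
     (\<integral>x. ipd [l] \<psi> x *\<^sub>R u x \<partial>M) = - (\<integral>x. \<psi> x *\<^sub>R g x \<partial>M))"
  unfolding weak_partial_def set_integral_M ..

lemma jet_component_sqint:
  assumes "qtest \<Omega> \<phi>"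
  shows "sqint M \<phi>" "sqint M (qpd l \<phi>)"
  using sqint_fst(1)[OF jet_sqint[OF assms]] sqint_snd(2)[OF jet_sqint[OF assms], of l]
  by (simp_all add: jet_def)

lemma weak_partial_qpd:
  assumes "qtest \<Omega> \<phi>"
  shows "weak_partial \<Omega> l \<phi> (qpd l \<phi>)"
  unfolding weak_partial_M
proof (intro allI impI)
  fix \<psi> assume \<psi>: "test_fun \<Omega> \<psi>"
  then obtain K where K: "compact K" "K \<subseteq> \<Omega>" "\<And>x. x \<notin> K \<Longrightarrow> \<psi> x = 0" and s: "smooth_on UNIV \<psi>"
    by (auto simp: test_fun_def)
  note i1 = scaleR_integrable[OF test_fun_sqint(2)[OF \<psi>] jet_component_sqint(1)[OF assms], of l]
    and i2 = scaleR_integrable[OF test_fun_sqint(1)[OF \<psi>] jet_component_sqint(2)[OF assms], of l]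
  note sm = qtest_smooth[OF assms]
  let ?F = "\<lambda>x. ipd [l] \<psi> x *\<^sub>R \<phi> x + \<psi> x *\<^sub>R qpd l \<phi> x"
  have "(\<integral>x. ?F x \<partial>M) $ i = 0" for i
  proof -
    let ?h' = "\<lambda>x. ipd [l] \<psi> x * \<phi> x $ i + \<psi> x * ipd [l] (\<lambda>y. \<phi> y $ i) x"
    \<comment> \<open>The shape required by \<open>integral_pd_product\<close> with constant
      coefficient 1.\<close>
    have "(\<integral>x. 0 * (\<psi> x * \<phi> x $ i) + 1 * ?h' x \<partial>M) = 0"
    proof (rule integral_pd_product(1)[OF \<Omega>_open K(1,2)])
      show "has_pd (axis l 1) (\<lambda>x. \<psi> x * \<phi> x $ i) ?h' x" for x
        by (intro has_pd_mult smooth_on_has_pd s sm)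
      show "continuous_on UNIV (\<lambda>x. \<psi> x * \<phi> x $ i)" "continuous_on UNIV ?h'"
        by (intro continuous_on_mult continuous_on_add smooth_on_continuous smooth_on_ipd s sm)+
    qed (auto simp: K(3) has_pd_const)
    moreover have "(\<integral>x. ?F x \<partial>M) $ i = (\<integral>x. ?F x $ i \<partial>M)"
      by (rule integral_bounded_linear[OF bounded_linear_vec_nth, symmetric])
        (use i1 i2 in \<open>rule Bochner_Integration.integrable_add\<close>)
    ultimately show ?thesis by (simp add: qpd_nth del: ipd.simps)
  qed
  then have "(\<integral>x. ?F x \<partial>M) = 0" by (simp add: vec_eq_iff)
  then show "(\<integral>x. ipd [l] \<psi> x *\<^sub>R \<phi> x \<partial>M) = - (\<integral>x. \<psi> x *\<^sub>R qpd l \<phi> x \<partial>M)"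
    using i1 i2 by (simp add: eq_neg_iff_add_eq_0 del: ipd.simps)
qed

lemma weak_partial_unique:
  assumes "sqint M g" "sqint M g'" "weak_partial \<Omega> l u g" "weak_partial \<Omega> l u g'"
  shows "AE x in M. g x = g' x"
proof -
  have "AE x in M. g x - g' x = 0"
  proof (rule fundamental_lemma[OF \<Omega>_open])
    show "integrable M (\<lambda>x. g x - g' x)" by (intro sqint_integrable sqint_diff assms)
    fix \<psi> assume \<psi>: "test_fun \<Omega> \<psi>"
    have "(\<integral>x. \<psi> x *\<^sub>R (g x - g' x) \<partial>M) = (\<integral>x. \<psi> x *\<^sub>R g x \<partial>M) - (\<integral>x. \<psi> x *\<^sub>R g' x \<partial>M)"
      using scaleR_integrable[OF test_fun_sqint(1)[OF \<psi>] assms(1)]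
        scaleR_integrable[OF test_fun_sqint(1)[OF \<psi>] assms(2)] by (simp add: scaleR_diff_right)
    also have "\<dots> = 0"
      using assms(3)[unfolded weak_partial_M, rule_format, OF \<psi>]
        assms(4)[unfolded weak_partial_M, rule_format, OF \<psi>] by simp
    finally show "(\<integral>x. \<psi> x *\<^sub>R (g x - g' x) \<partial>M) = 0" .
  qed
  then show ?thesis by simp
qed

text \<open>\<open>wpd\<close> is a choice, fixed only up to null sets. The last conclusion makes it
  usable: it agrees a.e. with any square-integrable weak derivative.\<close>

lemma wpd_weak_partial:
  assumes "sqint M g" "weak_partial \<Omega> l u g"
  shows "sqint M (wpd \<Omega> l u)" "weak_partial \<Omega> l u (wpd \<Omega> l u)" "AE x in M. wpd \<Omega> l u x = g x"
proof -
  have "L2 \<Omega> (wpd \<Omega> l u) \<and> weak_partial \<Omega> l u (wpd \<Omega> l u)"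
    unfolding wpd_def by (rule someI[of _ g]) (use assms in \<open>simp add: L2_iff_sqint\<close>)
  then show 1: "sqint M (wpd \<Omega> l u)" and 2: "weak_partial \<Omega> l u (wpd \<Omega> l u)"
    by (auto simp: L2_iff_sqint)
  show "AE x in M. wpd \<Omega> l u x = g x"
    by (rule weak_partial_unique[OF 1 assms(1) 2 assms(2)])
qed

section \<open>Characterisation of H^1_0 by limits of jets\<close>

definition wjet :: "(real^3 \<Rightarrow> quat) \<Rightarrow> real^3 \<Rightarrow> quat \<times> (quat^3)" where
  "wjet u x = (u x, \<chi> l. wpd \<Omega> l u x)"

text \<open>The closure of the 1-jets of test functions in \<open>L\<^sup>2\<close>; it is the graph of the weak gradient
  on \<open>H\<^sup>1\<^sub>0\<close>.\<close>

definition jet_closure :: "(real^3 \<Rightarrow> quat \<times> (quat^3)) \<Rightarrow> bool" where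
  "jet_closure U \<longleftrightarrow> sqint M U \<and>
     (\<exists>\<phi>s. (\<forall>n. qtest \<Omega> (\<phi>s n)) \<and> (\<lambda>n. l2n M (\<lambda>x. jet (\<phi>s n) x - U x)) \<longlonglongrightarrow> 0)"

lemma H1_wjet_sqint:
  assumes "H1 \<Omega> u"
  shows "sqint M u" "\<And>l. sqint M (wpd \<Omega> l u)" "sqint M (wjet u)"
proof -
  show 1: "sqint M u" using assms by (simp add: H1_def L2_iff_sqint)
  show 2: "sqint M (wpd \<Omega> l u)" for l
    using assms wpd_weak_partial(1) unfolding H1_def L2_iff_sqint by blast
  show "sqint M (wjet u)" unfolding wjet_def[abs_def] by (rule sqint_Pair(1)[OF 1 2])
qed

lemma jet_diff_wjet_l2n:
  assumes "qtest \<Omega> \<phi>" "H1 \<Omega> u"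
  shows "(l2n M (\<lambda>x. jet \<phi> x - wjet u x))\<^sup>2 = (L2norm \<Omega> (\<lambda>x. \<phi> x - u x))\<^sup>2 +
    (\<Sum>l\<in>UNIV. (L2norm \<Omega> (\<lambda>x. qpd l \<phi> x - wpd \<Omega> l u x))\<^sup>2)"
proof -
  have "(\<lambda>x. jet \<phi> x - wjet u x) = (\<lambda>x. (\<phi> x - u x, \<chi> l. qpd l \<phi> x - wpd \<Omega> l u x))"
    by (auto simp: jet_def wjet_def vec_eq_iff)
  moreover have "sqint M (\<lambda>x. \<phi> x - u x)" "\<And>l. sqint M (\<lambda>x. qpd l \<phi> x - wpd \<Omega> l u x)"
    using assms jet_component_sqint H1_wjet_sqint by (auto intro!: sqint_diff)
  ultimately show ?thesis
    unfolding L2norm_eq_l2n using sqint_Pair(2) by simp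
qed

lemma H01_jet_closure:
  assumes "H01 \<Omega> u"
  shows "jet_closure (wjet u)"
proof -
  from assms obtain \<phi>s where h: "H1 \<Omega> u" and t: "\<And>n. qtest \<Omega> (\<phi>s n)" and
    l: "(\<lambda>n. (L2norm \<Omega> (\<lambda>x. \<phi>s n x - u x))\<^sup>2 +
          (\<Sum>l\<in>UNIV. (L2norm \<Omega> (\<lambda>x. qpd l (\<phi>s n) x - wpd \<Omega> l u x))\<^sup>2)) \<longlonglongrightarrow> 0"
    by (auto simp: H01_def)
  have "(\<lambda>n. sqrt ((l2n M (\<lambda>x. jet (\<phi>s n) x - wjet u x))\<^sup>2)) \<longlonglongrightarrow> sqrt 0"
    using l unfolding jet_diff_wjet_l2n[OF t h] by (rule tendsto_real_sqrt)
  then have "(\<lambda>n. l2n M (\<lambda>x. jet (\<phi>s n) x - wjet u x)) \<longlonglongrightarrow> 0"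
    by (simp add: l2n_nonneg)
  with t H1_wjet_sqint(3)[OF h] show ?thesis by (auto simp: jet_closure_def)
qed

text \<open>The weak gradient is a closed operator: integration by parts against a fixed test
  function survives L^2 limits of both sides. Thus the gradient part of a limit of jets is a weak
  gradient of its first part, and uniqueness identifies it with the chosen
  \<open>wpd\<close>.\<close>

lemma jet_closure_H01:
  assumes "jet_closure U"
  shows "H01 \<Omega> (\<lambda>x. fst (U x))" "AE x in M. wjet (\<lambda>x. fst (U x)) x = U x"
proof -
  from assms obtain \<phi>s where U: "sqint M U" and t: "\<And>n. qtest \<Omega> (\<phi>s n)" and
    l: "(\<lambda>n. l2n M (\<lambda>x. jet (\<phi>s n) x - U x)) \<longlonglongrightarrow> 0"
    by (auto simp: jet_closure_def)
  let ?u = "\<lambda>x. fst (U x)" and ?g = "\<lambda>l x. snd (U x) $ l"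
  note d = sqint_diff[OF jet_sqint[OF t] U]
  have l1: "(\<lambda>n. l2n M (\<lambda>x. \<phi>s n x - ?u x)) \<longlonglongrightarrow> 0"
    by (rule tendsto_sandwich[OF _ _ tendsto_const l])
      (use sqint_fst(2)[OF d] in \<open>auto simp: l2n_nonneg jet_def\<close>)
  have l2: "(\<lambda>n. l2n M (\<lambda>x. qpd l (\<phi>s n) x - ?g l x)) \<longlonglongrightarrow> 0" for l
    by (rule tendsto_sandwich[OF _ _ tendsto_const l])
      (use sqint_snd(4)[OF d, of _ l] in \<open>auto simp: l2n_nonneg jet_def\<close>)
  have w: "weak_partial \<Omega> l ?u (?g l)" for l
    unfolding weak_partial_M
  proof (intro allI impI)
    fix \<psi> assume \<psi>: "test_fun \<Omega> \<psi>"
    have "(\<lambda>n. \<integral>x. ipd [l] \<psi> x *\<^sub>R \<phi>s n x \<partial>M) \<longlonglongrightarrow> (\<integral>x. ipd [l] \<psi> x *\<^sub>R ?u x \<partial>M)"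
      by (rule scaleR_tendsto[OF test_fun_sqint(2)[OF \<psi>] jet_component_sqint(1)[OF t] sqint_fst(1)[OF U] l1])
    moreover have "(\<lambda>n. \<integral>x. \<psi> x *\<^sub>R qpd l (\<phi>s n) x \<partial>M) \<longlonglongrightarrow> (\<integral>x. \<psi> x *\<^sub>R ?g l x \<partial>M)"
      by (rule scaleR_tendsto[OF test_fun_sqint(1)[OF \<psi>] jet_component_sqint(2)[OF t] sqint_snd(2)[OF U] l2])
    moreover have "(\<integral>x. ipd [l] \<psi> x *\<^sub>R \<phi>s n x \<partial>M) = - (\<integral>x. \<psi> x *\<^sub>R qpd l (\<phi>s n) x \<partial>M)" for n
      using weak_partial_qpd[OF t] \<psi> unfolding weak_partial_M by blast
    ultimately show "(\<integral>x. ipd [l] \<psi> x *\<^sub>R ?u x \<partial>M) = - (\<integral>x. \<psi> x *\<^sub>R ?g l x \<partial>M)"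
      by (metis (no_types, lifting) LIMSEQ_unique tendsto_minus ext)
  qed
  have h: "H1 \<Omega> ?u"
    unfolding H1_def L2_iff_sqint using w sqint_fst(1)[OF U] sqint_snd(2)[OF U] by blast
  have ae: "AE x in M. wpd \<Omega> l ?u x = ?g l x" for l
    by (rule wpd_weak_partial(3)[OF sqint_snd(2)[OF U] w])
  have "AE x in M. \<forall>l\<in>UNIV. wpd \<Omega> l ?u x = ?g l x"
    using ae by (intro AE_finite_allI) auto
  then show eq: "AE x in M. wjet ?u x = U x"
    by eventually_elim (auto simp: wjet_def prod_eq_iff vec_eq_iff)
  have "l2n M (\<lambda>x. jet (\<phi>s n) x - wjet ?u x) = l2n M (\<lambda>x. jet (\<phi>s n) x - U x)" for n
  proof (rule l2n_cong_AE)
    show "AE x in M. jet (\<phi>s n) x - wjet ?u x = jet (\<phi>s n) x - U x"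
      using eq by eventually_elim simp
  qed (use sqint_diff[OF jet_sqint[OF t[of n]] H1_wjet_sqint(3)[OF h]] d in \<open>auto simp: sqint_def\<close>)
  then have "(\<lambda>n. (l2n M (\<lambda>x. jet (\<phi>s n) x - wjet ?u x))\<^sup>2) \<longlonglongrightarrow> 0\<^sup>2"
    by (simp only:) (intro tendsto_power l)
  then have "(\<lambda>n. (L2norm \<Omega> (\<lambda>x. \<phi>s n x - ?u x))\<^sup>2 +
          (\<Sum>l\<in>UNIV. (L2norm \<Omega> (\<lambda>x. qpd l (\<phi>s n) x - wpd \<Omega> l ?u x))\<^sup>2)) \<longlonglongrightarrow> 0"
    unfolding jet_diff_wjet_l2n[OF t h] by simp
  with h t show "H01 \<Omega> ?u" unfolding H01_def by blast
qed

lemma jet_in_closure: "qtest \<Omega> \<phi> \<Longrightarrow> jet_closure (jet \<phi>)"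
  unfolding jet_closure_def using jet_sqint
  by (intro conjI exI[of _ "\<lambda>_. \<phi>"]) (auto simp: l2n_def)

lemma jet_closure_diff:
  assumes "jet_closure U" "jet_closure V"
  shows "jet_closure (\<lambda>x. U x - V x)"
proof -
  from assms(1) obtain \<phi>s where U: "sqint M U" and t: "\<And>n. qtest \<Omega> (\<phi>s n)" and
    l: "(\<lambda>n. l2n M (\<lambda>x. jet (\<phi>s n) x - U x)) \<longlonglongrightarrow> 0"
    by (auto simp: jet_closure_def)
  from assms(2) obtain \<psi>s where V: "sqint M V" and t': "\<And>n. qtest \<Omega> (\<psi>s n)" and
    l': "(\<lambda>n. l2n M (\<lambda>x. jet (\<psi>s n) x - V x)) \<longlonglongrightarrow> 0"
    by (auto simp: jet_closure_def)
  let ?\<chi> = "\<lambda>n x. \<phi>s n x + (-1) *\<^sub>R \<psi>s n x"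
  note d = sqint_diff[OF jet_sqint[OF t] U] and d' = sqint_diff[OF jet_sqint[OF t'] V]
  have j: "jet (?\<chi> n) x - (U x - V x) = (jet (\<phi>s n) x - U x) - (jet (\<psi>s n) x - V x)" for n x
    unfolding qtest_comb(2)[OF t t'] by simp
  have "(\<lambda>n. l2n M (\<lambda>x. jet (?\<chi> n) x - (U x - V x))) \<longlonglongrightarrow> 0"
  proof (rule tendsto_sandwich[OF _ _ tendsto_const])
    show "(\<lambda>n. l2n M (\<lambda>x. jet (\<phi>s n) x - U x) + l2n M (\<lambda>x. jet (\<psi>s n) x - V x)) \<longlonglongrightarrow> 0"
      using tendsto_add[OF l l'] by simp
    show "\<forall>\<^sub>F n in sequentially. l2n M (\<lambda>x. jet (?\<chi> n) x - (U x - V x))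
        \<le> l2n M (\<lambda>x. jet (\<phi>s n) x - U x) + l2n M (\<lambda>x. jet (\<psi>s n) x - V x)"
      unfolding j by (intro always_eventually allI l2n_diff d d')
  qed (simp add: l2n_nonneg)
  moreover have "qtest \<Omega> (?\<chi> n)" for n by (rule qtest_comb(1)[OF t t'])
  ultimately show ?thesis
    unfolding jet_closure_def using sqint_diff[OF U V] by (intro conjI exI[of _ ?\<chi>] allI)
qed

end

section \<open>The weak form of the squared operator\<close>

lemma bilinear_component_expansion:
  fixes K :: "real^'n \<Rightarrow> real^'n \<Rightarrow> real"
  assumes "bilinear K"
  shows "K p q = (\<Sum>i\<in>UNIV. \<Sum>j\<in>UNIV. K (axis i 1) (axis j 1) * (p$i * q$j))"
proof -
  have e: "v = (\<Sum>i\<in>UNIV. v$i *\<^sub>R axis i 1)" for v :: "real^'n"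
    using basis_expansion[of v] by (simp add: scalar_mult_eq_scaleR)
  have "K p q = K (\<Sum>i\<in>UNIV. p$i *\<^sub>R axis i 1) (\<Sum>j\<in>UNIV. q$j *\<^sub>R axis j 1)"
    using e by metis
  also have "\<dots> = (\<Sum>(i, j)\<in>UNIV \<times> UNIV. K (p$i *\<^sub>R axis i 1) (q$j *\<^sub>R axis j 1))"
    by (rule bilinear_sum[OF assms])
  also have "\<dots> = (\<Sum>i\<in>UNIV. \<Sum>j\<in>UNIV. K (p$i *\<^sub>R axis i 1) (q$j *\<^sub>R axis j 1))"
    by (rule sum.cartesian_product[symmetric])
  also have "\<dots> = (\<Sum>i\<in>UNIV. \<Sum>j\<in>UNIV. K (axis i 1) (axis j 1) * (p$i * q$j))"
    by (intro sum.cong refl) (simp add: bilinear_lmul[OF assms] bilinear_rmul[OF assms])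
  finally show ?thesis .
qed

lemma has_pd_bilinear:
  fixes K :: "real^'n \<Rightarrow> real^'n \<Rightarrow> real"
  assumes K: "bilinear K"
    and f: "\<And>i. has_pd e (\<lambda>x. f x $ i) (\<lambda>x. f' x $ i) x" and g: "\<And>i. has_pd e (\<lambda>x. g x $ i) (\<lambda>x. g' x $ i) x"
  shows "has_pd e (\<lambda>x. K (f x) (g x)) (\<lambda>x. K (f' x) (g x) + K (f x) (g' x)) x"
proof -
  have eq: "K (f' x) (g x) + K (f x) (g' x) =
      (\<Sum>i\<in>UNIV. \<Sum>j\<in>UNIV. K (axis i 1) (axis j 1) * (f' x $ i * g x $ j + f x $ i * g' x $ j))" for x
    unfolding bilinear_component_expansion[OF K, of "f' x"] bilinear_component_expansion[OF K, of "f x"]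
    by (simp add: sum.distrib[symmetric] distrib_left)
  show ?thesis
    unfolding eq unfolding bilinear_component_expansion[OF K, of "f _"]
    by (intro has_pd_sum has_pd_cmult has_pd_mult f g)
qed

lemma measurable_linear_image:
  fixes L :: "'b::euclidean_space \<Rightarrow> 'c::euclidean_space"
  assumes "linear L" "u \<in> borel_measurable N"
  shows "(\<lambda>x. L (u x)) \<in> borel_measurable N"
  using assms by (intro measurable_compose[OF assms(2)] borel_measurable_continuous_onI linear_continuous_on)
    (simp add: linear_conv_bounded_linear)

text \<open>The constants behind all estimates: \<open>m\<close>, \<open>P\<close> and
  \<open>C\<close> enter the coercivity, \<open>A\<close> the continuity of the form and the size of
  T. The assumption \<open>small\<close> is the second inequality of the theorem multiplied by 2
  m^2, with \<open>m\<close> the reciprocal of \<open>Ca\<close>.\<close>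

locale dirichlet = bounded_open +
  fixes a :: "3 \<Rightarrow> real \<Rightarrow> real" and m A P C :: real
  assumes m_pos: "0 < m" and m_le: "x \<in> \<Omega> \<Longrightarrow> m \<le> \<bar>a l (x$l)\<bar>"
    and A_nonneg: "0 \<le> A" and a_le: "x \<in> \<Omega> \<Longrightarrow> \<bar>a l (x$l)\<bar> \<le> A"
    and a'_le: "x \<in> \<Omega> \<Longrightarrow> \<bar>deriv (a l) (x$l)\<bar> \<le> A"
    and a_deriv: "x \<in> \<Omega> \<Longrightarrow> (a l has_real_derivative deriv (a l) (x$l)) (at (x$l))"
    and a'_cont: "continuous_on \<Omega> (\<lambda>x. deriv (a l) (x$l))"
    and P_ge: "x \<in> \<Omega> \<Longrightarrow> norm (Phi a x) \<le> P"
    and poincare: "poincare_const \<Omega> C"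
    and small: "P\<^sup>2 * C\<^sup>2 < m\<^sup>2"
begin

definition Tx :: "real^3 \<Rightarrow> quat \<times> (quat^3) \<Rightarrow> quat" where
  "Tx x U = (\<Sum>l\<in>UNIV. qmul (qe l) (a l (x$l) *\<^sub>R snd U $ l))"

definition Tadjx :: "real^3 \<Rightarrow> quat \<times> (quat^3) \<Rightarrow> quat" where
  "Tadjx x V = (\<Sum>l\<in>UNIV. qmul (qe l) (deriv (a l) (x$l) *\<^sub>R fst V + a l (x$l) *\<^sub>R snd V $ l))"

text \<open>The real part of the integrand of the form for Re s = 0, as a function of two jets and
  with \<sigma> = |s|; the first-order term 2 Re(s) T vanishes in this case.\<close>

definition b :: "real \<Rightarrow> real^3 \<Rightarrow> quat \<times> (quat^3) \<Rightarrow> quat \<times> (quat^3) \<Rightarrow> real" where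
  "b \<sigma> x U V = Tx x U \<bullet> Tadjx x V + \<sigma>\<^sup>2 * (fst U \<bullet> fst V)"

definition B :: "real \<Rightarrow> (real^3 \<Rightarrow> quat \<times> (quat^3)) \<Rightarrow> (real^3 \<Rightarrow> quat \<times> (quat^3)) \<Rightarrow> real" where
  "B \<sigma> U V = (\<integral>x. b \<sigma> x (U x) (V x) \<partial>M)"

lemma Top_eq: "Top \<Omega> a u x = Tx x (wjet u x)"
  by (simp add: Top_def Tx_def wjet_def)

lemma Tadj_eq: "Tadj a \<phi> x = Tadjx x (jet \<phi> x)"
  by (simp add: Tadj_def Tadjx_def jet_def)

lemma linear_Tx: "linear (Tx x)"
  unfolding Tx_def
  by (intro linearI) (simp_all add: qmul_add_right qmul_scaleR_right scaleR_add_right sum.distrib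
      scaleR_sum_right mult.commute)

lemma linear_Tadjx: "linear (Tadjx x)"
  unfolding Tadjx_def
  by (intro linearI) (simp_all add: qmul_add_right qmul_scaleR_right scaleR_add_right sum.distrib
      scaleR_sum_right scaleR_left_commute algebra_simps)

lemma norm_snd_nth_le: "norm (snd U $ l) \<le> norm (snd U)" for U :: "quat \<times> (quat^3)"
  by (rule Finite_Cartesian_Product.norm_nth_le)

lemma norm_Tx:
  assumes "x \<in> \<Omega>"
  shows "norm (Tx x U) \<le> 3 * A * norm (snd U)"
proof -
  have "norm (Tx x U) \<le> (\<Sum>l\<in>(UNIV::3 set). A * norm (snd U))"
    unfolding Tx_def
    by (rule sum_norm_le)
      (use assms a_le A_nonneg norm_snd_nth_le in \<open>auto simp: norm_qmul norm_qe intro!: mult_mono\<close>)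
  then show ?thesis by simp
qed

lemma norm_Tadjx:
  assumes "x \<in> \<Omega>"
  shows "norm (Tadjx x V) \<le> 6 * A * norm V"
proof -
  have "norm (Tadjx x V) \<le> (\<Sum>l\<in>(UNIV::3 set). 2 * A * norm V)"
    unfolding Tadjx_def
  proof (rule sum_norm_le)
    fix l :: 3
    have 1: "norm (fst V) \<le> norm V" "norm (snd V) \<le> norm V"
      by (metis norm_fst_le prod.collapse) (metis norm_snd_le prod.collapse)
    have "norm (qmul (qe l) (deriv (a l) (x$l) *\<^sub>R fst V + a l (x$l) *\<^sub>R snd V $ l))
        \<le> \<bar>deriv (a l) (x$l)\<bar> * norm (fst V) + \<bar>a l (x$l)\<bar> * norm (snd V $ l)"
      unfolding norm_qmul norm_qe using norm_triangle_ineq[of "deriv (a l) (x$l) *\<^sub>R fst V" "a l (x$l) *\<^sub>R snd V $ l"]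
      by simp
    also have "\<dots> \<le> A * norm V + A * norm V"
      using a_le[OF assms, of l] a'_le[OF assms, of l] A_nonneg 1 norm_snd_nth_le[of V l]
      by (intro add_mono mult_mono) auto
    finally show "norm (qmul (qe l) (deriv (a l) (x$l) *\<^sub>R fst V + a l (x$l) *\<^sub>R snd V $ l)) \<le> 2 * A * norm V"
      by simp
  qed
  then show ?thesis by simp
qed

lemma a_cont: "continuous_on \<Omega> (\<lambda>x. a l (x$l))"
proof (rule continuous_at_imp_continuous_on, rule ballI)
  fix x assume "x \<in> \<Omega>"
  have "isCont (\<lambda>x. x$l) x" by (intro continuous_intros)
  moreover have "isCont (a l) (x$l)" using a_deriv[OF \<open>x \<in> \<Omega>\<close>] by (rule DERIV_isCont)
  ultimately show "isCont (\<lambda>x. a l (x$l)) x" by (rule isCont_o2)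
qed

lemma measurable_a: "(\<lambda>x. a l (x$l)) \<in> borel_measurable M" "(\<lambda>x. deriv (a l) (x$l)) \<in> borel_measurable M"
  by (rule continuous_measurable_M[OF a_cont], rule continuous_measurable_M[OF a'_cont])

lemma measurable_fst:
  fixes U :: "real^3 \<Rightarrow> quat \<times> (quat^3)"
  assumes "U \<in> borel_measurable M"
  shows "(\<lambda>x. fst (U x)) \<in> borel_measurable M"
  by (rule measurable_compose[OF assms], intro borel_measurable_continuous_onI continuous_intros)

lemma measurable_Tx: "U \<in> borel_measurable M \<Longrightarrow> (\<lambda>x. Tx x (U x)) \<in> borel_measurable M"
  unfolding Tx_def
  by (intro borel_measurable_sum measurable_linear_image[OF linear_qmul_right] borel_measurable_scaleR
      measurable_a measurable_snd_nth)

lemma measurable_Tadjx: "V \<in> borel_measurable M \<Longrightarrow> (\<lambda>x. Tadjx x (V x)) \<in> borel_measurable M"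
  unfolding Tadjx_def
  by (intro borel_measurable_sum measurable_linear_image[OF linear_qmul_right] borel_measurable_scaleR
      borel_measurable_add measurable_a measurable_snd_nth measurable_fst)

lemma sqint_Tx:
  assumes "sqint M U"
  shows "sqint M (\<lambda>x. Tx x (U x))" "l2n M (\<lambda>x. Tx x (U x)) \<le> 3 * A * l2n M (\<lambda>x. snd (U x))"
proof -
  note m = measurable_Tx[OF sqint_measurable[OF assms]]
  have n: "norm (Tx x (U x)) \<le> 3 * A * norm (snd (U x))" if "x \<in> space M" for x
    using that norm_Tx by (simp add: space_M)
  show "sqint M (\<lambda>x. Tx x (U x))" by (rule sqint_bound[OF sqint_snd(1)[OF assms] m n])
  show "l2n M (\<lambda>x. Tx x (U x)) \<le> 3 * A * l2n M (\<lambda>x. snd (U x))"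
    by (rule l2n_bound[OF sqint_snd(1)[OF assms] m n]) (use A_nonneg in auto)
qed

lemma sqint_Tadjx:
  assumes "sqint M V"
  shows "sqint M (\<lambda>x. Tadjx x (V x))"
  by (rule sqint_bound[OF assms measurable_Tadjx[OF sqint_measurable[OF assms]], where C = "6 * A"])
    (simp add: space_M norm_Tadjx)

text \<open>The constant 18 A^2 is the product of 3 A from \<open>norm_Tx\<close> and 6 A from
  \<open>norm_Tadjx\<close>.\<close>

lemma l2form_b: "l2form M (18 * A\<^sup>2 + \<sigma>\<^sup>2) (b \<sigma>)"
proof
  fix x :: "real^3" and p q :: "quat \<times> (quat^3)" assume "x \<in> space M"
  then have x: "x \<in> \<Omega>" by (simp add: space_M)
  show "bilinear (b \<sigma> x)"
    unfolding bilinear_def b_def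
    by (intro conjI allI linearI)
      (simp_all add: linear_add[OF linear_Tx] linear_add[OF linear_Tadjx] linear_cmul[OF linear_Tx]
        linear_cmul[OF linear_Tadjx] inner_add_left inner_add_right algebra_simps)
  have n: "norm (fst p) \<le> norm p" "norm (snd p) \<le> norm p" "norm (fst q) \<le> norm q"
    by (metis norm_fst_le prod.collapse) (metis norm_snd_le prod.collapse, metis norm_fst_le prod.collapse)
  have "\<bar>b \<sigma> x p q\<bar> \<le> \<bar>Tx x p \<bullet> Tadjx x q\<bar> + \<sigma>\<^sup>2 * \<bar>fst p \<bullet> fst q\<bar>"
    unfolding b_def using abs_triangle_ineq[of "Tx x p \<bullet> Tadjx x q" "\<sigma>\<^sup>2 * (fst p \<bullet> fst q)"]
    by (simp add: abs_mult)
  also have "\<dots> \<le> (3 * A * norm p) * (6 * A * norm q) + \<sigma>\<^sup>2 * (norm p * norm q)"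
  proof (intro add_mono mult_left_mono)
    have "norm (Tx x p) \<le> 3 * A * norm p"
      using norm_Tx[OF x, of p] mult_left_mono[OF n(2), of "3 * A"] A_nonneg by linarith
    then have "norm (Tx x p) * norm (Tadjx x q) \<le> (3 * A * norm p) * (6 * A * norm q)"
      using norm_Tadjx[OF x, of q] A_nonneg by (intro mult_mono) auto
    then show "\<bar>Tx x p \<bullet> Tadjx x q\<bar> \<le> (3 * A * norm p) * (6 * A * norm q)"
      using Cauchy_Schwarz_ineq2[of "Tx x p" "Tadjx x q"] by linarith
    have "norm (fst p) * norm (fst q) \<le> norm p * norm q" using n by (intro mult_mono) auto
    then show "\<bar>fst p \<bullet> fst q\<bar> \<le> norm p * norm q"
      using Cauchy_Schwarz_ineq2[of "fst p" "fst q"] by linarith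
  qed simp
  also have "\<dots> = (18 * A\<^sup>2 + \<sigma>\<^sup>2) * (norm p * norm q)"
    by (simp add: algebra_simps power2_eq_square)
  finally show "\<bar>b \<sigma> x p q\<bar> \<le> (18 * A\<^sup>2 + \<sigma>\<^sup>2) * (norm p * norm q)" .
next
  fix U V :: "real^3 \<Rightarrow> quat \<times> (quat^3)"
  assume "U \<in> borel_measurable M" "V \<in> borel_measurable M"
  then show "(\<lambda>x. b \<sigma> x (U x) (V x)) \<in> borel_measurable M"
    unfolding b_def
    by (intro borel_measurable_add borel_measurable_times borel_measurable_inner borel_measurable_const
        measurable_Tx measurable_Tadjx measurable_fst)
qed

lemma B_eq_form: "l2form.form M (b \<sigma>) = B \<sigma>"
  by (intro ext) (simp add: l2form.form_def[OF l2form_b] B_def)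

lemmas b_integrable = l2form.form_integrable[OF l2form_b]
  and B_bound = l2form.form_bound[OF l2form_b, unfolded B_eq_form]
  and B_comb_left = l2form.form_add_left[OF l2form_b, unfolded B_eq_form]
  and B_comb_right = l2form.form_add_right[OF l2form_b, unfolded B_eq_form]
  and B_diff_left = l2form.form_diff_left[OF l2form_b, unfolded B_eq_form]
  and B_tendsto = l2form.form_tendsto[OF l2form_b, unfolded B_eq_form]

lemma B_split:
  assumes "sqint M U"
  shows "B \<sigma> U U = B 0 U U + \<sigma>\<^sup>2 * (l2n M (\<lambda>x. fst (U x)))\<^sup>2"
proof -
  have "B \<sigma> U U = (\<integral>x. b 0 x (U x) (U x) + \<sigma>\<^sup>2 * (norm (fst (U x)))\<^sup>2 \<partial>M)"
    unfolding B_def by (simp add: b_def dot_square_norm)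
  also have "\<dots> = B 0 U U + \<sigma>\<^sup>2 * (l2n M (\<lambda>x. fst (U x)))\<^sup>2"
    using b_integrable[OF assms assms, of 0] sqint_fst(1)[OF assms]
    by (simp add: B_def l2n_sq sqint_def)
  finally show ?thesis .
qed

lemma has_pd_a:
  assumes "x \<in> \<Omega>"
  shows "has_pd (axis l 1) (\<lambda>x. a l (x$l)) (\<lambda>x. deriv (a l) (x$l)) x"
proof -
  have "((\<lambda>t. a l (x$l + t)) has_real_derivative deriv (a l) (x$l)) (at 0)"
    using a_deriv[OF assms, of l] DERIV_shift[of "a l" _ 0 "x$l"] by (simp add: add.commute)
  then show ?thesis by (simp add: has_pd_def axis_def)
qed

lemma has_pd_a_other:
  assumes "k \<noteq> l"
  shows "has_pd (axis k 1) (\<lambda>x. a l (x$l)) (\<lambda>x. 0) x"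
  using assms by (simp add: has_pd_def axis_def)

text \<open>The sum of the two mixed terms is a divergence, because the imaginary units anticommute while
  \<open>a\<^sub>l \<partial>\<^sub>l\<close> and \<open>a\<^sub>k \<partial>\<^sub>k\<close> commute.\<close>

lemma cross_terms_integral_zero:
  fixes l k :: 3
  assumes \<phi>: "qtest \<Omega> \<phi>" and lk: "l \<noteq> k"
  defines "D \<equiv> \<lambda>x. qmul (qe l) (a l (x$l) *\<^sub>R qpd l \<phi> x) \<bullet>
        qmul (qe k) (deriv (a k) (x$k) *\<^sub>R \<phi> x + a k (x$k) *\<^sub>R qpd k \<phi> x)
      + qmul (qe k) (a k (x$k) *\<^sub>R qpd k \<phi> x) \<bullet>
        qmul (qe l) (deriv (a l) (x$l) *\<^sub>R \<phi> x + a l (x$l) *\<^sub>R qpd l \<phi> x)"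
  shows "integrable M D" "(\<integral>x. D x \<partial>M) = 0"
proof -
  define K where "K p q = qmul (qe l) p \<bullet> qmul (qe k) q" for p q
  have bil: "bilinear K"
    unfolding bilinear_def K_def
    by (intro conjI allI linearI)
      (simp_all add: qmul_add_right qmul_scaleR_right inner_add_left inner_add_right)
  have cK: "continuous_on UNIV (\<lambda>x. K (f x) (g x))" if "continuous_on UNIV f" "continuous_on UNIV g"
    for f g :: "real^3 \<Rightarrow> quat"
    using bilinear_continuous_on_compose[OF that bil] .
  obtain S where S: "compact S" "S \<subseteq> \<Omega>" "\<And>x. x \<notin> S \<Longrightarrow> \<phi> x = 0"
    using qtest_support[OF \<phi>] by metis
  have K0: "K p 0 = 0" "K 0 p = 0" for p using bilinear_lzero[OF bil] bilinear_rzero[OF bil] by auto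
  note sm = qtest_smooth[OF \<phi>]
  have pd: "has_pd (axis j 1) (\<lambda>x. \<phi> x $ i) (\<lambda>x. qpd j \<phi> x $ i) x" for i j x
    unfolding qpd_nth by (rule smooth_on_has_pd[OF sm])
  have pd2: "has_pd (axis j 1) (\<lambda>x. qpd h \<phi> x $ i) (\<lambda>x. qpd j (qpd h \<phi>) x $ i) x" for i j h x
    unfolding qpd_nth by (rule smooth_on_has_pd[OF smooth_on_ipd[OF sm]])
  have c2: "continuous_on UNIV (qpd j (qpd h \<phi>))" for j h
    by (rule continuous_on_vec_nth, unfold qpd_nth)
      (rule smooth_on_continuous[OF smooth_on_ipd[OF smooth_on_ipd[OF sm]]])
  have comm: "qpd k (qpd l \<phi>) x = qpd l (qpd k \<phi>) x" for x
    unfolding vec_eq_iff qpd_nth by (intro allI ipd_commute sm)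
  note c = qtest_continuous[OF \<phi>] qpd_continuous[OF \<phi>] c2
  \<comment> \<open>\<open>?F1\<close> is the k-derivative of
    \<open>?c x * K (qpd l \<phi> x) (\<phi> x)\<close>, and \<open>?F2\<close> the l-derivative of
    \<open>?c x * K (\<phi> x) (qpd k \<phi> x)\<close>; the zeros are the derivatives of
    \<open>a l\<close> in direction \<open>k\<close> and of \<open>a k\<close> in direction
    \<open>l\<close>. In the sum the second-order terms cancel by \<open>comm\<close> and
    \<open>skew\<close>, and what remains is \<open>D\<close>.\<close>
  let ?c = "\<lambda>x. a l (x$l) * a k (x$k)"
  let ?F1 = "\<lambda>x. (0 * a k (x$k) + a l (x$l) * deriv (a k) (x$k)) * K (qpd l \<phi> x) (\<phi> x)
      + ?c x * (K (qpd k (qpd l \<phi>) x) (\<phi> x) + K (qpd l \<phi> x) (qpd k \<phi> x))"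
  let ?F2 = "\<lambda>x. (deriv (a l) (x$l) * a k (x$k) + a l (x$l) * 0) * K (\<phi> x) (qpd k \<phi> x)
      + ?c x * (K (qpd l \<phi> x) (qpd k \<phi> x) + K (\<phi> x) (qpd l (qpd k \<phi>) x))"
  have F1: "(\<integral>x. ?F1 x \<partial>M) = 0" "integrable M ?F1"
  proof -
    have z: "K (qpd l \<phi> x) (\<phi> x) = 0" if "x \<notin> S" for x using S(3)[OF that] K0 by simp
    have h: "has_pd (axis k 1) (\<lambda>x. K (qpd l \<phi> x) (\<phi> x))
        (\<lambda>x. K (qpd k (qpd l \<phi>) x) (\<phi> x) + K (qpd l \<phi> x) (qpd k \<phi> x)) x" for x
      by (intro has_pd_bilinear[OF bil] pd pd2)
    have q: "has_pd (axis k 1) ?c (\<lambda>x. 0 * a k (x$k) + a l (x$l) * deriv (a k) (x$k)) x" if "x \<in> \<Omega>" for x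
      by (intro has_pd_mult has_pd_a has_pd_a_other that lk[symmetric])
    show "(\<integral>x. ?F1 x \<partial>M) = 0" "integrable M ?F1"
      by (rule integral_pd_product[OF \<Omega>_open S(1,2) z h q],
          (assumption | intro cK continuous_intros a_cont a'_cont c)+)+
  qed
  have F2: "(\<integral>x. ?F2 x \<partial>M) = 0" "integrable M ?F2"
  proof -
    have z: "K (\<phi> x) (qpd k \<phi> x) = 0" if "x \<notin> S" for x using S(3)[OF that] K0 by simp
    have h: "has_pd (axis l 1) (\<lambda>x. K (\<phi> x) (qpd k \<phi> x))
        (\<lambda>x. K (qpd l \<phi> x) (qpd k \<phi> x) + K (\<phi> x) (qpd l (qpd k \<phi>) x)) x" for x
      by (intro has_pd_bilinear[OF bil] pd pd2)
    have q: "has_pd (axis l 1) ?c (\<lambda>x. deriv (a l) (x$l) * a k (x$k) + a l (x$l) * 0) x" if "x \<in> \<Omega>" for x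
      by (intro has_pd_mult has_pd_a has_pd_a_other that lk)
    show "(\<integral>x. ?F2 x \<partial>M) = 0" "integrable M ?F2"
      by (rule integral_pd_product[OF \<Omega>_open S(1,2) z h q],
          (assumption | intro cK continuous_intros a_cont a'_cont c)+)+
  qed
  have D: "D = (\<lambda>x. ?F1 x + ?F2 x)"
  proof
    fix x
    have skew: "K (qpd l (qpd k \<phi>) x) (\<phi> x) = - K (\<phi> x) (qpd l (qpd k \<phi>) x)"
      unfolding K_def by (rule qmul_qe_inner_skew[OF lk])
    have sym: "qmul (qe k) p \<bullet> qmul (qe l) q = K q p" for p q
      by (simp add: K_def inner_commute)
    show "D x = ?F1 x + ?F2 x"
      unfolding D_def sym comm skew unfolding K_def[symmetric]
      by (simp add: bilinear_ladd[OF bil] bilinear_radd[OF bil] bilinear_lmul[OF bil] bilinear_rmul[OF bil]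
          algebra_simps)
  qed
  show "integrable M D" unfolding D using F1(2) F2(2) by (rule Bochner_Integration.integrable_add)
  show "(\<integral>x. D x \<partial>M) = 0" unfolding D using F1 F2 by (simp only: Bochner_Integration.integral_add add_0)
qed

section \<open>Coercivity on test functions and on the closure of their jets\<close>

lemma norm_Phi_sq: "(norm (Phi a x))\<^sup>2 = (\<Sum>l\<in>UNIV. (deriv (a l) (x$l))\<^sup>2)"
  unfolding Phi_def sum_UNIV_3 power2_norm_eq_inner quat_inner
  by (simp add: qe_nth power2_eq_square)

text \<open>The square of \<alpha> g + \<alpha>' p is nonnegative. The weights 1/2 here are those of
  the second smallness assumption.\<close>

lemma young_pointwise:
  fixes g p :: quat
  shows "(\<alpha> *\<^sub>R g) \<bullet> (\<alpha>' *\<^sub>R p + \<alpha> *\<^sub>R g) \<ge> \<alpha>\<^sup>2 * (norm g)\<^sup>2 / 2 - \<alpha>'\<^sup>2 * (norm p)\<^sup>2 / 2"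
proof -
  have "0 \<le> (\<alpha> *\<^sub>R g + \<alpha>' *\<^sub>R p) \<bullet> (\<alpha> *\<^sub>R g + \<alpha>' *\<^sub>R p)" by simp
  then show ?thesis
    unfolding power2_norm_eq_inner
    by (simp add: inner_add_left inner_add_right inner_commute[of p g] power2_eq_square algebra_simps)
qed

lemma jet_gradient_bound:
  assumes \<phi>: "qtest \<Omega> \<phi>"
  shows "m\<^sup>2 / 2 * (l2n M (\<lambda>x. snd (jet \<phi> x)))\<^sup>2 - P\<^sup>2 / 2 * (l2n M \<phi>)\<^sup>2 \<le> B 0 (jet \<phi>) (jet \<phi>)"
proof -
  define D where "D l k x = qmul (qe l) (a l (x$l) *\<^sub>R qpd l \<phi> x) \<bullet>
        qmul (qe k) (deriv (a k) (x$k) *\<^sub>R \<phi> x + a k (x$k) *\<^sub>R qpd k \<phi> x)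
      + qmul (qe k) (a k (x$k) *\<^sub>R qpd k \<phi> x) \<bullet>
        qmul (qe l) (deriv (a l) (x$l) *\<^sub>R \<phi> x + a l (x$l) *\<^sub>R qpd l \<phi> x)" for l k x
  have D: "integrable M (D l k)" "(\<integral>x. D l k x \<partial>M) = 0" if "l \<noteq> k" for l k
    unfolding D_def using cross_terms_integral_zero[OF \<phi> that] .
  note J = jet_sqint[OF \<phi>]
  note iD = D(1)[of 0 1] D(1)[of 0 2] D(1)[of 1 2]
  note b0 = b_integrable[OF J J, of 0]
  \<comment> \<open>The mixed terms vanish only after integration. Subtracting them under the
    integral leaves the three diagonal terms, for which the estimate is pointwise.\<close>
  have R: "B 0 (jet \<phi>) (jet \<phi>) =
      (\<integral>x. b 0 x (jet \<phi> x) (jet \<phi> x) - D 0 1 x - D 0 2 x - D 1 2 x \<partial>M)"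
    using b0 iD D(2) by (simp add: B_def)
  have i: "integrable M (\<lambda>x. (norm (snd (jet \<phi> x)))\<^sup>2)" "integrable M (\<lambda>x. (norm (\<phi> x))\<^sup>2)"
    using sqint_snd(1)[OF J] jet_component_sqint(1)[OF \<phi>] by (auto simp: sqint_def)
  have "m\<^sup>2 / 2 * (l2n M (\<lambda>x. snd (jet \<phi> x)))\<^sup>2 - P\<^sup>2 / 2 * (l2n M \<phi>)\<^sup>2
      = (\<integral>x. m\<^sup>2 / 2 * (norm (snd (jet \<phi> x)))\<^sup>2 - P\<^sup>2 / 2 * (norm (\<phi> x))\<^sup>2 \<partial>M)"
    unfolding l2n_sq using i by simp
  also have "\<dots> \<le> (\<integral>x. b 0 x (jet \<phi> x) (jet \<phi> x) - D 0 1 x - D 0 2 x - D 1 2 x \<partial>M)"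
  proof (rule integral_mono)
    fix x assume "x \<in> space M"
    then have x: "x \<in> \<Omega>" by (simp add: space_M)
    let ?g = "\<lambda>l. qpd l \<phi> x" and ?a = "\<lambda>l. a l (x$l)" and ?a' = "\<lambda>l. deriv (a l) (x$l)"
    have "b 0 x (jet \<phi> x) (jet \<phi> x) - D 0 1 x - D 0 2 x - D 1 2 x =
        (\<Sum>l\<in>UNIV. (?a l *\<^sub>R ?g l) \<bullet> (?a' l *\<^sub>R \<phi> x + ?a l *\<^sub>R ?g l))"
      unfolding b_def Tx_def Tadjx_def D_def sum_UNIV_3
      by (simp add: jet_def inner_add_left inner_add_right qmul_qe_inner del: inner_scaleR_left inner_scaleR_right
          add: qmul_add_right)
    moreover have "(\<Sum>l\<in>UNIV. (?a l *\<^sub>R ?g l) \<bullet> (?a' l *\<^sub>R \<phi> x + ?a l *\<^sub>R ?g l))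
        \<ge> (\<Sum>l\<in>UNIV. (?a l)\<^sup>2 * (norm (?g l))\<^sup>2 / 2 - (?a' l)\<^sup>2 * (norm (\<phi> x))\<^sup>2 / 2)"
      by (intro sum_mono young_pointwise)
    moreover have "(\<Sum>l\<in>UNIV. (?a l)\<^sup>2 * (norm (?g l))\<^sup>2 / 2 - (?a' l)\<^sup>2 * (norm (\<phi> x))\<^sup>2 / 2)
        = (\<Sum>l\<in>UNIV. (?a l)\<^sup>2 * (norm (?g l))\<^sup>2) / 2 - (norm (Phi a x))\<^sup>2 * (norm (\<phi> x))\<^sup>2 / 2"
      unfolding norm_Phi_sq by (simp add: sum_subtractf sum_divide_distrib sum_distrib_right)
    moreover have "(\<Sum>l\<in>UNIV. (?a l)\<^sup>2 * (norm (?g l))\<^sup>2) \<ge> (\<Sum>l\<in>UNIV. m\<^sup>2 * (norm (?g l))\<^sup>2)"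
    proof (intro sum_mono mult_right_mono)
      show "m\<^sup>2 \<le> (?a l)\<^sup>2" for l
        using power_mono[OF m_le[OF x, of l], of 2] m_pos by simp
    qed simp
    moreover have "(\<Sum>l\<in>UNIV. m\<^sup>2 * (norm (?g l))\<^sup>2) = m\<^sup>2 * (norm (snd (jet \<phi> x)))\<^sup>2"
      by (simp add: jet_def norm_vec_def L2_set_def sum_nonneg sum_distrib_left)
    moreover have "(norm (Phi a x))\<^sup>2 * (norm (\<phi> x))\<^sup>2 \<le> P\<^sup>2 * (norm (\<phi> x))\<^sup>2"
      using P_ge[OF x] by (intro mult_right_mono power_mono) auto
    ultimately show "m\<^sup>2 / 2 * (norm (snd (jet \<phi> x)))\<^sup>2 - P\<^sup>2 / 2 * (norm (\<phi> x))\<^sup>2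
        \<le> b 0 x (jet \<phi> x) (jet \<phi> x) - D 0 1 x - D 0 2 x - D 1 2 x"
      by linarith
  qed (use i b0 iD in auto)
  finally show ?thesis unfolding R .
qed

definition c1 :: real where "c1 = (m\<^sup>2 - P\<^sup>2 * C\<^sup>2) / 2"

lemma c1_pos: "0 < c1"
  using small by (simp add: c1_def)

text \<open>The Poincare hypothesis speaks of \<open>wpd\<close>; on a test function this agrees
  a.e. with the classical derivatives, so the summed inequality applies to the jet.\<close>

lemma jet_poincare:
  assumes \<phi>: "qtest \<Omega> \<phi>"
  shows "(l2n M \<phi>)\<^sup>2 \<le> C\<^sup>2 * (l2n M (\<lambda>x. snd (jet \<phi> x)))\<^sup>2"
proof -
  note cl = jet_closure_H01[OF jet_in_closure[OF \<phi>]]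
  have fst: "(\<lambda>x. fst (jet \<phi> x)) = \<phi>" by (simp add: jet_def)
  have h: "H01 \<Omega> \<phi>" and ae: "AE x in M. wjet \<phi> x = jet \<phi> x" using cl unfolding fst by auto
  have h1: "H1 \<Omega> \<phi>" using h by (simp add: H01_def)
  have "l2n M (wpd \<Omega> l \<phi>) = l2n M (qpd l \<phi>)" for l
  proof (rule l2n_cong_AE)
    show "AE x in M. wpd \<Omega> l \<phi> x = qpd l \<phi> x"
      using ae by eventually_elim (auto simp: wjet_def jet_def vec_eq_iff[where 'a="real^4"])
  qed (use H1_wjet_sqint(2)[OF h1] jet_component_sqint(2)[OF \<phi>] in \<open>auto simp: sqint_def\<close>)
  moreover have "(l2n M (\<lambda>x. snd (jet \<phi> x)))\<^sup>2 = (\<Sum>l\<in>UNIV. (l2n M (qpd l \<phi>))\<^sup>2)"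
  proof -
    have "(norm (snd (jet \<phi> x)))\<^sup>2 = (\<Sum>l\<in>UNIV. (norm (qpd l \<phi> x))\<^sup>2)" for x
      by (simp add: jet_def norm_vec_def L2_set_def sum_nonneg)
    then show ?thesis
      unfolding l2n_sq using jet_component_sqint(2)[OF \<phi>] by (simp add: sqint_def)
  qed
  ultimately show ?thesis
    using poincare h unfolding poincare_const_def L2norm_eq_l2n by auto
qed

lemma jet_coercive:
  assumes \<phi>: "qtest \<Omega> \<phi>"
  shows "c1 * (l2n M (\<lambda>x. snd (jet \<phi> x)))\<^sup>2 + \<sigma>\<^sup>2 * (l2n M (\<lambda>x. fst (jet \<phi> x)))\<^sup>2 \<le> B \<sigma> (jet \<phi>) (jet \<phi>)"
proof -
  have "P\<^sup>2 * (l2n M \<phi>)\<^sup>2 \<le> P\<^sup>2 * (C\<^sup>2 * (l2n M (\<lambda>x. snd (jet \<phi> x)))\<^sup>2)"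
    by (intro mult_left_mono jet_poincare \<phi>) simp
  then have "c1 * (l2n M (\<lambda>x. snd (jet \<phi> x)))\<^sup>2 \<le> B 0 (jet \<phi>) (jet \<phi>)"
    using jet_gradient_bound[OF \<phi>] by (simp add: c1_def field_simps)
  then show ?thesis using B_split[OF jet_sqint[OF \<phi>], of \<sigma>] by simp
qed

text \<open>\<open>jet_coercive\<close> rests on second derivatives, but both of its sides are
  continuous under L^2 convergence of jets.\<close>

lemma closure_coercive:
  assumes "jet_closure U"
  shows "c1 * (l2n M (\<lambda>x. snd (U x)))\<^sup>2 + \<sigma>\<^sup>2 * (l2n M (\<lambda>x. fst (U x)))\<^sup>2 \<le> B \<sigma> U U"
proof -
  from assms obtain \<phi>s where U: "sqint M U" and t: "\<And>n. qtest \<Omega> (\<phi>s n)" and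
    l: "(\<lambda>n. l2n M (\<lambda>x. jet (\<phi>s n) x - U x)) \<longlonglongrightarrow> 0"
    by (auto simp: jet_closure_def)
  note J = jet_sqint[OF t] and d = sqint_diff[OF jet_sqint[OF t] U]
  have "(\<lambda>n. l2n M (\<lambda>x. fst (jet (\<phi>s n) x) - fst (U x))) \<longlonglongrightarrow> 0"
    by (rule tendsto_sandwich[OF _ _ tendsto_const l])
      (use sqint_fst(2)[OF d] in \<open>auto simp: l2n_nonneg\<close>)
  then have f: "(\<lambda>n. l2n M (\<lambda>x. fst (jet (\<phi>s n) x))) \<longlonglongrightarrow> l2n M (\<lambda>x. fst (U x))"
    by (rule l2n_tendsto[OF sqint_fst(1)[OF J] sqint_fst(1)[OF U]])
  have "(\<lambda>n. l2n M (\<lambda>x. snd (jet (\<phi>s n) x) - snd (U x))) \<longlonglongrightarrow> 0"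
    by (rule tendsto_sandwich[OF _ _ tendsto_const l])
      (use sqint_snd(3)[OF d] in \<open>auto simp: l2n_nonneg\<close>)
  then have s: "(\<lambda>n. l2n M (\<lambda>x. snd (jet (\<phi>s n) x))) \<longlonglongrightarrow> l2n M (\<lambda>x. snd (U x))"
    by (rule l2n_tendsto[OF sqint_snd(1)[OF J] sqint_snd(1)[OF U]])
  show ?thesis
  proof (rule LIMSEQ_le)
    show "(\<lambda>n. B \<sigma> (jet (\<phi>s n)) (jet (\<phi>s n))) \<longlonglongrightarrow> B \<sigma> U U"
      by (rule B_tendsto[OF J U l J U l]) simp
    show "(\<lambda>n. c1 * (l2n M (\<lambda>x. snd (jet (\<phi>s n) x)))\<^sup>2 + \<sigma>\<^sup>2 * (l2n M (\<lambda>x. fst (jet (\<phi>s n) x)))\<^sup>2)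
        \<longlonglongrightarrow> c1 * (l2n M (\<lambda>x. snd (U x)))\<^sup>2 + \<sigma>\<^sup>2 * (l2n M (\<lambda>x. fst (U x)))\<^sup>2"
      by (intro tendsto_intros f s)
  qed (use jet_coercive[OF t] in auto)
qed

end

section \<open>Existence, uniqueness and resolvent bounds\<close>

lemma linear_qcnj: "linear qcnj"
  by (intro linearI) (simp_all add: quat_eq_iff qcnj_nth)

context bounded_open
begin

lemma qinner_nth:
  assumes w: "sqint M w" and v: "sqint M v"
  shows "qinner \<Omega> w v $ i = (\<integral>x. w x \<bullet> qmul (v x) (qcnj (axis i 1)) \<partial>M)"
proof -
  have "continuous_on UNIV (\<lambda>p::quat \<times> quat. qmul (qcnj (fst p)) (snd p))"
  proof (rule bilinear_continuous_on_compose[OF _ _ bilinear_qmul])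
    show "continuous_on UNIV (\<lambda>p::quat \<times> quat. qcnj (fst p))"
      by (rule continuous_on_compose2[OF linear_continuous_on[OF linear_qcnj[unfolded linear_conv_bounded_linear], of UNIV]])
        (auto intro: continuous_intros)
  qed (intro continuous_intros)
  then have "(\<lambda>p::quat \<times> quat. qmul (qcnj (fst p)) (snd p)) \<in> borel_measurable borel"
    by (rule borel_measurable_continuous_onI)
  moreover have "(\<lambda>x. (w x, v x)) \<in> borel_measurable M"
    using w v by (intro borel_measurable_Pair) (auto simp: sqint_def)
  ultimately have "(\<lambda>x. qmul (qcnj (fst (w x, v x))) (snd (w x, v x))) \<in> borel_measurable M"
    by (rule measurable_compose[rotated])
  then have "(\<lambda>x. qmul (qcnj (w x)) (v x)) \<in> borel_measurable M" by simp
  then have "integrable M (\<lambda>x. qmul (qcnj (w x)) (v x))"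
    by (rule Bochner_Integration.integrable_bound[OF sqint_prod_integrable[OF w v]])
      (simp add: norm_qmul norm_qcnj)
  then have "(\<integral>x. qmul (qcnj (w x)) (v x) \<partial>M) $ i = (\<integral>x. qmul (qcnj (w x)) (v x) $ i \<partial>M)"
    by (rule integral_bounded_linear[OF bounded_linear_vec_nth, symmetric])
  then show ?thesis unfolding qinner_def set_integral_M qmul_qcnj_nth .
qed

lemma l2n_Pair_sq:
  fixes U :: "real^3 \<Rightarrow> quat \<times> (quat^3)"
  assumes "sqint M U"
  shows "(l2n M U)\<^sup>2 = (l2n M (\<lambda>x. fst (U x)))\<^sup>2 + (l2n M (\<lambda>x. snd (U x)))\<^sup>2"
proof -
  have "(norm (U x))\<^sup>2 = (norm (fst (U x)))\<^sup>2 + (norm (snd (U x)))\<^sup>2" for x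
    by (simp add: norm_prod_def)
  then show ?thesis
    unfolding l2n_sq using sqint_fst(1)[OF assms] sqint_snd(1)[OF assms] by (simp add: sqint_def)
qed

lemma inner_integrable:
  fixes f g :: "real^3 \<Rightarrow> 'b::euclidean_space"
  shows "sqint M f \<Longrightarrow> sqint M g \<Longrightarrow> integrable M (\<lambda>x. f x \<bullet> g x)"
  by (rule l2form.form_integrable[OF l2form_inner])

lemma inner_integral_bound:
  fixes f g :: "real^3 \<Rightarrow> 'b::euclidean_space"
  assumes "sqint M f" "sqint M g"
  shows "\<bar>\<integral>x. f x \<bullet> g x \<partial>M\<bar> \<le> l2n M f * l2n M g"
  using l2form.form_bound[OF l2form_inner assms] by (simp add: l2form.form_def[OF l2form_inner])

end

context dirichlet
begin

text \<open>Units act from the left and coefficients are real, so the formal adjoint commutes with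
  right multiplication by a constant quaternion.\<close>

lemma Tadjx_qmul:
  assumes "qtest \<Omega> \<phi>"
  shows "qtest \<Omega> (\<lambda>x. qmul (\<phi> x) q)"
    and "Tadjx x (jet (\<lambda>x. qmul (\<phi> x) q) x) = qmul (Tadjx x (jet \<phi> x)) q"
proof -
  show "qtest \<Omega> (\<lambda>x. qmul (\<phi> x) q)" by (rule qtest_linear(1)[OF assms linear_qmul_left])
  have p: "qpd l (\<lambda>x. qmul (\<phi> x) q) x = qmul (qpd l \<phi> x) q" for l
    by (rule qtest_linear(2)[OF assms linear_qmul_left])
  show "Tadjx x (jet (\<lambda>x. qmul (\<phi> x) q) x) = qmul (Tadjx x (jet \<phi> x)) q"
    unfolding Tadjx_def jet_def linear_sum[OF linear_qmul_left]
    by (simp add: p qmul_assoc qmul_add_left qmul_scaleR_left)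
qed

lemma weak_form_nth:
  assumes u: "H1 \<Omega> u" and \<phi>: "qtest \<Omega> \<phi>" and s: "qRe s = 0"
  shows "(qinner \<Omega> (Top \<Omega> a u) (Tadj a \<phi>) - (2 * qRe s) *\<^sub>R qinner \<Omega> (Top \<Omega> a u) \<phi>
       + (norm s)\<^sup>2 *\<^sub>R qinner \<Omega> u \<phi>) $ i = B (norm s) (wjet u) (jet (\<lambda>x. qmul (\<phi> x) (qcnj (axis i 1))))"
proof -
  let ?k = "qcnj (axis i 1)"
  note U = H1_wjet_sqint(3)[OF u] and J = jet_sqint[OF \<phi>]
  have T: "sqint M (Top \<Omega> a u)" unfolding Top_eq[abs_def] by (rule sqint_Tx(1)[OF U])
  have T': "sqint M (Tadj a \<phi>)" unfolding Tadj_eq[abs_def] by (rule sqint_Tadjx[OF J])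
  let ?\<phi> = "\<lambda>x. qmul (\<phi> x) ?k"
  have \<phi>': "qtest \<Omega> ?\<phi>" by (rule Tadjx_qmul(1)[OF \<phi>])
  have i1: "integrable M (\<lambda>x. Top \<Omega> a u x \<bullet> qmul (Tadj a \<phi> x) ?k)"
  proof -
    have "integrable M (\<lambda>x. Tx x (wjet u x) \<bullet> Tadjx x (jet ?\<phi> x))"
      by (rule inner_integrable[OF sqint_Tx(1)[OF U] sqint_Tadjx[OF jet_sqint[OF \<phi>']]])
    then show ?thesis by (simp add: Top_eq Tadj_eq Tadjx_qmul(2)[OF \<phi>])
  qed
  have i2: "integrable M (\<lambda>x. u x \<bullet> ?\<phi> x)"
    by (rule inner_integrable[OF H1_wjet_sqint(1)[OF u] jet_component_sqint(1)[OF \<phi>']])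
  have "B (norm s) (wjet u) (jet ?\<phi>)
      = (\<integral>x. Top \<Omega> a u x \<bullet> qmul (Tadj a \<phi> x) ?k + (norm s)\<^sup>2 * (u x \<bullet> ?\<phi> x) \<partial>M)"
    unfolding B_def b_def Tadjx_qmul(2)[OF \<phi>] by (simp add: Top_eq Tadj_eq wjet_def jet_def)
  also have "\<dots> = (\<integral>x. Top \<Omega> a u x \<bullet> qmul (Tadj a \<phi> x) ?k \<partial>M) + (norm s)\<^sup>2 * (\<integral>x. u x \<bullet> ?\<phi> x \<partial>M)"
    using i1 i2 by simp
  finally show ?thesis
    using s qinner_nth[OF T T'] qinner_nth[OF H1_wjet_sqint(1)[OF u] jet_component_sqint(1)[OF \<phi>]]
    by simp
qed

text \<open>Component \<open>i\<close> of the quaternionic equation is the real equation tested with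
  \<phi> times the conjugate of the i-th unit. The component 0 is the real equation itself, and
  conversely the test functions are stable under these right multiplications.\<close>

lemma weak_sol_iff:
  assumes f: "sqint M f" and s: "qRe s = 0"
  shows "weak_sol \<Omega> a s f u \<longleftrightarrow> H01 \<Omega> u \<and>
    (\<forall>\<phi>. qtest \<Omega> \<phi> \<longrightarrow> B (norm s) (wjet u) (jet \<phi>) = (\<integral>x. f x \<bullet> \<phi> x \<partial>M))"
proof (cases "H01 \<Omega> u")
  case False
  then show ?thesis by (simp add: weak_sol_def)
next
  case True
  then have u: "H1 \<Omega> u" by (simp add: H01_def)
  let ?k = "\<lambda>i. qcnj (axis i 1)"
  have "weak_sol \<Omega> a s f u \<longleftrightarrow> (\<forall>\<phi>. qtest \<Omega> \<phi> \<longrightarrow> (\<forall>i.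
      B (norm s) (wjet u) (jet (\<lambda>x. qmul (\<phi> x) (?k i))) = (\<integral>x. f x \<bullet> qmul (\<phi> x) (?k i) \<partial>M)))"
    unfolding weak_sol_def vec_eq_iff
    using True weak_form_nth[OF u _ s] qinner_nth[OF f jet_component_sqint(1)] by simp
  also have "\<dots> \<longleftrightarrow> (\<forall>\<phi>. qtest \<Omega> \<phi> \<longrightarrow> B (norm s) (wjet u) (jet \<phi>) = (\<integral>x. f x \<bullet> \<phi> x \<partial>M))"
  proof (intro iffI allI impI)
    fix \<phi> assume "\<forall>\<phi>. qtest \<Omega> \<phi> \<longrightarrow> (\<forall>i.
      B (norm s) (wjet u) (jet (\<lambda>x. qmul (\<phi> x) (?k i))) = (\<integral>x. f x \<bullet> qmul (\<phi> x) (?k i) \<partial>M))"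
      and "qtest \<Omega> \<phi>"
    then have "B (norm s) (wjet u) (jet (\<lambda>x. qmul (\<phi> x) (?k 0))) = (\<integral>x. f x \<bullet> qmul (\<phi> x) (?k 0) \<partial>M)"
      by blast
    then show "B (norm s) (wjet u) (jet \<phi>) = (\<integral>x. f x \<bullet> \<phi> x \<partial>M)" by (simp add: qmul_one)
  qed (use Tadjx_qmul(1) in blast)
  finally show ?thesis using True by simp
qed

text \<open>The equation is known for test functions only. Keeping \<open>U\<close> in the first
  slot and letting jets converge to \<open>U\<close> in the second yields B(U,U) = (f,u), to which
  coercivity and Cauchy--Schwarz apply.\<close>

lemma energy:
  assumes U: "jet_closure U" and f: "sqint M f"
    and eq: "\<And>\<phi>. qtest \<Omega> \<phi> \<Longrightarrow> B \<sigma> U (jet \<phi>) = (\<integral>x. f x \<bullet> \<phi> x \<partial>M)"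
  shows "c1 * (l2n M (\<lambda>x. snd (U x)))\<^sup>2 + \<sigma>\<^sup>2 * (l2n M (\<lambda>x. fst (U x)))\<^sup>2 \<le> l2n M f * l2n M (\<lambda>x. fst (U x))"
proof -
  from U obtain \<phi>s where sU: "sqint M U" and t: "\<And>n. qtest \<Omega> (\<phi>s n)" and
    l: "(\<lambda>n. l2n M (\<lambda>x. jet (\<phi>s n) x - U x)) \<longlonglongrightarrow> 0"
    by (auto simp: jet_closure_def)
  note J = jet_sqint[OF t] and d = sqint_diff[OF jet_sqint[OF t] sU]
  have l1: "(\<lambda>n. l2n M (\<lambda>x. \<phi>s n x - fst (U x))) \<longlonglongrightarrow> 0"
    by (rule tendsto_sandwich[OF _ _ tendsto_const l])
      (use sqint_fst(2)[OF d] in \<open>auto simp: l2n_nonneg jet_def\<close>)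
  have zero: "(\<lambda>n::nat. l2n M (\<lambda>x. V x - V x)) \<longlonglongrightarrow> 0" for V :: "real^3 \<Rightarrow> 'b::euclidean_space"
    by (simp add: l2n_def)
  have "(\<lambda>n. B \<sigma> U (jet (\<phi>s n))) \<longlonglongrightarrow> B \<sigma> U U"
    by (rule B_tendsto[OF sU sU zero J sU l]) simp
  moreover have "(\<lambda>n. \<integral>x. f x \<bullet> \<phi>s n x \<partial>M) \<longlonglongrightarrow> (\<integral>x. f x \<bullet> fst (U x) \<partial>M)"
    using l2form.form_tendsto[OF l2form_inner f f zero jet_component_sqint(1)[OF t] sqint_fst(1)[OF sU] l1]
    by (simp add: l2form.form_def[OF l2form_inner])
  ultimately have "B \<sigma> U U = (\<integral>x. f x \<bullet> fst (U x) \<partial>M)"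
    unfolding eq[OF t] by (rule LIMSEQ_unique)
  then show ?thesis
    using closure_coercive[OF U, of \<sigma>] inner_integral_bound[OF f sqint_fst(1)[OF sU]] by linarith
qed

lemma energy_bounds:
  assumes U: "jet_closure U" and f: "sqint M f" and \<sigma>: "0 < \<sigma>"
    and eq: "\<And>\<phi>. qtest \<Omega> \<phi> \<Longrightarrow> B \<sigma> U (jet \<phi>) = (\<integral>x. f x \<bullet> \<phi> x \<partial>M)"
  shows "l2n M (\<lambda>x. fst (U x)) \<le> l2n M f / \<sigma>\<^sup>2"
    and "l2n M (\<lambda>x. snd (U x)) \<le> l2n M f / (\<sigma> * sqrt c1)"
proof -
  let ?u = "l2n M (\<lambda>x. fst (U x))" and ?g = "l2n M (\<lambda>x. snd (U x))" and ?f = "l2n M f"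
  have e: "c1 * ?g\<^sup>2 + \<sigma>\<^sup>2 * ?u\<^sup>2 \<le> ?f * ?u" by (rule energy[OF U f eq])
  have "0 \<le> c1 * ?g\<^sup>2" using c1_pos by simp
  with e have "(\<sigma>\<^sup>2 * ?u) * ?u \<le> ?f * ?u" by (simp add: power2_eq_square)
  then have "\<sigma>\<^sup>2 * ?u \<le> ?f"
    using l2n_nonneg[of M "\<lambda>x. fst (U x)"] l2n_nonneg[of M f]
    by (cases "?u = 0") (auto simp: mult_le_cancel_right)
  then show u: "?u \<le> ?f / \<sigma>\<^sup>2" using \<sigma> by (simp add: field_simps)
  have "0 \<le> \<sigma>\<^sup>2 * ?u\<^sup>2" by simp
  with e have "c1 * ?g\<^sup>2 \<le> ?f * ?u" by linarith
  also have "\<dots> \<le> ?f * (?f / \<sigma>\<^sup>2)" by (intro mult_left_mono u l2n_nonneg)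
  finally have "c1 * ?g\<^sup>2 * \<sigma>\<^sup>2 \<le> ?f\<^sup>2"
    using \<sigma> by (simp add: field_simps power2_eq_square)
  then have "(?g * (\<sigma> * sqrt c1))\<^sup>2 \<le> ?f\<^sup>2"
    using c1_pos by (simp add: power_mult_distrib mult_ac)
  then have "?g * (\<sigma> * sqrt c1) \<le> ?f"
    by (rule power2_le_imp_le) (rule l2n_nonneg)
  then show "?g \<le> ?f / (\<sigma> * sqrt c1)" using \<sigma> c1_pos by (simp add: field_simps)
qed

text \<open>Approximate Lax--Milgram runs on test functions with the real H^1 inner product.
  Solutions with residual 1/(n+1) converge in the L^2 sense of jets, and the limit jet belongs to an
  element of H^1_0.\<close>

lemma weak_sol_exists:
  assumes f: "sqint M f" and \<sigma>: "0 < \<sigma>"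
  shows "\<exists>u. H01 \<Omega> u \<and> (\<forall>\<phi>. qtest \<Omega> \<phi> \<longrightarrow> B \<sigma> (wjet u) (jet \<phi>) = (\<integral>x. f x \<bullet> \<phi> x \<partial>M))"
proof -
  define ip where "ip \<phi> \<psi> = (\<integral>x. jet \<phi> x \<bullet> jet \<psi> x \<partial>M)" for \<phi> \<psi>
  note [simp] = inner_integrable jet_sqint jet_component_sqint
  interpret prehilbert "{\<phi>. qtest \<Omega> \<phi>}" "\<lambda>\<phi> t \<psi> x. \<phi> x + t *\<^sub>R \<psi> x" ip
  proof
    show "ip (\<lambda>x. u x + t *\<^sub>R v x) w = ip u w + t * ip v w"
      if "u \<in> {\<phi>. qtest \<Omega> \<phi>}" "v \<in> {\<phi>. qtest \<Omega> \<phi>}" "w \<in> {\<phi>. qtest \<Omega> \<phi>}" for u v w t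
      using that by (simp add: ip_def qtest_comb(2) inner_add_left)
  qed (auto simp: ip_def qtest_comb(1) inner_commute intro: qtest_zero)
  have nrm: "nrm \<phi> = l2n M (jet \<phi>)" for \<phi>
    by (simp add: nrm_def ip_def l2n_def dot_square_norm)
  have fst_le: "l2n M \<phi> \<le> l2n M (jet \<phi>)" if "qtest \<Omega> \<phi>" for \<phi>
    using sqint_fst(2)[OF jet_sqint[OF that]] by (simp add: jet_def)
  have jet_comb: "jet (\<lambda>x. \<phi> x + t *\<^sub>R \<psi> x) = (\<lambda>x. jet \<phi> x + t *\<^sub>R jet \<psi> x)"
    if "qtest \<Omega> \<phi>" "qtest \<Omega> \<psi>" for \<phi> \<psi> t
    by (rule ext) (rule qtest_comb(2)[OF that])
  define K where "K = 18 * A\<^sup>2 + \<sigma>\<^sup>2"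
  have K: "0 < K" using \<sigma> by (simp add: K_def add_nonneg_pos)
  define c where "c = min c1 (\<sigma>\<^sup>2)"
  have c: "0 < c" using c1_pos \<sigma> by (simp add: c_def)
  have coer: "c * (nrm \<phi>)\<^sup>2 \<le> B \<sigma> (jet \<phi>) (jet \<phi>)" if "qtest \<Omega> \<phi>" for \<phi>
  proof -
    let ?J = "jet \<phi>"
    have "c * (nrm \<phi>)\<^sup>2 = c * (l2n M (\<lambda>x. snd (?J x)))\<^sup>2 + c * (l2n M (\<lambda>x. fst (?J x)))\<^sup>2"
      unfolding nrm l2n_Pair_sq[OF jet_sqint[OF that]] by (simp add: algebra_simps)
    also have "\<dots> \<le> c1 * (l2n M (\<lambda>x. snd (?J x)))\<^sup>2 + \<sigma>\<^sup>2 * (l2n M (\<lambda>x. fst (?J x)))\<^sup>2"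
      by (intro add_mono mult_right_mono) (auto simp: c_def)
    also have "\<dots> \<le> B \<sigma> ?J ?J" by (rule jet_coercive[OF that])
    finally show ?thesis .
  qed
  have ex: "\<exists>u\<in>{\<phi>. qtest \<Omega> \<phi>}. \<forall>v\<in>{\<phi>. qtest \<Omega> \<phi>}.
      \<bar>(\<integral>x. f x \<bullet> v x \<partial>M) - B \<sigma> (jet u) (jet v)\<bar> \<le> e * nrm v" if e: "0 < e" for e
  proof (rule approximate_lax_milgram[where K = "l2n M f" and M = K and c = c])
    show "lin (\<lambda>u. B \<sigma> (jet u) (jet w))" if "w \<in> {\<phi>. qtest \<Omega> \<phi>}" for w
      using that by (auto simp: lin_def jet_comb B_comb_left)
    show "lin (\<lambda>v. B \<sigma> (jet u) (jet v))" if "u \<in> {\<phi>. qtest \<Omega> \<phi>}" for u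
      using that by (auto simp: lin_def jet_comb B_comb_right)
    show "lin (\<lambda>v. \<integral>x. f x \<bullet> v x \<partial>M)"
      using f by (auto simp: lin_def inner_add_right)
    show "\<bar>\<integral>x. f x \<bullet> v x \<partial>M\<bar> \<le> l2n M f * nrm v" if "v \<in> {\<phi>. qtest \<Omega> \<phi>}" for v
      using inner_integral_bound[OF f jet_component_sqint(1), of v]
        mult_left_mono[OF fst_le l2n_nonneg[of M f], of v] that by (auto simp: nrm)
    show "\<bar>B \<sigma> (jet u) (jet v)\<bar> \<le> K * nrm u * nrm v"
      if "u \<in> {\<phi>. qtest \<Omega> \<phi>}" "v \<in> {\<phi>. qtest \<Omega> \<phi>}" for u v
      using B_bound[of "jet u" "jet v" \<sigma>] that by (simp add: nrm K_def mult.assoc)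
  qed (use K c e coer in auto)
  have "\<forall>n. \<exists>u. qtest \<Omega> u \<and> (\<forall>v. qtest \<Omega> v \<longrightarrow>
      \<bar>(\<integral>x. f x \<bullet> v x \<partial>M) - B \<sigma> (jet u) (jet v)\<bar> \<le> inverse (real (Suc n)) * nrm v)"
  proof
    fix n
    have "0 < inverse (real (Suc n))" by simp
    from ex[OF this] show "\<exists>u. qtest \<Omega> u \<and> (\<forall>v. qtest \<Omega> v \<longrightarrow>
        \<bar>(\<integral>x. f x \<bullet> v x \<partial>M) - B \<sigma> (jet u) (jet v)\<bar> \<le> inverse (real (Suc n)) * nrm v)"
      by blast
  qed
  then obtain us where t: "\<And>n. qtest \<Omega> (us n)" and
    res: "\<And>n v. qtest \<Omega> v \<Longrightarrow>
      \<bar>(\<integral>x. f x \<bullet> v x \<partial>M) - B \<sigma> (jet (us n)) (jet v)\<bar> \<le> inverse (real (Suc n)) * nrm v"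
    by metis
  have lim0: "(\<lambda>n. inverse (real (Suc n))) \<longlonglongrightarrow> 0" by (rule LIMSEQ_inverse_real_of_nat)
  have diff: "l2n M (\<lambda>x. jet (us i) x - jet (us j) x) \<le> (inverse (real (Suc i)) + inverse (real (Suc j))) / c" for i j
  proof -
    \<comment> \<open>Both functions nearly solve the same equation, so
      \<open>B \<sigma> (jet w) (jet w)\<close> is at most the sum of the two tolerances times
      \<open>nrm w\<close>; coercivity then bounds \<open>nrm w\<close>.\<close>
    define w where "w x = us i x + (-1) *\<^sub>R us j x" for x
    have w: "qtest \<Omega> w" unfolding w_def by (rule qtest_comb(1)[OF t t])
    have jw: "jet w = (\<lambda>x. jet (us i) x - jet (us j) x)"
      unfolding w_def jet_comb[OF t t] by simp
    have "B \<sigma> (jet w) (jet w) = B \<sigma> (jet (us i)) (jet w) - B \<sigma> (jet (us j)) (jet w)"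
      by (subst (1) jw) (rule B_diff_left[OF jet_sqint[OF t] jet_sqint[OF t] jet_sqint[OF w]])
    then have "c * (nrm w)\<^sup>2 \<le> (inverse (real (Suc i)) + inverse (real (Suc j))) * nrm w"
      using coer[OF w] res[OF w, of i] res[OF w, of j] by (simp add: distrib_right del: of_nat_Suc)
    then have "(c * nrm w) * nrm w \<le> (inverse (real (Suc i)) + inverse (real (Suc j))) * nrm w"
      by (simp add: power2_eq_square del: of_nat_Suc)
    then have "c * nrm w \<le> inverse (real (Suc i)) + inverse (real (Suc j))"
      using l2n_nonneg[of M "jet w"]
      by (cases "nrm w = 0") (auto simp: mult_le_cancel_right nrm simp del: of_nat_Suc)
    then have "nrm w \<le> (inverse (real (Suc i)) + inverse (real (Suc j))) / c"
      using c by (simp add: pos_le_divide_eq mult.commute)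
    then show ?thesis by (simp add: nrm jw)
  qed
  have cauchy: "\<exists>N. \<forall>i\<ge>N. \<forall>j\<ge>N. l2n M (\<lambda>x. jet (us i) x - jet (us j) x) < e" if "0 < e" for e
  proof -
    have "0 < e * c / 2" using that c by simp
    then obtain N where N: "inverse (real (Suc N)) < e * c / 2" using reals_Archimedean by blast
    have "l2n M (\<lambda>x. jet (us i) x - jet (us j) x) < e" if "N \<le> i" "N \<le> j" for i j
    proof -
      have "inverse (real (Suc i)) \<le> inverse (real (Suc N))" "inverse (real (Suc j)) \<le> inverse (real (Suc N))"
        using that by (auto intro!: le_imp_inverse_le)
      with N have "inverse (real (Suc i)) + inverse (real (Suc j)) < e * c" by linarith
      then have "(inverse (real (Suc i)) + inverse (real (Suc j))) / c < e"
        using c by (simp only: pos_divide_less_eq)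
      with diff[of i j] show ?thesis by linarith
    qed
    then show ?thesis by blast
  qed
  obtain U where U: "sqint M U" and l: "(\<lambda>n. l2n M (\<lambda>x. jet (us n) x - U x)) \<longlonglongrightarrow> 0"
    by (rule sqint_complete[OF finite_M jet_sqint[OF t] cauchy], assumption, rule that)
  have cl: "jet_closure U" using U t l by (auto simp: jet_closure_def)
  have eq: "B \<sigma> U (jet \<phi>) = (\<integral>x. f x \<bullet> \<phi> x \<partial>M)" if \<phi>: "qtest \<Omega> \<phi>" for \<phi>
  proof (rule LIMSEQ_unique)
    have zero: "(\<lambda>n::nat. l2n M (\<lambda>x. jet \<phi> x - jet \<phi> x)) \<longlonglongrightarrow> 0" by (simp add: l2n_def)
    show "(\<lambda>n. B \<sigma> (jet (us n)) (jet \<phi>)) \<longlonglongrightarrow> B \<sigma> U (jet \<phi>)"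
      by (rule B_tendsto[OF jet_sqint[OF t] U l jet_sqint[OF \<phi>] jet_sqint[OF \<phi>] zero]) simp
    have "(\<lambda>n. (\<integral>x. f x \<bullet> \<phi> x \<partial>M) - B \<sigma> (jet (us n)) (jet \<phi>)) \<longlonglongrightarrow> 0"
    proof (rule Lim_null_comparison)
      show "(\<lambda>n. inverse (real (Suc n)) * nrm \<phi>) \<longlonglongrightarrow> 0"
        using tendsto_mult_left_zero[OF lim0] .
    qed (use res[OF \<phi>] in \<open>simp del: of_nat_Suc\<close>)
    from tendsto_diff[OF tendsto_const[of "\<integral>x. f x \<bullet> \<phi> x \<partial>M"] this]
    show "(\<lambda>n. B \<sigma> (jet (us n)) (jet \<phi>)) \<longlonglongrightarrow> (\<integral>x. f x \<bullet> \<phi> x \<partial>M)" by simp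
  qed
  let ?u = "\<lambda>x. fst (U x)"
  have h: "H01 \<Omega> ?u" and ae: "AE x in M. wjet ?u x = U x" using jet_closure_H01[OF cl] by auto
  have sw: "sqint M (wjet ?u)" using h H1_wjet_sqint(3) by (auto simp: H01_def)
  \<comment> \<open>The gradient part of \<open>U\<close> and the chosen weak gradient of
    \<open>?u\<close> may differ on a null set, which the integral ignores.\<close>
  have "B \<sigma> (wjet ?u) (jet \<phi>) = B \<sigma> U (jet \<phi>)" if \<phi>: "qtest \<Omega> \<phi>" for \<phi>
    unfolding B_def
  proof (rule integral_cong_AE)
    show "AE x in M. b \<sigma> x (wjet ?u x) (jet \<phi> x) = b \<sigma> x (U x) (jet \<phi> x)"
      using ae by eventually_elim simp
  qed (use b_integrable[OF sw jet_sqint[OF \<phi>]] b_integrable[OF U jet_sqint[OF \<phi>]] in auto)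
  with h eq show ?thesis by (intro exI[of _ ?u]) simp
qed

lemma weak_sol_bounds:
  assumes f: "sqint M f" and s: "qRe s = 0" "s \<noteq> 0" and u: "weak_sol \<Omega> a s f u"
  shows "sqint M u" "l2n M u \<le> l2n M f / (norm s)\<^sup>2"
    "sqint M (Top \<Omega> a u)" "l2n M (Top \<Omega> a u) \<le> 3 * A * (l2n M f / (norm s * sqrt c1))"
proof -
  have h: "H01 \<Omega> u" and eq: "\<And>\<phi>. qtest \<Omega> \<phi> \<Longrightarrow> B (norm s) (wjet u) (jet \<phi>) = (\<integral>x. f x \<bullet> \<phi> x \<partial>M)"
    using u weak_sol_iff[OF f s(1)] by auto
  have h1: "H1 \<Omega> u" using h by (simp add: H01_def)
  note eb = energy_bounds[OF H01_jet_closure[OF h] f _ eq]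
  show "sqint M u" by (rule H1_wjet_sqint(1)[OF h1])
  show "l2n M u \<le> l2n M f / (norm s)\<^sup>2" using eb(1) s by (simp add: wjet_def)
  show "sqint M (Top \<Omega> a u)" unfolding Top_eq[abs_def] by (rule sqint_Tx(1)[OF H1_wjet_sqint(3)[OF h1]])
  have "l2n M (Top \<Omega> a u) \<le> 3 * A * l2n M (\<lambda>x. snd (wjet u x))"
    unfolding Top_eq[abs_def] by (rule sqint_Tx(2)[OF H1_wjet_sqint(3)[OF h1]])
  also have "\<dots> \<le> 3 * A * (l2n M f / (norm s * sqrt c1))"
    using eb(2) s A_nonneg by (intro mult_left_mono) auto
  finally show "l2n M (Top \<Omega> a u) \<le> 3 * A * (l2n M f / (norm s * sqrt c1))" .
qed

text \<open>The difference solves the problem with f = 0. It is taken at the level of jets, since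
  \<open>wpd\<close> is a choice and need not be additive pointwise.\<close>

lemma weak_sol_unique:
  assumes f: "sqint M f" and s: "qRe s = 0" "s \<noteq> 0" and u: "weak_sol \<Omega> a s f u" and v: "weak_sol \<Omega> a s f v"
  shows "AE x in lebesgue. x \<in> \<Omega> \<longrightarrow> u x = v x"
proof -
  have hu: "H01 \<Omega> u" and equ: "\<And>\<phi>. qtest \<Omega> \<phi> \<Longrightarrow> B (norm s) (wjet u) (jet \<phi>) = (\<integral>x. f x \<bullet> \<phi> x \<partial>M)"
    using u weak_sol_iff[OF f s(1)] by auto
  have hv: "H01 \<Omega> v" and eqv: "\<And>\<phi>. qtest \<Omega> \<phi> \<Longrightarrow> B (norm s) (wjet v) (jet \<phi>) = (\<integral>x. f x \<bullet> \<phi> x \<partial>M)"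
    using v weak_sol_iff[OF f s(1)] by auto
  let ?U = "\<lambda>x. wjet u x - wjet v x"
  have cl: "jet_closure ?U" by (intro jet_closure_diff H01_jet_closure hu hv)
  have su: "sqint M (wjet u)" "sqint M (wjet v)" "sqint M u" "sqint M v"
    using hu hv H1_wjet_sqint by (auto simp: H01_def)
  have z: "sqint M (\<lambda>x. 0 :: quat)" by (simp add: sqint_def)
  have eq: "B (norm s) ?U (jet \<phi>) = (\<integral>x. 0 \<bullet> \<phi> x \<partial>M)" if "qtest \<Omega> \<phi>" for \<phi>
    using B_diff_left[OF su(1,2) jet_sqint[OF that], of "norm s"] equ[OF that] eqv[OF that] by simp
  have "l2n M (\<lambda>x. fst (?U x)) \<le> l2n M (\<lambda>x. 0 :: quat) / (norm s)\<^sup>2"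
    by (rule energy_bounds(1)[OF cl z _ eq]) (use s in auto)
  then have "l2n M (\<lambda>x. u x - v x) \<le> 0" by (simp add: wjet_def l2n_def)
  then have "l2n M (\<lambda>x. u x - v x) = 0" using l2n_nonneg[of M "\<lambda>x. u x - v x"] by linarith
  then have "AE x in M. u x - v x = 0" by (rule l2n_zero_AE[OF sqint_diff[OF su(3,4)]])
  then show ?thesis using \<Omega>_sets by (subst (asm) AE_restrict_space_iff) auto
qed

lemma Qinv_weak_sol:
  assumes "sqint M f" "qRe s = 0" "s \<noteq> 0"
  shows "weak_sol \<Omega> a s f (Qinv \<Omega> a s f)"
proof -
  have "\<exists>u. weak_sol \<Omega> a s f u"
    using weak_sol_exists[OF assms(1), of "norm s"] weak_sol_iff[OF assms(1,2)] assms(3) by auto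
  then show ?thesis unfolding Qinv_def by (rule someI_ex)
qed

lemma resolvent_set:
  assumes s: "qRe s = 0" "s \<noteq> 0"
  shows "s \<in> rho_S \<Omega> a"
proof -
  have "l2n M (Qinv \<Omega> a s f) \<le> 1 / (norm s)\<^sup>2 * l2n M f" if "sqint M f" for f
    using weak_sol_bounds(2)[OF that s Qinv_weak_sol[OF that s]] by simp
  then show ?thesis
    unfolding rho_S_def L2_iff_sqint L2norm_eq_l2n
    using Qinv_weak_sol[OF _ s] weak_sol_unique[OF _ s] by blast
qed

text \<open>The term with conj(s) costs a factor |s| against the bound 1/|s|^2 for the inverse, and
  T applied to the inverse is bounded by 3 A / (|s| sqrt c1). The sum is \<Theta>/|s|, with \<Theta>
  free of \<open>s\<close>.\<close>

lemma resolvent_bounds: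
  assumes s: "qRe s = 0" "s \<noteq> 0" and f: "sqint M f"
  defines "\<Theta> \<equiv> 1 + 3 * A / sqrt c1"
  shows "sqint M (SL \<Omega> a s f)" "l2n M (SL \<Omega> a s f) \<le> \<Theta> / norm s * l2n M f"
    "sqint M (SR \<Omega> a s f)" "l2n M (SR \<Omega> a s f) \<le> \<Theta> / norm s * l2n M f"
proof -
  let ?q = "\<lambda>u x. qmul (qcnj s) (u x)"
  have q: "sqint M (?q u)" "l2n M (?q u) \<le> norm s * l2n M u" if "sqint M u" for u
  proof -
    have m: "?q u \<in> borel_measurable M"
      by (rule measurable_linear_image[OF linear_qmul_right sqint_measurable[OF that]])
    have n: "norm (?q u x) \<le> norm s * norm (u x)" for x by (simp add: norm_qmul norm_qcnj)
    show "sqint M (?q u)" "l2n M (?q u) \<le> norm s * l2n M u"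
      using sqint_bound[OF that m n] l2n_bound[OF that m n] by auto
  qed
  have ns: "0 < norm s" using s by simp
  note b1 = weak_sol_bounds[OF f s Qinv_weak_sol[OF f s]]
  \<comment> \<open>In the left resolvent conj(s) acts before the inverse, so a second weak
    solution, with right-hand side conj(s) f, is estimated.\<close>
  note b2 = weak_sol_bounds[OF q(1)[OF f] s Qinv_weak_sol[OF q(1)[OF f] s]]
  have \<Theta>: "\<Theta> / norm s * l2n M f = l2n M f / norm s + 3 * A * (l2n M f / (norm s * sqrt c1))"
    using ns c1_pos by (simp add: \<Theta>_def field_simps)
  have "l2n M (?q f) / (norm s)\<^sup>2 \<le> norm s * l2n M f / (norm s)\<^sup>2"
    using q(2)[OF f] by (intro divide_right_mono) auto
  also have "\<dots> = l2n M f / norm s" using ns by (simp add: power2_eq_square)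
  finally have 1: "l2n M (Qinv \<Omega> a s (?q f)) \<le> l2n M f / norm s" using b2(2) by linarith
  have "l2n M (?q (Qinv \<Omega> a s f)) \<le> norm s * (l2n M f / (norm s)\<^sup>2)"
    using q(2)[OF b1(1)] mult_left_mono[OF b1(2), of "norm s"] by simp
  also have "\<dots> = l2n M f / norm s" using ns by (simp add: power2_eq_square)
  finally have 2: "l2n M (?q (Qinv \<Omega> a s f)) \<le> l2n M f / norm s" .
  have SL: "SL \<Omega> a s f = (\<lambda>x. Qinv \<Omega> a s (?q f) x - Top \<Omega> a (Qinv \<Omega> a s f) x)"
    by (auto simp: SL_def)
  have SR: "SR \<Omega> a s f = (\<lambda>x. ?q (Qinv \<Omega> a s f) x - Top \<Omega> a (Qinv \<Omega> a s f) x)"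
    by (auto simp: SR_def)
  show "sqint M (SL \<Omega> a s f)" unfolding SL by (rule sqint_diff[OF b2(1) b1(3)])
  show "sqint M (SR \<Omega> a s f)" unfolding SR by (rule sqint_diff[OF q(1)[OF b1(1)] b1(3)])
  show "l2n M (SL \<Omega> a s f) \<le> \<Theta> / norm s * l2n M f"
    unfolding SL \<Theta> using l2n_diff[OF b2(1) b1(3)] 1 b1(4) by linarith
  show "l2n M (SR \<Omega> a s f) \<le> \<Theta> / norm s * l2n M f"
    unfolding SR \<Theta> using l2n_diff[OF q(1)[OF b1(1)] b1(3)] 2 b1(4) by linarith
qed

end

section \<open>From the hypotheses to the constants, and the conclusion\<close>

theorem theorem4p1:
  fixes \<Omega> :: "(real^3) set" and a :: "3 \<Rightarrow> real \<Rightarrow> real" and C\<Omega> :: real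
  assumes dom: "bounded_smooth_domain \<Omega>"
    and C1: "\<forall>l. a l C1_differentiable_on ((\<lambda>x. x$l) ` closure \<Omega>)"
    and PC: "poincare_const \<Omega> C\<Omega>"
    and H1: "\<forall>l. (INF x\<in>\<Omega>. (a l (x$l))\<^sup>2)
                 - sqrt C\<Omega> / 2 * (SUP x\<in>\<Omega>. \<bar>deriv (\<lambda>t. (a l t)\<^sup>2) (x$l)\<bar>) > 0"
    and H2: "1/2 - 1/2 * (SUP x\<in>\<Omega>. norm (Phi a x))\<^sup>2 * C\<Omega>\<^sup>2 * (Ca \<Omega> a)\<^sup>2 > 0"
  shows "(\<forall>s::quat. s \<noteq> 0 \<and> qRe s = 0 \<longrightarrow> s \<in> rho_S \<Omega> a) \<and>
         (\<exists>\<Theta>>0. \<forall>s::quat. s \<noteq> 0 \<and> qRe s = 0 \<longrightarrow>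
            (\<forall>f. L2 \<Omega> f \<longrightarrow>
               L2 \<Omega> (SL \<Omega> a s f) \<and> L2norm \<Omega> (SL \<Omega> a s f) \<le> \<Theta> / norm s * L2norm \<Omega> f \<and>
               L2 \<Omega> (SR \<Omega> a s f) \<and> L2norm \<Omega> (SR \<Omega> a s f) \<le> \<Theta> / norm s * L2norm \<Omega> f))"
proof -
  have \<Omega>: "open \<Omega>" "bounded \<Omega>" "\<Omega> \<noteq> {}"
    using dom by (auto simp: bounded_smooth_domain_def)
  \<comment> \<open>The coordinate projections of the closure are compact, so \<open>a l\<close> and
    its derivative are bounded on them; this produces \<open>A\<close>.\<close>
  define S where "S l = (\<lambda>x. x$l) ` closure \<Omega>" for l :: 3
  have S: "compact (S l)" for l
    unfolding S_def using \<Omega>(2) by (intro compact_continuous_image continuous_intros) (simp add: compact_closure)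
  have inS: "x$l \<in> S l" if "x \<in> \<Omega>" for x l using that closure_subset by (auto simp: S_def)
  have "\<forall>l. \<exists>D. (\<forall>t\<in>S l. (a l has_real_derivative D t) (at t)) \<and> continuous_on (S l) D"
    using C1 unfolding C1_differentiable_on_def has_real_derivative_iff_has_vector_derivative S_def .
  then obtain D where D: "\<And>l t. t \<in> S l \<Longrightarrow> (a l has_real_derivative D l t) (at t)"
    "\<And>l. continuous_on (S l) (D l)" by metis
  have dD: "deriv (a l) t = D l t" if "t \<in> S l" for l t using D(1)[OF that] by (rule DERIV_imp_deriv)
  have cont_a: "continuous_on (S l) (a l)" for l
    using D(1) by (intro continuous_at_imp_continuous_on ballI DERIV_isCont)
  have "\<exists>A. \<forall>t\<in>S l. \<bar>a l t\<bar> \<le> A \<and> \<bar>D l t\<bar> \<le> A" for l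
  proof -
    have "bounded (a l ` S l)" "bounded (D l ` S l)"
      using compact_continuous_image[OF cont_a S] compact_continuous_image[OF D(2) S]
      by (auto intro: compact_imp_bounded)
    then obtain A1 A2 where "\<forall>y\<in>a l ` S l. \<bar>y\<bar> \<le> A1" "\<forall>y\<in>D l ` S l. \<bar>y\<bar> \<le> A2"
      unfolding bounded_iff real_norm_def by blast
    then show ?thesis by (intro exI[of _ "max A1 A2"]) (auto intro: max.coboundedI1 max.coboundedI2)
  qed
  then obtain A' where A': "\<And>l t. t \<in> S l \<Longrightarrow> \<bar>a l t\<bar> \<le> A' l \<and> \<bar>D l t\<bar> \<le> A' l" by metis
  define A where "A = (\<Sum>l\<in>UNIV. \<bar>A' l\<bar>)"
  have A'A: "A' l \<le> A" for l
    unfolding A_def using member_le_sum[of l UNIV "\<lambda>l. \<bar>A' l\<bar>"] by (auto intro: order_trans[OF abs_ge_self])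
  have A0: "0 \<le> A" by (auto simp: A_def intro: sum_nonneg)
  have aA: "\<bar>a l (x$l)\<bar> \<le> A" "\<bar>deriv (a l) (x$l)\<bar> \<le> A" if "x \<in> \<Omega>" for x l
    using A'[OF inS[OF that, of l]] A'A[of l] dD[OF inS[OF that, of l]] by auto
  define m where "m = (INF p\<in>\<Omega> \<times> UNIV. \<bar>a (snd p) (fst p $ snd p)\<bar>)"
  have m_le: "m \<le> \<bar>a l (x$l)\<bar>" if "x \<in> \<Omega>" for x l
  proof -
    have "m \<le> \<bar>a (snd (x, l)) (fst (x, l) $ snd (x, l))\<bar>"
      unfolding m_def by (rule cINF_lower) (use that in \<open>auto intro!: bdd_belowI2[of _ 0]\<close>)
    then show ?thesis by simp
  qed
  define i where "i l = (INF x\<in>\<Omega>. (a l (x$l))\<^sup>2)" for l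
  have i_pos: "0 < i l" for l
  proof -
    \<comment> \<open>The supremum in the first assumption dominates its values only once the family
      is known to be bounded. The subtracted term is then nonnegative, and the infimum of the
      squared coefficient is positive.\<close>
    have d: "\<bar>deriv (\<lambda>t. (a l t)\<^sup>2) (x$l)\<bar> \<le> 2 * (A * A)" if "x \<in> \<Omega>" for x
    proof -
      have "((\<lambda>t. (a l t)\<^sup>2) has_real_derivative 2 * (a l (x$l) * D l (x$l))) (at (x$l))"
        using DERIV_power[OF D(1)[OF inS[OF that, of l]], of 2] by (simp add: mult_ac)
      then have "deriv (\<lambda>t. (a l t)\<^sup>2) (x$l) = 2 * (a l (x$l) * deriv (a l) (x$l))"
        using dD[OF inS[OF that, of l]] by (simp add: DERIV_imp_deriv)
      then show ?thesis
        using aA[OF that, of l] A0 by (simp add: abs_mult mult_mono)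
    qed
    obtain x0 where x0: "x0 \<in> \<Omega>" using \<Omega>(3) by blast
    have "0 \<le> \<bar>deriv (\<lambda>t. (a l t)\<^sup>2) (x0$l)\<bar>" by simp
    also have "\<dots> \<le> (SUP x\<in>\<Omega>. \<bar>deriv (\<lambda>t. (a l t)\<^sup>2) (x$l)\<bar>)"
      by (rule cSUP_upper[OF x0]) (use d in \<open>auto intro!: bdd_aboveI2\<close>)
    finally have "0 \<le> sqrt C\<Omega> / 2 * (SUP x\<in>\<Omega>. \<bar>deriv (\<lambda>t. (a l t)\<^sup>2) (x$l)\<bar>)"
      using PC by (simp add: poincare_const_def)
    with H1[rule_format, of l] show ?thesis by (simp add: i_def)
  qed
  have m_pos: "0 < m"
  proof -
    \<comment> \<open>Only three directions occur, so the separate lower bounds have a positive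
      minimum.\<close>
    let ?r = "Min (range (\<lambda>l. sqrt (i l)))"
    have "0 < ?r" using i_pos by (subst Min_gr_iff) auto
    also have "?r \<le> m"
      unfolding m_def
    proof (rule cINF_greatest)
      fix p assume p: "p \<in> \<Omega> \<times> (UNIV :: 3 set)"
      have "i (snd p) \<le> (a (snd p) (fst p $ snd p))\<^sup>2"
        unfolding i_def by (rule cINF_lower) (use p in \<open>auto intro!: bdd_belowI2[of _ 0]\<close>)
      then have "sqrt (i (snd p)) \<le> \<bar>a (snd p) (fst p $ snd p)\<bar>"
        using real_sqrt_le_mono by fastforce
      moreover have "?r \<le> sqrt (i (snd p))" by (intro Min_le) auto
      ultimately show "?r \<le> \<bar>a (snd p) (fst p $ snd p)\<bar>" by linarith
    qed (use \<Omega>(3) in auto)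
    finally show ?thesis .
  qed
  define P where "P = (SUP x\<in>\<Omega>. norm (Phi a x))"
  have "norm (Phi a x) \<le> (\<Sum>l\<in>(UNIV::3 set). A)" if "x \<in> \<Omega>" for x
    unfolding Phi_def by (rule sum_norm_le) (use aA(2)[OF that] in \<open>simp add: norm_qe\<close>)
  then have P_ge: "norm (Phi a x) \<le> P" if "x \<in> \<Omega>" for x
    unfolding P_def using that by (intro cSUP_upper bdd_aboveI2) auto
  have Ca: "Ca \<Omega> a = 1 / m" by (simp add: Ca_def m_def)
  \<comment> \<open>The second assumption multiplied by 2 m^2, using
    \<open>Ca \<Omega> a = 1 / m\<close>.\<close>
  have small: "P\<^sup>2 * C\<Omega>\<^sup>2 < m\<^sup>2"
    using H2 m_pos unfolding Ca P_def[symmetric] by (simp add: field_simps power_divide)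
  interpret dirichlet \<Omega> a m A P C\<Omega>
  proof
    show "(a l has_real_derivative deriv (a l) (x$l)) (at (x$l))" if "x \<in> \<Omega>" for x l
      using D(1)[OF inS[OF that]] dD[OF inS[OF that]] by simp
    have "continuous_on \<Omega> (\<lambda>x. D l (x$l))" for l
      by (rule continuous_on_compose2[OF D(2)[of l]]) (auto intro!: continuous_intros inS)
    then show "continuous_on \<Omega> (\<lambda>x. deriv (a l) (x$l))" for l
      by (rule continuous_on_eq) (simp add: dD inS)
  qed (use \<Omega> m_pos m_le A0 aA P_ge PC small in auto)
  show ?thesis
  proof (intro conjI allI impI)
    show "s \<in> rho_S \<Omega> a" if "s \<noteq> 0 \<and> qRe s = 0" for s
      using that by (intro resolvent_set) auto
    show "\<exists>\<Theta>>0. \<forall>s::quat. s \<noteq> 0 \<and> qRe s = 0 \<longrightarrow>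
            (\<forall>f. L2 \<Omega> f \<longrightarrow>
               L2 \<Omega> (SL \<Omega> a s f) \<and> L2norm \<Omega> (SL \<Omega> a s f) \<le> \<Theta> / norm s * L2norm \<Omega> f \<and>
               L2 \<Omega> (SR \<Omega> a s f) \<and> L2norm \<Omega> (SR \<Omega> a s f) \<le> \<Theta> / norm s * L2norm \<Omega> f)"
    proof (rule exI[of _ "1 + 3 * A / sqrt c1"], intro conjI allI impI)
      show "0 < 1 + 3 * A / sqrt c1" using A0 c1_pos by (simp add: add_pos_nonneg)
    qed (use resolvent_bounds in \<open>auto simp: L2_iff_sqint L2norm_eq_l2n\<close>)
  qed
qed

end
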